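(* Let $k$ be a perfect ring of characteristic $p > 2$, let $A = W(k)$, and let $E_{\cdot}^{\bullet}$ be the complex, with its structure maps $\lambda, R, d, F, V$, defined in the context: $E_n^0 = W_n(A)$, $E_n^1 = \prod_{i=0}^{n-1} A/p^iA \cdot dV^i(1)$, and $E_n^d = 0$ for $d \geq 2$ (for all $n \geq 1$). Then $E_{\cdot}^{\bullet}$ is a Witt complex over $A$.
   Context: $W$, $W_n$ denote $p$-typical Witt vectors. $\varphi: A \to A$ is the Witt vector Frobenius of $A = W(k)$ (an automorphism), while $F, V$ denote Frobenius and Verschiebung on $W(A)$. There is a unique ring homomorphism $s_\varphi: A \to W(A)$ with $F\circ s_\varphi = s_\varphi\circ\varphi$ and such that $s_\varphi(a)$ has ghost components $(a, \varphi(a), \varphi^2(a), \ldots)$; its composite with $W(A)\to W_n(A)$ is also written $s_\varphi$. Every element of $W_n(A)$ is uniquely of the form $\sum_{i=0}^{n-1} s_\varphi(a_i) V^i(1)$ with $a_i \in A$. Definition of $E_\cdot^\bullet$. As abelian groups, for $n\ge 1$: $E_n^0 := W_n(A)$; $E_n^1 := \prod_{i=0}^{n-1} A/p^iA \cdot dV^i(1)$, where $dV^i(1)$ is a formal basis symbol; $E_n^d := 0$ for $d\ge 2$. The ring structure on $E_n^0$ and its maps $R, F, V$ are the usual ones, and $\lambda: W_n(A) \to E_n^0$ is the identity. The product $E_n^0\times E_n^1\to E_n^1$ is given by letting $W_n(A)$ act on the factor $A/p^iA$ through the ring homomorphism $W_n(A)\to A/p^iA$, $\sum_{j=0}^{n-1}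 s_\varphi(a_j)V^j(1)\mapsto \sum_{j=0}^{n-1} a_jp^j$. The remaining maps are: $d: E_n^0\to E_n^1$, $d\left(\sum_{i=0}^{n-1} s_\varphi(a_i)V^i(1)\right) = \sum_{i=1}^{n-1} a_i\cdot dV^i(1)$; $R: E_{n+1}^1\to E_n^1$, $R\left(\sum_{i=0}^{n} a_i\cdot dV^i(1)\right) = \sum_{i=0}^{n-1} a_i\cdot dV^i(1)$; $F: E_{n+1}^1\to E_n^1$, $F\left(\sum_{i=1}^{n} a_i\cdot dV^i(1)\right) = \sum_{i=0}^{n-1}\varphi(a_{i+1})\cdot dV^i(1)$; $V: E_n^1\to E_{n+1}^1$, $V\left(\sum_{i=1}^{n-1} a_i\cdot dV^i(1)\right) = \sum_{i=1}^{n-1} p\varphi^{-1}(a_i)\cdot dV^{i+1}(1)$. A Witt complex over a $\mathbf{Z}_{(p)}$-algebra $R$ ($p$ odd) consists of: (i) a pro-differential graded ring $E^{\bullet}_{\cdot} = (E_n^{\bullet})_{n \ge 1}$ (each $E_n^\bullet$ a graded-commutative differential graded ring in non-negative degrees, with restriction maps $E_{n+1}^\bullet \to E_n^\bullet$) and a strict map of pro-rings $\lambda: W_{\cdot}(R) \to E^0_{\cdot}$; (ii) a strict map of pro-graded rings $F: E_{\cdot}^{\bullet} \to E_{\cdot-1}^{\bullet}$ with $F\lambda = \lambda F$ and $F d\lambda([r]) = \lambda([r]^{p-1})\, d\lambda([r])$ for all $r \in R$ ($[r]$ the Teichmüller lift); (iii) a strict map of graded $E_{\cdot}^{\bullet}$-modules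 $V: F_*E_{\cdot-1}^{\bullet} \to E_{\cdot}^{\bullet}$ (i.e. additive with $V(F(\omega)\eta) = \omega V(\eta)$, and similarly on the right) with $V\lambda = \lambda V$, $FdV = d$, $FV = p$. "Strict" means commuting with the restriction maps. *)

theory Defs
  imports
    "HOL-Algebra.QuotRing"
    "HOL-Algebra.Product_Groups"
    "HOL-Computational_Algebra.Primes"
    "HOL-Library.Poly_Mapping"
    "HOL-Library.FuncSet"
begin

section \<open>Rings\<close>

text \<open>The zero ring is not excluded here: a ring of characteristic \<open>p\<close> is an
  \<open>\<bbbF>\<^sub>p\<close>-algebra.\<close>

definition perfect_ring_of_char :: "nat \<Rightarrow> ('a, 'b) ring_scheme \<Rightarrow> bool" where
  "perfect_ring_of_char p k \<longleftrightarrow>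
     cring k \<and> [p] \<cdot>\<^bsub>k\<^esub> \<one>\<^bsub>k\<^esub> = \<zero>\<^bsub>k\<^esub> \<and>
     bij_betw (\<lambda>x. x [^]\<^bsub>k\<^esub> p) (carrier k) (carrier k)"

definition integers_localized_at :: "nat \<Rightarrow> rat ring" where
  "integers_localized_at p =
     \<lparr>carrier = {of_int a / of_int b | a b :: int. \<not> int p dvd b},
      monoid.mult = (*), one = 1, zero = 0, add = (+)\<rparr>"


section \<open>Universal Witt polynomials\<close>

type_synonym 'v int_mpoly = "('v \<Rightarrow>\<^sub>0 nat) \<Rightarrow>\<^sub>0 int"

definition mpoly_var :: "'v \<Rightarrow> 'v int_mpoly" where
  "mpoly_var v = Poly_Mapping.single (Poly_Mapping.single v 1) 1"

definition mpoly_eval :: "('a, 'b) ring_scheme \<Rightarrow> ('v \<Rightarrow> 'a) \<Rightarrow> 'v int_mpoly \<Rightarrow> 'a" where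
  "mpoly_eval R f P =
     (\<Oplus>\<^bsub>R\<^esub>m\<in>Poly_Mapping.keys P.
        [(Poly_Mapping.lookup P m)] \<cdot>\<^bsub>R\<^esub>
          (\<Otimes>\<^bsub>R\<^esub>v\<in>Poly_Mapping.keys m. f v [^]\<^bsub>R\<^esub> Poly_Mapping.lookup m v))"

definition ghost_poly :: "nat \<Rightarrow> (nat \<Rightarrow> 'r::comm_ring_1) \<Rightarrow> nat \<Rightarrow> 'r" where
  "ghost_poly p x n = (\<Sum>i\<le>n. of_nat p ^ i * x i ^ (p ^ (n - i)))"

text \<open>The two families of variables \<open>X\<close> and \<open>Y\<close> are indexed by \<open>Inl\<close> and \<open>Inr\<close>. The
  descriptions are definite for prime \<open>p\<close>: uniqueness holds because the polynomial rings are
  torsion-free, existence is the classical theorem of Witt.\<close>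

definition witt_add_poly :: "nat \<Rightarrow> nat \<Rightarrow> (nat + nat) int_mpoly" where
  "witt_add_poly p = (THE S. \<forall>n. ghost_poly p S n =
     ghost_poly p (\<lambda>i. mpoly_var (Inl i)) n + ghost_poly p (\<lambda>i. mpoly_var (Inr i)) n)"

definition witt_mult_poly :: "nat \<Rightarrow> nat \<Rightarrow> (nat + nat) int_mpoly" where
  "witt_mult_poly p = (THE S. \<forall>n. ghost_poly p S n =
     ghost_poly p (\<lambda>i. mpoly_var (Inl i)) n * ghost_poly p (\<lambda>i. mpoly_var (Inr i)) n)"

definition witt_frob_poly :: "nat \<Rightarrow> nat \<Rightarrow> nat int_mpoly" where
  "witt_frob_poly p = (THE S. \<forall>n. ghost_poly p S n = ghost_poly p mpoly_var (Suc n))"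


section \<open>Rings of \<open>p\<close>-typical Witt vectors\<close>

text \<open>The index set \<open>I\<close> is \<open>UNIV\<close> for \<open>W(R)\<close> and \<open>{..<n}\<close> for \<open>W\<^sub>n(R)\<close>. A truncated Witt vector
  is an extensional function, so the restriction maps are \<open>\<lambda>x. restrict x {..<n}\<close>.\<close>

definition witt_ring_on :: "nat \<Rightarrow> ('a, 'b) ring_scheme \<Rightarrow> nat set \<Rightarrow> (nat \<Rightarrow> 'a) ring" where
  "witt_ring_on p R I =
     \<lparr>carrier = I \<rightarrow>\<^sub>E carrier R,
      monoid.mult = (\<lambda>x y. \<lambda>i\<in>I. mpoly_eval R (case_sum x y) (witt_mult_poly p i)),
      one = (\<lambda>i\<in>I. if i = 0 then \<one>\<^bsub>R\<^esub> else \<zero>\<^bsub>R\<^esub>),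
      zero = (\<lambda>i\<in>I. \<zero>\<^bsub>R\<^esub>),
      add = (\<lambda>x y. \<lambda>i\<in>I. mpoly_eval R (case_sum x y) (witt_add_poly p i))\<rparr>"

abbreviation witt_ring :: "nat \<Rightarrow> ('a, 'b) ring_scheme \<Rightarrow> (nat \<Rightarrow> 'a) ring" where
  "witt_ring p R \<equiv> witt_ring_on p R UNIV"

abbreviation witt_ring_trunc :: "nat \<Rightarrow> ('a, 'b) ring_scheme \<Rightarrow> nat \<Rightarrow> (nat \<Rightarrow> 'a) ring" where
  "witt_ring_trunc p R n \<equiv> witt_ring_on p R {..<n}"

text \<open>In \<open>witt_frob\<close> and \<open>witt_ver\<close> the set \<open>I\<close> is the index set of the target: with
  \<open>I = {..<n}\<close> they are \<open>F : W\<^sub>n\<^sub>+\<^sub>1(R) \<rightarrow> W\<^sub>n(R)\<close> and \<open>V : W\<^sub>n\<^sub>-\<^sub>1(R) \<rightarrow> W\<^sub>n(R)\<close>.\<close>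

definition witt_frob :: "nat \<Rightarrow> ('a, 'b) ring_scheme \<Rightarrow> nat set \<Rightarrow> (nat \<Rightarrow> 'a) \<Rightarrow> (nat \<Rightarrow> 'a)" where
  "witt_frob p R I x = (\<lambda>i\<in>I. mpoly_eval R x (witt_frob_poly p i))"

definition witt_ver :: "('a, 'b) ring_scheme \<Rightarrow> nat set \<Rightarrow> (nat \<Rightarrow> 'a) \<Rightarrow> (nat \<Rightarrow> 'a)" where
  "witt_ver R I x = (\<lambda>i\<in>I. case i of 0 \<Rightarrow> \<zero>\<^bsub>R\<^esub> | Suc j \<Rightarrow> x j)"

definition teichmueller :: "('a, 'b) ring_scheme \<Rightarrow> nat set \<Rightarrow> 'a \<Rightarrow> (nat \<Rightarrow> 'a)" where
  "teichmueller R I r = (\<lambda>i\<in>I. if i = 0 then r else \<zero>\<^bsub>R\<^esub>)"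

definition ghost_component :: "nat \<Rightarrow> ('a, 'b) ring_scheme \<Rightarrow> nat \<Rightarrow> (nat \<Rightarrow> 'a) \<Rightarrow> 'a" where
  "ghost_component p R n x = (\<Oplus>\<^bsub>R\<^esub>i\<in>{..n}. [(p ^ i)] \<cdot>\<^bsub>R\<^esub> (x i [^]\<^bsub>R\<^esub> (p ^ (n - i))))"


section \<open>Witt complexes\<close>

text \<open>A graded ring is a ring that is the internal direct sum of additive subgroups \<open>gr i\<close>.\<close>

locale graded_commutative_dg_ring = ring E
  for E :: "('e, 'm) ring_scheme" (structure) +
  fixes gr :: "nat \<Rightarrow> 'e set" and d :: "'e \<Rightarrow> 'e"
  assumes gr_subgroup: "additive_subgroup (gr i) E"
    and gr_direct_sum: "x \<in> carrier E \<Longrightarrow>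
      \<exists>!c. (\<forall>i. c i \<in> gr i) \<and> finite {i. c i \<noteq> \<zero>} \<and> x = (\<Oplus>i\<in>{i. c i \<noteq> \<zero>}. c i)"
    and gr_one: "\<one> \<in> gr 0"
    and gr_mult: "\<lbrakk>x \<in> gr i; y \<in> gr j\<rbrakk> \<Longrightarrow> x \<otimes> y \<in> gr (i + j)"
    and gr_commutative: "\<lbrakk>x \<in> gr i; y \<in> gr j\<rbrakk> \<Longrightarrow>
      x \<otimes> y = [((- 1 :: int) ^ (i * j))] \<cdot> (y \<otimes> x)"
    and d_additive: "d \<in> hom (add_monoid E) (add_monoid E)"
    and d_degree: "x \<in> gr i \<Longrightarrow> d x \<in> gr (Suc i)"
    and d_d: "x \<in> carrier E \<Longrightarrow> d (d x) = \<zero>"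
    and d_Leibniz: "\<lbrakk>x \<in> gr i; y \<in> gr j\<rbrakk> \<Longrightarrow>
      d (x \<otimes> y) = (d x \<otimes> y) \<oplus> ([((- 1 :: int) ^ i)] \<cdot> (x \<otimes> d y))"

text \<open>The maps are indexed by the lower level they involve: \<open>res n, F n : E n+1 \<rightarrow> E n\<close> and
  \<open>V n : E n \<rightarrow> E n+1\<close>. Only the levels \<open>n \<ge> 1\<close> are relevant.\<close>

locale witt_complex =
  fixes p :: nat
    and R :: "('a, 'b) ring_scheme"
    and E :: "nat \<Rightarrow> ('e, 'm) ring_scheme"
    and gr :: "nat \<Rightarrow> nat \<Rightarrow> 'e set"
    and d :: "nat \<Rightarrow> 'e \<Rightarrow> 'e"
    and res :: "nat \<Rightarrow> 'e \<Rightarrow> 'e"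
    and lam :: "nat \<Rightarrow> (nat \<Rightarrow> 'a) \<Rightarrow> 'e"
    and F :: "nat \<Rightarrow> 'e \<Rightarrow> 'e"
    and V :: "nat \<Rightarrow> 'e \<Rightarrow> 'e"
  assumes prime_p: "prime p" and odd_p: "odd p"
    and cring_R: "cring R"
    and R_algebra: "\<exists>h. h \<in> ring_hom (integers_localized_at p) R"
    and dg_ring: "n \<ge> 1 \<Longrightarrow> graded_commutative_dg_ring (E n) (gr n) (d n)"
    and res_hom: "n \<ge> 1 \<Longrightarrow> res n \<in> ring_hom (E (Suc n)) (E n)"
    and res_degree: "\<lbrakk>n \<ge> 1; x \<in> gr (Suc n) i\<rbrakk> \<Longrightarrow> res n x \<in> gr n i"
    and res_d: "\<lbrakk>n \<ge> 1; x \<in> carrier (E (Suc n))\<rbrakk> \<Longrightarrow> res n (d (Suc n) x) = d n (res n x)"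
    and lam_hom: "n \<ge> 1 \<Longrightarrow> lam n \<in> ring_hom (witt_ring_trunc p R n) (E n)"
    and lam_degree: "\<lbrakk>n \<ge> 1; w \<in> carrier (witt_ring_trunc p R n)\<rbrakk> \<Longrightarrow> lam n w \<in> gr n 0"
    and lam_res: "\<lbrakk>n \<ge> 1; w \<in> carrier (witt_ring_trunc p R (Suc n))\<rbrakk> \<Longrightarrow>
      res n (lam (Suc n) w) = lam n (restrict w {..<n})"
    and F_hom: "n \<ge> 1 \<Longrightarrow> F n \<in> ring_hom (E (Suc n)) (E n)"
    and F_degree: "\<lbrakk>n \<ge> 1; x \<in> gr (Suc n) i\<rbrakk> \<Longrightarrow> F n x \<in> gr n i"
    and F_res: "\<lbrakk>n \<ge> 1; x \<in> carrier (E (Suc (Suc n)))\<rbrakk> \<Longrightarrow>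
      F n (res (Suc n) x) = res n (F (Suc n) x)"
    and F_lam: "\<lbrakk>n \<ge> 1; w \<in> carrier (witt_ring_trunc p R (Suc n))\<rbrakk> \<Longrightarrow>
      F n (lam (Suc n) w) = lam n (witt_frob p R {..<n} w)"
    and F_d_teichmueller: "\<lbrakk>n \<ge> 1; r \<in> carrier R\<rbrakk> \<Longrightarrow>
      F n (d (Suc n) (lam (Suc n) (teichmueller R {..<Suc n} r))) =
        lam n (teichmueller R {..<n} r [^]\<^bsub>witt_ring_trunc p R n\<^esub> (p - 1))
          \<otimes>\<^bsub>E n\<^esub> d n (lam n (teichmueller R {..<n} r))"
    and V_additive: "n \<ge> 1 \<Longrightarrow> V n \<in> hom (add_monoid (E n)) (add_monoid (E (Suc n)))"
    and V_degree: "\<lbrakk>n \<ge> 1; x \<in> gr n i\<rbrakk> \<Longrightarrow> V n x \<in> gr (Suc n) i"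
    and V_res: "\<lbrakk>n \<ge> 1; x \<in> carrier (E (Suc n))\<rbrakk> \<Longrightarrow>
      V n (res n x) = res (Suc n) (V (Suc n) x)"
    and V_module_left: "\<lbrakk>n \<ge> 1; x \<in> carrier (E (Suc n)); y \<in> carrier (E n)\<rbrakk> \<Longrightarrow>
      V n (F n x \<otimes>\<^bsub>E n\<^esub> y) = x \<otimes>\<^bsub>E (Suc n)\<^esub> V n y"
    and V_module_right: "\<lbrakk>n \<ge> 1; x \<in> carrier (E (Suc n)); y \<in> carrier (E n)\<rbrakk> \<Longrightarrow>
      V n (y \<otimes>\<^bsub>E n\<^esub> F n x) = V n y \<otimes>\<^bsub>E (Suc n)\<^esub> x"
    and V_lam: "\<lbrakk>n \<ge> 1; w \<in> carrier (witt_ring_trunc p R n)\<rbrakk> \<Longrightarrow>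
      V n (lam n w) = lam (Suc n) (witt_ver R {..<Suc n} w)"
    and F_d_V: "\<lbrakk>n \<ge> 1; x \<in> carrier (E n)\<rbrakk> \<Longrightarrow> F n (d (Suc n) (V n x)) = d n x"
    and F_V: "\<lbrakk>n \<ge> 1; x \<in> carrier (E n)\<rbrakk> \<Longrightarrow> F n (V n x) = [p] \<cdot>\<^bsub>E n\<^esub> x"


section \<open>The complex over \<open>A = W(k)\<close>\<close>

definition phi :: "nat \<Rightarrow> ('a, 'b) ring_scheme \<Rightarrow> (nat \<Rightarrow> 'a) \<Rightarrow> (nat \<Rightarrow> 'a)" where
  "phi p k = witt_frob p k UNIV"

definition phi_inv :: "nat \<Rightarrow> ('a, 'b) ring_scheme \<Rightarrow> (nat \<Rightarrow> 'a) \<Rightarrow> (nat \<Rightarrow> 'a)" where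
  "phi_inv p k = inv_into (carrier (witt_ring p k)) (phi p k)"

text \<open>Extensionality only pins down the junk values outside the carrier, so that the function
  is unique.\<close>

definition s_phi :: "nat \<Rightarrow> ('a, 'b) ring_scheme \<Rightarrow> (nat \<Rightarrow> 'a) \<Rightarrow> (nat \<Rightarrow> nat \<Rightarrow> 'a)" where
  "s_phi p k =
     (let A = witt_ring p k in
      THE s. s \<in> ring_hom A (witt_ring p A) \<and> s \<in> extensional (carrier A) \<and>
        (\<forall>a\<in>carrier A. witt_frob p A UNIV (s a) = s (phi p k a)) \<and>
        (\<forall>a\<in>carrier A. \<forall>n. ghost_component p A n (s a) = (phi p k ^^ n) a))"

definition ver_one :: "nat \<Rightarrow> ('a, 'b) ring_scheme \<Rightarrow> nat \<Rightarrow> nat \<Rightarrow> (nat \<Rightarrow> nat \<Rightarrow> 'a)" where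
  "ver_one p k n i =
     (let A = witt_ring p k in restrict ((witt_ver A UNIV ^^ i) \<one>\<^bsub>witt_ring p A\<^esub>) {..<n})"

text \<open>The coefficients \<open>(a\<^sub>i)\<close> in \<open>x = \<Sum>\<^bsub>i<n\<^esub> s\<^sub>\<phi>(a\<^sub>i) V\<^sup>i(1)\<close> for \<open>x \<in> W\<^sub>n(A)\<close>.\<close>

definition ver_coeffs ::
    "nat \<Rightarrow> ('a, 'b) ring_scheme \<Rightarrow> nat \<Rightarrow> (nat \<Rightarrow> nat \<Rightarrow> 'a) \<Rightarrow> (nat \<Rightarrow> nat \<Rightarrow> 'a)" where
  "ver_coeffs p k n x =
     (let A = witt_ring p k; W = witt_ring_trunc p A n in
      THE a. a \<in> {..<n} \<rightarrow>\<^sub>E carrier A \<and>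
        x = (\<Oplus>\<^bsub>W\<^esub>i\<in>{..<n}. restrict (s_phi p k (a i)) {..<n} \<otimes>\<^bsub>W\<^esub> ver_one p k n i))"

definition p_ideal :: "nat \<Rightarrow> ('a, 'b) ring_scheme \<Rightarrow> nat \<Rightarrow> (nat \<Rightarrow> 'a) set" where
  "p_ideal p k i = (let A = witt_ring p k in PIdl\<^bsub>A\<^esub> ([(p ^ i)] \<cdot>\<^bsub>A\<^esub> \<one>\<^bsub>A\<^esub>))"

definition quot_p :: "nat \<Rightarrow> ('a, 'b) ring_scheme \<Rightarrow> nat \<Rightarrow> (nat \<Rightarrow> 'a) set ring" where
  "quot_p p k i = witt_ring p k Quot p_ideal p k i"

definition quot_class :: "nat \<Rightarrow> ('a, 'b) ring_scheme \<Rightarrow> nat \<Rightarrow> (nat \<Rightarrow> 'a) \<Rightarrow> (nat \<Rightarrow> 'a) set" where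
  "quot_class p k i a = p_ideal p k i +>\<^bsub>witt_ring p k\<^esub> a"

text \<open>For \<open>f : A \<rightarrow> A\<close> with \<open>f(p\<^sup>jA) \<subseteq> p\<^sup>iA\<close>, the induced map \<open>A/p\<^sup>jA \<rightarrow> A/p\<^sup>iA\<close>.\<close>

definition quot_map :: "nat \<Rightarrow> ('a, 'b) ring_scheme \<Rightarrow> nat \<Rightarrow> ((nat \<Rightarrow> 'a) \<Rightarrow> (nat \<Rightarrow> 'a)) \<Rightarrow>
    (nat \<Rightarrow> 'a) set \<Rightarrow> (nat \<Rightarrow> 'a) set" where
  "quot_map p k i f C = the_elem ((\<lambda>a. quot_class p k i (f a)) ` C)"

text \<open>\<open>E\<^sup>1\<^sub>n\<close> as an additive group in multiplicative notation; the component \<open>i\<close> of an element is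
  its coefficient of \<open>dV\<^sup>i(1)\<close>. The component \<open>0\<close> lies in the zero ring \<open>A/p\<^sup>0A\<close>.\<close>

definition E1 :: "nat \<Rightarrow> ('a, 'b) ring_scheme \<Rightarrow> nat \<Rightarrow> (nat \<Rightarrow> (nat \<Rightarrow> 'a) set) monoid" where
  "E1 p k n = product_group {..<n} (\<lambda>i. add_monoid (quot_p p k i))"

definition E1_act :: "nat \<Rightarrow> ('a, 'b) ring_scheme \<Rightarrow> nat \<Rightarrow> (nat \<Rightarrow> nat \<Rightarrow> 'a) \<Rightarrow>
    (nat \<Rightarrow> (nat \<Rightarrow> 'a) set) \<Rightarrow> (nat \<Rightarrow> (nat \<Rightarrow> 'a) set)" where
  "E1_act p k n x m =
     (let A = witt_ring p k in
      (\<lambda>i\<in>{..<n}.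
        quot_class p k i (\<Oplus>\<^bsub>A\<^esub>j\<in>{..<n}. [(p ^ j)] \<cdot>\<^bsub>A\<^esub> ver_coeffs p k n x j) \<otimes>\<^bsub>quot_p p k i\<^esub> m i))"

text \<open>The total ring \<open>E\<^sup>0\<^sub>n \<oplus> E\<^sup>1\<^sub>n\<close>. Products of two elements of degree \<open>1\<close> vanish, and the right
  action of \<open>E\<^sup>0\<^sub>n\<close> on \<open>E\<^sup>1\<^sub>n\<close> agrees with the left one.\<close>

type_synonym 'a E_elem = "(nat \<Rightarrow> nat \<Rightarrow> 'a) \<times> (nat \<Rightarrow> (nat \<Rightarrow> 'a) set)"

definition E_ring :: "nat \<Rightarrow> ('a, 'b) ring_scheme \<Rightarrow> nat \<Rightarrow> 'a E_elem ring" where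
  "E_ring p k n =
     (let W = witt_ring_trunc p (witt_ring p k) n; M = E1 p k n in
      \<lparr>carrier = carrier W \<times> carrier M,
       monoid.mult = (\<lambda>(x, m) (y, l). (x \<otimes>\<^bsub>W\<^esub> y, E1_act p k n x l \<otimes>\<^bsub>M\<^esub> E1_act p k n y m)),
       one = (\<one>\<^bsub>W\<^esub>, \<one>\<^bsub>M\<^esub>),
       zero = (\<zero>\<^bsub>W\<^esub>, \<one>\<^bsub>M\<^esub>),
       add = (\<lambda>(x, m) (y, l). (x \<oplus>\<^bsub>W\<^esub> y, m \<otimes>\<^bsub>M\<^esub> l))\<rparr>)"

definition E_gr :: "nat \<Rightarrow> ('a, 'b) ring_scheme \<Rightarrow> nat \<Rightarrow> nat \<Rightarrow> 'a E_elem set" where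
  "E_gr p k n i =
     (let W = witt_ring_trunc p (witt_ring p k) n; M = E1 p k n in
      if i = 0 then carrier W \<times> {\<one>\<^bsub>M\<^esub>}
      else if i = 1 then {\<zero>\<^bsub>W\<^esub>} \<times> carrier M
      else {\<zero>\<^bsub>W\<^esub>} \<times> {\<one>\<^bsub>M\<^esub>})"

definition E_lam :: "nat \<Rightarrow> ('a, 'b) ring_scheme \<Rightarrow> nat \<Rightarrow> (nat \<Rightarrow> nat \<Rightarrow> 'a) \<Rightarrow> 'a E_elem" where
  "E_lam p k n x = (x, \<one>\<^bsub>E1 p k n\<^esub>)"

definition E_res :: "nat \<Rightarrow> 'a E_elem \<Rightarrow> 'a E_elem" where
  "E_res n = (\<lambda>(x, m). (restrict x {..<n}, restrict m {..<n}))"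

text \<open>In \<open>E_d\<close> the summand \<open>i = 0\<close> may be included, since its value lies in \<open>A/p\<^sup>0A = 0\<close>.\<close>

definition E_d :: "nat \<Rightarrow> ('a, 'b) ring_scheme \<Rightarrow> nat \<Rightarrow> 'a E_elem \<Rightarrow> 'a E_elem" where
  "E_d p k n = (\<lambda>(x, m).
     (\<zero>\<^bsub>witt_ring_trunc p (witt_ring p k) n\<^esub>,
      \<lambda>i\<in>{..<n}. quot_class p k i (ver_coeffs p k n x i)))"

definition E_F :: "nat \<Rightarrow> ('a, 'b) ring_scheme \<Rightarrow> nat \<Rightarrow> 'a E_elem \<Rightarrow> 'a E_elem" where
  "E_F p k n = (\<lambda>(x, m).
     (witt_frob p (witt_ring p k) {..<n} x,
      \<lambda>i\<in>{..<n}. quot_map p k i (phi p k) (m (Suc i))))"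

definition E_V :: "nat \<Rightarrow> ('a, 'b) ring_scheme \<Rightarrow> nat \<Rightarrow> 'a E_elem \<Rightarrow> 'a E_elem" where
  "E_V p k n = (\<lambda>(x, m).
     (witt_ver (witt_ring p k) {..<Suc n} x,
      \<lambda>i\<in>{..<Suc n}. case i of
          0 \<Rightarrow> \<zero>\<^bsub>quot_p p k 0\<^esub>
        | Suc j \<Rightarrow> quot_map p k i (\<lambda>a. [p] \<cdot>\<^bsub>witt_ring p k\<^esub> phi_inv p k a) (m j)))"

end

theory Submission
  imports Defs
begin

text \<open>Since \<open>A = W(k)\<close> is \<open>p\<close>-torsion-free, Witt vectors over \<open>A\<close> are determined by their ghost
  components \<open>w\<^sub>m\<close>. The twisted components \<open>g\<^sub>m = \<phi>\<^sup>-\<^sup>m(w\<^sub>m)\<close> identify \<open>W\<^sub>n(A)\<close> with the ring of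
  sequences satisfying \<open>g\<^sub>i \<equiv> g\<^sub>i\<^sub>-\<^sub>1\<close> modulo \<open>p\<^sup>i\<close>. The coefficients of \<open>x\<close> are
  \<open>a\<^sub>i = (g\<^sub>i - g\<^sub>i\<^sub>-\<^sub>1) / p\<^sup>i\<close>, and \<open>x\<close> acts on \<open>A/p\<^sup>iA\<close> as multiplication by \<open>g\<^sub>i\<close>. The Leibniz rule
  is then \<open>g\<^sub>i h\<^sub>i - g\<^sub>i\<^sub>-\<^sub>1 h\<^sub>i\<^sub>-\<^sub>1 = (g\<^sub>i - g\<^sub>i\<^sub>-\<^sub>1) h\<^sub>i + g\<^sub>i\<^sub>-\<^sub>1 (h\<^sub>i - h\<^sub>i\<^sub>-\<^sub>1)\<close>, and the axiom on
  \<open>F d[r]\<close> amounts to \<open>(u\<^sup>p - v\<^sup>p) / p\<^sup>i\<^sup>+\<^sup>1 \<equiv> u\<^sup>p\<^sup>-\<^sup>1 (u - v) / p\<^sup>i\<close> modulo \<open>p\<^sup>i\<close> for consecutive twisted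
  components \<open>v, u\<close> of \<open>[r]\<close>, which holds because \<open>p\<close> is odd. Dwork's lemma supplies both the
  universal Witt polynomials and the section \<open>s\<^sub>\<phi>\<close>.\<close>


section \<open>Evaluation of integer polynomials\<close>

text \<open>Two layers of Witt vectors occur. Over \<open>A\<close> the ghost components are
  faithful; over \<open>k\<close>, where \<open>p\<close> vanishes, they are not. Hence the ring
  axioms of \<open>A = W(k)\<close> and the identities between Frobenius, Verschiebung and
  Teichmueller lifts are proved over a ring of integer polynomials, which has no
  \<open>p\<close>-torsion, and then evaluated in \<open>k\<close>. In characteristic
  \<open>p\<close> the Frobenius of Witt vectors is the componentwise \<open>p\<close>-th power, and
  multiplication by \<open>p\<close> is Verschiebung followed by this Frobenius; as the Frobenius of
  \<open>k\<close> is bijective, \<open>A\<close> is torsion-free and \<phi> is bijective. The rest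
  is carried out for a torsion-free ring with a bijective lift \<phi> of the \<open>p\<close>-th
  power. The twist by \<phi>^(-m) is chosen because Dwork's congruence between \<phi>(w_(m-1)) and
  w_m modulo p^m then compares neighbours, s_phi(a) becomes the constant sequence a, and V^i(1)
  becomes p^i from index i on and 0 before. Elements of degree one are handled through sequences of
  representatives in \<open>A\<close>, so that each axiom turns into an equation in W_n(A) and
  equations or congruences modulo p^i in \<open>A\<close>.\<close>

lemma poly_mapping_induct [case_names zero single add]:
  fixes q :: "'v \<Rightarrow>\<^sub>0 'b::comm_monoid_add"
  assumes "P 0" and "\<And>m c. P (Poly_Mapping.single m c)"
    and "\<And>q r. P q \<Longrightarrow> P r \<Longrightarrow> P (q + r)"
  shows "P q"
proof (induction q rule: update_induct)
  case const
  show ?case by (rule assms(1))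
next
  case (update f a b)
  have "Poly_Mapping.update a b f = Poly_Mapping.single a b + f"
    using update(1) by (intro poly_mapping_eqI)
      (auto simp: lookup_update lookup_add lookup_single in_keys_iff)
  then show ?case using assms(2,3) update(3) by simp
qed

lemma mpoly_var_power: "mpoly_var v ^ n = Poly_Mapping.single (Poly_Mapping.single v n) 1"
  by (induction n) (auto simp: mpoly_var_def mult_single single_add[symmetric])

text \<open>The polynomial ring is generated as a ring by its variables. The case for negation is
  there because sums and products alone reach only nonnegative coefficients. The rule serves
  properties stable under ring operations, such as compatibility with a homomorphism or congruence
  to the \<open>p\<close>-th power.\<close>

lemma mpoly_var_induct [case_names one var uminus add mult]:
  fixes q :: "'v int_mpoly"
  assumes one: "P 1" and var: "\<And>v. P (mpoly_var v)" and uminus: "\<And>q. P q \<Longrightarrow> P (- q)"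
    and add: "\<And>q r. P q \<Longrightarrow> P r \<Longrightarrow> P (q + r)" and mult: "\<And>q r. P q \<Longrightarrow> P r \<Longrightarrow> P (q * r)"
  shows "P q"
proof -
  have zero: "P 0" using add[OF one uminus[OF one]] by simp
  have nat: "P (of_nat n)" for n by (induction n) (auto intro: zero one add)
  have int: "P (of_int c)" for c
    by (cases c) (auto intro!: nat uminus simp del: of_nat_Suc)
  have power: "P (mpoly_var v ^ n)" for v n by (induction n) (auto intro: one var mult)
  \<comment> \<open>The exponent vector is itself a finitely supported map, so the same induction
    applies to it and turns sums of exponents into products of monomials.\<close>
  have monomial: "P (Poly_Mapping.single m 1)" for m
  proof (induction m rule: poly_mapping_induct)
    case (add m m')
    then show ?case using mult[OF add] by (simp add: mult_single)
  qed (use one power in \<open>auto simp: mpoly_var_power\<close>)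
  show ?thesis
  proof (induction q rule: poly_mapping_induct)
    case (single m c)
    have "Poly_Mapping.single m c = of_int c * Poly_Mapping.single m 1"
      by (simp add: single_of_int[symmetric] mult_single del: single_of_int)
    then show ?case using mult[OF int monomial] by metis
  qed (auto intro: zero add)
qed

definition monomial_eval :: "('a, 'b) ring_scheme \<Rightarrow> ('v \<Rightarrow> 'a) \<Rightarrow> ('v \<Rightarrow>\<^sub>0 nat) \<Rightarrow> 'a" where
  "monomial_eval R f m =
     (\<Otimes>\<^bsub>R\<^esub>v\<in>Poly_Mapping.keys m. f v [^]\<^bsub>R\<^esub> Poly_Mapping.lookup m v)"

context cring
begin

lemma monomial_eval_closed [simp]:
  assumes "range f \<subseteq> carrier R"
  shows "monomial_eval R f m \<in> carrier R"
  using assms unfolding monomial_eval_def by (intro finprod_closed) auto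

text \<open>The extra factors are zeroth powers. Two monomials can thus be multiplied over one
  common index set, and likewise two polynomials added.\<close>

lemma monomial_eval_superset:
  assumes "range f \<subseteq> carrier R" "finite S" "Poly_Mapping.keys m \<subseteq> S"
  shows "monomial_eval R f m = (\<Otimes>v\<in>S. f v [^] Poly_Mapping.lookup m v)"
  unfolding monomial_eval_def
  using assms by (intro finprod_mono_neutral_cong_left) (auto simp: in_keys_iff)

lemma monomial_eval_add:
  assumes f: "range f \<subseteq> carrier R"
  shows "monomial_eval R f (m + m') = monomial_eval R f m \<otimes> monomial_eval R f m'"
proof -
  let ?S = "Poly_Mapping.keys m \<union> Poly_Mapping.keys m'"
  have f': "f v \<in> carrier R" for v using f by auto
  have "monomial_eval R f (m + m') = (\<Otimes>v\<in>?S. f v [^] Poly_Mapping.lookup (m + m') v)"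
    using keys_add[of m m'] by (intro monomial_eval_superset[OF f]) auto
  also have "\<dots> = (\<Otimes>v\<in>?S. f v [^] Poly_Mapping.lookup m v \<otimes> f v [^] Poly_Mapping.lookup m' v)"
    using f' by (intro finprod_cong') (auto simp: lookup_add nat_pow_mult)
  also have "\<dots> = (\<Otimes>v\<in>?S. f v [^] Poly_Mapping.lookup m v) \<otimes> (\<Otimes>v\<in>?S. f v [^] Poly_Mapping.lookup m' v)"
    using f' by (intro finprod_multf) auto
  also have "\<dots> = monomial_eval R f m \<otimes> monomial_eval R f m'"
    by (simp add: monomial_eval_superset[OF f, of ?S])
  finally show ?thesis .
qed

lemma mpoly_eval_alt:
  "mpoly_eval R f q =
     (\<Oplus>m\<in>Poly_Mapping.keys q. [(Poly_Mapping.lookup q m)] \<cdot> monomial_eval R f m)"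
  by (simp add: mpoly_eval_def monomial_eval_def)

lemma mpoly_eval_closed [simp]:
  assumes "range f \<subseteq> carrier R"
  shows "mpoly_eval R f q \<in> carrier R"
  using assms unfolding mpoly_eval_alt by (intro finsum_closed) auto

lemma mpoly_eval_superset:
  assumes "range f \<subseteq> carrier R" "finite S" "Poly_Mapping.keys q \<subseteq> S"
  shows "mpoly_eval R f q = (\<Oplus>m\<in>S. [(Poly_Mapping.lookup q m)] \<cdot> monomial_eval R f m)"
  unfolding mpoly_eval_alt
  using assms by (intro add.finprod_mono_neutral_cong_left) (auto simp: in_keys_iff add_pow_int_ge)

lemma mpoly_eval_single:
  assumes f: "range f \<subseteq> carrier R"
  shows "mpoly_eval R f (Poly_Mapping.single m c) = [c] \<cdot> monomial_eval R f m"
  using f by (simp add: mpoly_eval_superset[OF f, of "{m}"])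

lemma mpoly_eval_zero [simp]: "mpoly_eval R f 0 = \<zero>"
  by (simp add: mpoly_eval_alt)

lemma mpoly_eval_one [simp]: "range f \<subseteq> carrier R \<Longrightarrow> mpoly_eval R f 1 = \<one>"
  using mpoly_eval_single[of f 0 1] by (simp add: monomial_eval_def)

lemma mpoly_eval_var [simp]: "range f \<subseteq> carrier R \<Longrightarrow> mpoly_eval R f (mpoly_var v) = f v"
  unfolding mpoly_var_def
  by (subst mpoly_eval_single) (auto simp: monomial_eval_def image_subset_iff)

lemma mpoly_eval_add:
  assumes f: "range f \<subseteq> carrier R"
  shows "mpoly_eval R f (q + r) = mpoly_eval R f q \<oplus> mpoly_eval R f r"
proof -
  let ?S = "Poly_Mapping.keys q \<union> Poly_Mapping.keys r"
  have "mpoly_eval R f (q + r) =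
      (\<Oplus>m\<in>?S. [(Poly_Mapping.lookup (q + r) m)] \<cdot> monomial_eval R f m)"
    using keys_add[of q r] by (intro mpoly_eval_superset[OF f]) auto
  also have "\<dots> = (\<Oplus>m\<in>?S. [(Poly_Mapping.lookup q m)] \<cdot> monomial_eval R f m \<oplus>
      [(Poly_Mapping.lookup r m)] \<cdot> monomial_eval R f m)"
    using f by (intro finsum_cong') (auto simp: lookup_add add.int_pow_mult)
  also have "\<dots> = (\<Oplus>m\<in>?S. [(Poly_Mapping.lookup q m)] \<cdot> monomial_eval R f m) \<oplus>
      (\<Oplus>m\<in>?S. [(Poly_Mapping.lookup r m)] \<cdot> monomial_eval R f m)"
    using f by (intro finsum_addf) auto
  also have "\<dots> = mpoly_eval R f q \<oplus> mpoly_eval R f r"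
    by (simp add: mpoly_eval_superset[OF f, of ?S])
  finally show ?thesis .
qed

lemma mpoly_eval_mult:
  assumes f: "range f \<subseteq> carrier R"
  shows "mpoly_eval R f (q * r) = mpoly_eval R f q \<otimes> mpoly_eval R f r"
proof (induction q rule: poly_mapping_induct)
  case (single m c)
  show ?case
  proof (induction r rule: poly_mapping_induct)
    case (single m' c')
    show ?case
      using f by (simp add: mult_single mpoly_eval_single monomial_eval_add add_pow_ldistr_int
          add_pow_rdistr_int add.int_pow_pow mult.commute m_comm)
  qed (use f in \<open>simp_all add: mpoly_eval_add distrib_left r_distr\<close>)
qed (use f in \<open>simp_all add: mpoly_eval_add distrib_right l_distr\<close>)

lemma mpoly_eval_power:
  "range f \<subseteq> carrier R \<Longrightarrow> mpoly_eval R f (q ^ n) = mpoly_eval R f q [^] n"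
  by (induction n) (simp_all add: mpoly_eval_mult m_comm)

lemma mpoly_eval_uminus:
  assumes f: "range f \<subseteq> carrier R"
  shows "mpoly_eval R f (- q) = \<ominus> mpoly_eval R f q"
proof (rule minus_equality[symmetric])
  show "mpoly_eval R f (- q) \<oplus> mpoly_eval R f q = \<zero>"
    using mpoly_eval_add[OF f, of "- q" q] by simp
qed (use f in auto)

lemma mpoly_eval_minus:
  assumes f: "range f \<subseteq> carrier R"
  shows "mpoly_eval R f (q - r) = mpoly_eval R f q \<ominus> mpoly_eval R f r"
  using mpoly_eval_add[OF f, of q "- r"] by (simp add: mpoly_eval_uminus[OF f] minus_eq)

lemma mpoly_eval_of_nat_mult:
  assumes f: "range f \<subseteq> carrier R"
  shows "mpoly_eval R f (of_nat n * q) = [n] \<cdot> mpoly_eval R f q"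
  using f by (induction n) (simp_all add: mpoly_eval_add distrib_right a_comm)

lemma mpoly_eval_sum:
  assumes f: "range f \<subseteq> carrier R" and "finite S"
  shows "mpoly_eval R f (\<Sum>s\<in>S. q s) = (\<Oplus>s\<in>S. mpoly_eval R f (q s))"
  using assms(2) by (induction S) (use f in \<open>simp_all add: mpoly_eval_add\<close>)

text \<open>Outside \<open>U\<close> both valuations may take any value, even one outside the
  carrier. This is the form required for truncated Witt vectors, which are \<open>undefined\<close>
  off their index set.\<close>

lemma mpoly_eval_cong:
  assumes "\<And>v. v \<in> U \<Longrightarrow> f v = g v" "\<And>v. v \<in> U \<Longrightarrow> g v \<in> carrier R"
    and "\<forall>m\<in>Poly_Mapping.keys q. Poly_Mapping.keys m \<subseteq> U"
  shows "mpoly_eval R f q = mpoly_eval R g q"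
  unfolding mpoly_eval_def
proof (intro finsum_cong' arg_cong[where f="add_pow R _"] finprod_cong' refl funcsetI)
  fix m assume "m \<in> Poly_Mapping.keys q"
  with assms have "g v \<in> carrier R" if "v \<in> Poly_Mapping.keys m" for v using that by blast
  then show "[(Poly_Mapping.lookup q m)] \<cdot> (\<Otimes>v\<in>Poly_Mapping.keys m. g v [^] Poly_Mapping.lookup m v)
      \<in> carrier R"
    by (intro add.int_pow_closed finprod_closed) auto
qed (use assms in \<open>auto simp: subset_iff\<close>)

end

lemma hom_mpoly_eval:
  assumes "cring R" "cring S" and h: "h \<in> ring_hom R S" and f: "range f \<subseteq> carrier R"
  shows "h (mpoly_eval R f q) = mpoly_eval S (\<lambda>v. h (f v)) q"
proof -
  interpret R: cring R by fact
  interpret S: cring S by fact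
  interpret h: ring_hom_cring R S h by unfold_locales (fact h)
  have hf: "range (\<lambda>v. h (f v)) \<subseteq> carrier S" using f by auto
  have f': "f v \<in> carrier R" for v using f by auto
  show ?thesis
    by (induction q rule: mpoly_var_induct)
      (simp_all add: f f' hf R.mpoly_eval_uminus S.mpoly_eval_uminus R.mpoly_eval_add
        S.mpoly_eval_add R.mpoly_eval_mult S.mpoly_eval_mult)
qed


section \<open>Type class rings as records\<close>

text \<open>Bridge from type classes to records: statements proved for record rings, such as Dwork's
  lemma, become available for integer polynomials.\<close>

definition class_ring :: "'r::comm_ring_1 ring" where
  "class_ring = \<lparr>carrier = UNIV, monoid.mult = (*), one = 1, zero = 0, add = (+)\<rparr>"

lemma class_ring_simps [simp]:
  "carrier class_ring = UNIV" "monoid.mult class_ring = (*)" "one class_ring = 1"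
  "zero class_ring = 0" "add class_ring = (+)"
  by (simp_all add: class_ring_def)

lemma cring_class_ring: "cring (class_ring :: 'r::comm_ring_1 ring)"
proof (intro cringI abelian_groupI comm_monoidI)
  show "\<exists>y\<in>carrier class_ring. y \<oplus>\<^bsub>class_ring\<^esub> x = \<zero>\<^bsub>class_ring\<^esub>" for x :: 'r
    by (intro bexI[of _ "- x"]) simp_all
qed (simp_all add: algebra_simps)

interpretation class_ring: cring "class_ring :: 'r::comm_ring_1 ring"
  by (rule cring_class_ring)

lemma class_ring_pow [simp]: "x [^]\<^bsub>class_ring\<^esub> (n::nat) = x ^ n"
  by (induction n) (simp_all add: mult.commute)

lemma class_ring_add_pow [simp]: "[(n::nat)] \<cdot>\<^bsub>class_ring\<^esub> x = of_nat n * x"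
  by (induction n) (simp_all add: algebra_simps)

lemma class_ring_finsum [simp]: "finsum class_ring f A = sum f A"
  by (cases "finite A", induction A rule: finite_induct) simp_all

lemma class_ring_a_inv [simp]: "\<ominus>\<^bsub>class_ring\<^esub> x = - x"
  by (rule class_ring.minus_equality) simp_all

lemma class_ring_a_minus [simp]: "x \<ominus>\<^bsub>class_ring\<^esub> y = x - y"
  by (simp add: a_minus_def)

lemma ghost_component_class_ring [simp]: "ghost_component p class_ring n x = ghost_poly p x n"
  by (simp add: ghost_component_def ghost_poly_def)

lemma (in cring) mpoly_eval_ring_hom:
  "range f \<subseteq> carrier R \<Longrightarrow> mpoly_eval R f \<in> ring_hom class_ring R"
  by (auto intro!: ring_hom_memI simp: mpoly_eval_mult mpoly_eval_add)

lemma (in cring) mpoly_eval_ghost_poly: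
  assumes f: "range f \<subseteq> carrier R"
  shows "mpoly_eval R f (ghost_poly p S n) = ghost_component p R n (\<lambda>i. mpoly_eval R f (S i))"
  unfolding ghost_poly_def ghost_component_def
  by (simp add: mpoly_eval_sum[OF f] mpoly_eval_of_nat_mult[OF f] mpoly_eval_power[OF f]
      flip: of_nat_power)

text \<open>The variables are the elements of \<open>R\<close> themselves, so every element is the
  value of a variable and evaluation is surjective. The default zero keeps the valuation inside the
  carrier on the whole type.\<close>

definition ceval :: "('a, 'b) ring_scheme \<Rightarrow> 'a int_mpoly \<Rightarrow> 'a" where
  "ceval R = mpoly_eval R (\<lambda>a. if a \<in> carrier R then a else \<zero>\<^bsub>R\<^esub>)"

context cring
begin

lemma range_canonical: "range (\<lambda>a. if a \<in> carrier R then a else \<zero>) \<subseteq> carrier R"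
  by auto

lemma ceval_hom: "ceval R \<in> ring_hom class_ring R"
  unfolding ceval_def by (rule mpoly_eval_ring_hom[OF range_canonical])

lemma ceval_var: "a \<in> carrier R \<Longrightarrow> ceval R (mpoly_var a) = a"
  unfolding ceval_def by (simp only: mpoly_eval_var[OF range_canonical] if_True)

lemmas ceval_simps [simp] =
  mpoly_eval_closed[OF range_canonical, folded ceval_def]
  ceval_var
  mpoly_eval_zero[of "\<lambda>a. if a \<in> carrier R then a else \<zero>", folded ceval_def]
  mpoly_eval_one[OF range_canonical, folded ceval_def]
  mpoly_eval_add[OF range_canonical, folded ceval_def]
  mpoly_eval_mult[OF range_canonical, folded ceval_def]
  mpoly_eval_uminus[OF range_canonical, folded ceval_def]
  mpoly_eval_minus[OF range_canonical, folded ceval_def]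
  mpoly_eval_power[OF range_canonical, folded ceval_def]

lemma ceval_of_nat_mult:
  "ceval R (of_nat n * q) = [n] \<cdot> ceval R q"
  unfolding ceval_def by (rule mpoly_eval_of_nat_mult) auto

end


section \<open>Congruences modulo powers of \<open>p\<close>\<close>

lemma binomial_expansion2:
  fixes b z :: "'r::comm_ring_1"
  shows "\<exists>c. (b + z) ^ n = b ^ n + of_nat n * b ^ (n - 1) * z + z ^ 2 * c"
proof (induction n)
  case 0
  show ?case by (intro exI[of _ 0]) simp
next
  case (Suc n)
  then obtain c where c: "(b + z) ^ n = b ^ n + of_nat n * b ^ (n - 1) * z + z ^ 2 * c" by blast
  \<comment> \<open>At \<open>n = 0\<close> the truncated exponent \<open>n - 1\<close> does no harm
    because the coefficient in front of it vanishes.\<close>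
  have b: "of_nat n * b ^ (n - 1) * b = of_nat n * b ^ n" by (cases n) (simp_all add: mult_ac)
  have "(b + z) ^ Suc n = (b ^ n + of_nat n * b ^ (n - 1) * z + z ^ 2 * c) * (b + z)"
    by (simp add: c mult.commute)
  also have "\<dots> = b ^ Suc n + b ^ n * z + (of_nat n * b ^ (n - 1) * b) * z
      + z ^ 2 * (of_nat n * b ^ (n - 1) + c * (b + z))"
    by (simp add: algebra_simps power2_eq_square)
  also have "\<dots> = b ^ Suc n + of_nat (Suc n) * b ^ (Suc n - 1) * z
      + z ^ 2 * (of_nat n * b ^ (n - 1) + c * (b + z))"
    unfolding b by (simp add: algebra_simps)
  finally show ?case by blast
qed

text \<open>One order more than before, because the comparison of \<open>p\<close>-th powers in the
  Teichmueller axiom needs the coefficient \<open>p choose 2\<close> of the quadratic term in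
  explicit form.\<close>

lemma binomial_expansion3:
  fixes b z :: "'r::comm_ring_1"
  shows "\<exists>c. (b + z) ^ n = b ^ n + of_nat n * b ^ (n - 1) * z
           + of_nat (n choose 2) * b ^ (n - 2) * z ^ 2 + z ^ 3 * c"
proof (induction n)
  case 0
  show ?case by (intro exI[of _ 0]) (simp add: numeral_2_eq_2)
next
  case (Suc n)
  let ?C = "of_nat (n choose 2) :: 'r"
  obtain c where c: "(b + z) ^ n = b ^ n + of_nat n * b ^ (n - 1) * z
      + ?C * b ^ (n - 2) * z ^ 2 + z ^ 3 * c" using Suc by blast
  have b: "of_nat n * b ^ (n - 1) * b = of_nat n * b ^ n" by (cases n) (simp_all add: mult_ac)
  have b': "?C * b ^ (n - 2) * b = ?C * b ^ (n - 1)"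
  proof (cases "n \<ge> 2")
    case True
    then have "b ^ (n - 1) = b ^ (n - 2) * b" by (metis One_nat_def Suc_1 Suc_diff_Suc less_eq_Suc_le power_Suc2)
    then show ?thesis by (simp add: mult_ac)
  qed (simp add: binomial_eq_0)
  have choose: "of_nat (Suc n choose 2) = of_nat n + ?C"
    by (simp add: numeral_2_eq_2)
  have "(b + z) ^ Suc n = (b ^ n + of_nat n * b ^ (n - 1) * z + ?C * b ^ (n - 2) * z ^ 2
      + z ^ 3 * c) * (b + z)"
    by (simp add: c mult.commute)
  also have "\<dots> = b ^ Suc n + b ^ n * z + (of_nat n * b ^ (n - 1) * b) * z
      + of_nat n * b ^ (n - 1) * z ^ 2 + (?C * b ^ (n - 2) * b) * z ^ 2
      + z ^ 3 * (?C * b ^ (n - 2) + c * (b + z))"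
    by (simp add: algebra_simps power2_eq_square power3_eq_cube)
  also have "\<dots> = b ^ Suc n + of_nat (Suc n) * b ^ (Suc n - 1) * z
      + of_nat (Suc n choose 2) * b ^ (Suc n - 2) * z ^ 2
      + z ^ 3 * (?C * b ^ (n - 2) + c * (b + z))"
    unfolding b b' choose by (simp add: algebra_simps numeral_2_eq_2)
  finally show ?case by blast
qed

text \<open>The existential form hands out the cofactor of \<open>p ^ n\<close>, which is the next
  Witt component in Dwork's lemma and a coefficient of V^n(1) later on.\<close>

definition pcong :: "('a, 'b) ring_scheme \<Rightarrow> nat \<Rightarrow> nat \<Rightarrow> 'a \<Rightarrow> 'a \<Rightarrow> bool" where
  "pcong R p n a b \<longleftrightarrow> (\<exists>c\<in>carrier R. a = b \<oplus>\<^bsub>R\<^esub> [(p ^ n)] \<cdot>\<^bsub>R\<^esub> c)"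

definition p_torsion_free :: "nat \<Rightarrow> ('a, 'b) ring_scheme \<Rightarrow> bool" where
  "p_torsion_free p R \<longleftrightarrow> (\<forall>a\<in>carrier R. [p] \<cdot>\<^bsub>R\<^esub> a = \<zero>\<^bsub>R\<^esub> \<longrightarrow> a = \<zero>\<^bsub>R\<^esub>)"

context cring
begin

lemma add_pow_mult_one: "a \<in> carrier R \<Longrightarrow> [(n::nat)] \<cdot> a = [n] \<cdot> \<one> \<otimes> a"
  by (simp add: add_pow_ldistr)

lemma add_pow_mult_ring_hom:
  assumes "cring S" "h \<in> ring_hom R S" "a \<in> carrier R"
  shows "h ([(n::nat)] \<cdot> a) = [n] \<cdot>\<^bsub>S\<^esub> h a"
proof -
  interpret S: cring S by fact
  interpret ring_hom_cring R S h by unfold_locales fact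
  show ?thesis by (induction n) (simp_all add: assms(3))
qed

lemma pcong_I:
  "a = b \<oplus> [(p ^ n)] \<cdot> c \<Longrightarrow> c \<in> carrier R \<Longrightarrow> pcong R p n a b"
  by (auto simp: pcong_def)

lemma pcong_refl [simp, intro]: "a \<in> carrier R \<Longrightarrow> pcong R p n a a"
  by (auto simp: pcong_def intro!: bexI[of _ \<zero>])

lemma pcong_sym:
  assumes "pcong R p n a b" and "b \<in> carrier R"
  shows "pcong R p n b a"
proof -
  obtain c where c: "c \<in> carrier R" "a = b \<oplus> [(p ^ n)] \<cdot> c" using assms by (auto simp: pcong_def)
  have "b = a \<oplus> [(p ^ n)] \<cdot> (\<ominus> c)"
    using c assms by (simp add: add.nat_pow_inv a_assoc r_neg)
  from pcong_I[OF this] show ?thesis using c by simp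
qed

lemma pcong_trans:
  assumes "pcong R p n a b" "pcong R p n b c" and "c \<in> carrier R"
  shows "pcong R p n a c"
proof -
  obtain d where d: "d \<in> carrier R" "a = b \<oplus> [(p ^ n)] \<cdot> d" using assms by (auto simp: pcong_def)
  obtain e where e: "e \<in> carrier R" "b = c \<oplus> [(p ^ n)] \<cdot> e" using assms by (auto simp: pcong_def)
  have "a = c \<oplus> [(p ^ n)] \<cdot> (e \<oplus> d)"
    using d e assms by (simp add: add.nat_pow_distrib a_assoc)
  from pcong_I[OF this] show ?thesis using d e by simp
qed

lemma pcong_add:
  assumes "pcong R p n a b" "pcong R p n a' b'" and "b \<in> carrier R" "b' \<in> carrier R"
  shows "pcong R p n (a \<oplus> a') (b \<oplus> b')"
proof -
  obtain d where d: "d \<in> carrier R" "a = b \<oplus> [(p ^ n)] \<cdot> d" using assms by (auto simp: pcong_def)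
  obtain e where e: "e \<in> carrier R" "a' = b' \<oplus> [(p ^ n)] \<cdot> e" using assms by (auto simp: pcong_def)
  have "a \<oplus> a' = b \<oplus> b' \<oplus> [(p ^ n)] \<cdot> (d \<oplus> e)"
    using d e assms by (simp add: add.nat_pow_distrib a_ac)
  from pcong_I[OF this] show ?thesis using d e by simp
qed

lemma pcong_mult:
  assumes "pcong R p n a b" "pcong R p n a' b'" and "b \<in> carrier R" "b' \<in> carrier R"
  shows "pcong R p n (a \<otimes> a') (b \<otimes> b')"
proof -
  obtain d where d: "d \<in> carrier R" "a = b \<oplus> [(p ^ n)] \<cdot> d" using assms by (auto simp: pcong_def)
  obtain e where e: "e \<in> carrier R" "a' = b' \<oplus> [(p ^ n)] \<cdot> e" using assms by (auto simp: pcong_def)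
  let ?q = "[(p ^ n)] \<cdot> \<one>"
  have de: "a = b \<oplus> ?q \<otimes> d" "a' = b' \<oplus> ?q \<otimes> e"
    using d e by (simp_all add: add_pow_ldistr)
  have "a \<otimes> a' = b \<otimes> b' \<oplus> ?q \<otimes> (d \<otimes> b' \<oplus> b \<otimes> e \<oplus> ?q \<otimes> d \<otimes> e)"
    unfolding de using d(1) e(1) assms(3,4) add.nat_pow_closed[OF one_closed, of "p ^ n"] by algebra
  then show ?thesis using d e assms
    by (intro pcong_I[of _ _ _ _ "d \<otimes> b' \<oplus> b \<otimes> e \<oplus> ?q \<otimes> d \<otimes> e"]) (simp_all add: add_pow_ldistr)
qed

lemma pcong_finsum:
  assumes "finite S" "\<And>s. s \<in> S \<Longrightarrow> pcong R p n (f s) (g s)"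
    "\<And>s. s \<in> S \<Longrightarrow> f s \<in> carrier R" "\<And>s. s \<in> S \<Longrightarrow> g s \<in> carrier R"
  shows "pcong R p n (\<Oplus>s\<in>S. f s) (\<Oplus>s\<in>S. g s)"
  using assms by (induction S) (auto intro!: pcong_add simp: Pi_def)

lemma pcong_mono:
  assumes "pcong R p n a b" "m \<le> n"
  shows "pcong R p m a b"
proof -
  obtain c where c: "c \<in> carrier R" "a = b \<oplus> [(p ^ n)] \<cdot> c" using assms by (auto simp: pcong_def)
  have "[(p ^ n)] \<cdot> c = [(p ^ m)] \<cdot> ([(p ^ (n - m))] \<cdot> c)"
    using c assms(2) by (simp add: add.nat_pow_pow power_add[symmetric] mult.commute)
  then show ?thesis using c by (intro pcong_I[of _ _ _ _ "[(p ^ (n - m))] \<cdot> c"]) auto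
qed

lemma pcong_scale:
  assumes "pcong R p n a b" "b \<in> carrier R"
  shows "pcong R p (m + n) ([(p ^ m)] \<cdot> a) ([(p ^ m)] \<cdot> b)"
proof -
  obtain c where c: "c \<in> carrier R" "a = b \<oplus> [(p ^ n)] \<cdot> c" using assms by (auto simp: pcong_def)
  have "[(p ^ m)] \<cdot> a = [(p ^ m)] \<cdot> b \<oplus> [(p ^ (m + n))] \<cdot> c"
    using c assms(2) by (simp add: add.nat_pow_distrib add.nat_pow_pow power_add mult.commute)
  from pcong_I[OF this] show ?thesis using c by simp
qed

lemma pcong_hom:
  assumes "pcong R p n a b" "b \<in> carrier R" "cring S" "h \<in> ring_hom R S"
  shows "pcong S p n (h a) (h b)"
proof -
  obtain c where c: "c \<in> carrier R" "a = b \<oplus> [(p ^ n)] \<cdot> c" using assms by (auto simp: pcong_def)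
  interpret S: cring S by fact
  show ?thesis using c assms(2,4)
    by (intro S.pcong_I[of _ _ _ _ "h c"])
      (simp_all add: ring_hom_add ring_hom_closed add_pow_mult_ring_hom[OF assms(3,4)])
qed

text \<open>Polynomial identities transfer from the polynomial ring, where type class automation is
  available, to \<open>R\<close> by applying \<^const>\<open>ceval\<close>.\<close>

lemma pcong_pow_p:
  assumes "pcong R p (Suc n) a b" "b \<in> carrier R"
  shows "pcong R p (Suc (Suc n)) (a [^] p) (b [^] p)"
proof -
  obtain c where c: "c \<in> carrier R" "a = b \<oplus> [(p ^ Suc n)] \<cdot> c" using assms by (auto simp: pcong_def)
  let ?b = "mpoly_var b" and ?z = "of_nat (p ^ Suc n) * mpoly_var c"
  obtain q where q: "(?b + ?z) ^ p = ?b ^ p + of_nat p * ?b ^ (p - 1) * ?z + ?z ^ 2 * q"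
    using binomial_expansion2 by blast
  \<comment> \<open>The linear term gains a factor \<open>p\<close> from its binomial coefficient;
    the remainder carries p^(2n+2), a multiple of p^(n+2). The modulus has to start at exponent one
    for this.\<close>
  have "(?b + ?z) ^ p = ?b ^ p + of_nat (p ^ Suc (Suc n))
      * (?b ^ (p - 1) * mpoly_var c + of_nat (p ^ n) * mpoly_var c ^ 2 * q)"
    unfolding q by (simp add: power2_eq_square algebra_simps)
  from arg_cong[OF this, of "ceval R"]
  have "a [^] p = b [^] p \<oplus> [(p ^ Suc (Suc n))] \<cdot>
      ceval R (?b ^ (p - 1) * mpoly_var c + of_nat (p ^ n) * mpoly_var c ^ 2 * q)"
    using c assms(2)
    by (simp only: ceval_simps(2,5,9) ceval_of_nat_mult)
  from pcong_I[OF this] show ?thesis by simp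
qed

lemma pcong_pow_p_power:
  assumes "pcong R p 1 a b" "a \<in> carrier R" "b \<in> carrier R"
  shows "pcong R p (Suc n) (a [^] (p ^ n)) (b [^] (p ^ n))"
proof (induction n)
  case (Suc n)
  from pcong_pow_p[OF this] show ?case using assms
    by (simp add: nat_pow_pow mult.commute)
qed (use assms in simp)

lemma p_torsion_freeD:
  assumes "p_torsion_free p R" "[(p ^ n)] \<cdot> a = [(p ^ n)] \<cdot> b" "a \<in> carrier R" "b \<in> carrier R"
  shows "a = b"
proof -
  have "[(p ^ n)] \<cdot> c = \<zero> \<Longrightarrow> c = \<zero>" if "c \<in> carrier R" for c
  proof (induction n)
    case (Suc n)
    have "[p] \<cdot> ([(p ^ n)] \<cdot> c) = \<zero>"
      using Suc(2) that by (simp add: add.nat_pow_pow mult.commute)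
    then have "[(p ^ n)] \<cdot> c = \<zero>" using assms(1) that by (auto simp: p_torsion_free_def)
    then show ?case by (rule Suc(1))
  qed (use that in simp)
  moreover have "[(p ^ n)] \<cdot> (a \<ominus> b) = \<zero>"
    using assms by (simp add: minus_eq add.nat_pow_distrib add.nat_pow_inv r_neg)
  ultimately have "a \<ominus> b = \<zero>" using assms by simp
  moreover have "a = (a \<ominus> b) \<oplus> b" using assms(3,4) by algebra
  ultimately show ?thesis using assms(4) by simp
qed


section \<open>Ghost components and Dwork's lemma\<close>

lemma ghost_component_closed [simp]:
  "(\<And>i. i \<le> n \<Longrightarrow> x i \<in> carrier R) \<Longrightarrow> ghost_component p R n x \<in> carrier R"
  unfolding ghost_component_def by (intro finsum_closed) auto

lemma ghost_component_cong:
  assumes "\<And>i. i \<le> n \<Longrightarrow> x i = y i" "\<And>i. i \<le> n \<Longrightarrow> y i \<in> carrier R"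
  shows "ghost_component p R n x = ghost_component p R n y"
  unfolding ghost_component_def using assms by (intro finsum_cong') auto

lemma ghost_component_0: "x 0 \<in> carrier R \<Longrightarrow> ghost_component p R 0 x = x 0"
  by (simp add: ghost_component_def)

lemma ghost_component_last:
  assumes "\<And>i. i \<le> n \<Longrightarrow> x i \<in> carrier R"
  shows "ghost_component p R n x =
    (\<Oplus>i\<in>{..<n}. [(p ^ i)] \<cdot> (x i [^] (p ^ (n - i)))) \<oplus> [(p ^ n)] \<cdot> x n"
proof -
  have "{..n} = insert n {..<n}" by auto
  moreover have "(\<lambda>i. [(p ^ i)] \<cdot> (x i [^] (p ^ (n - i)))) \<in> {..<n} \<rightarrow> carrier R" using assms by auto
  ultimately show ?thesis using assms unfolding ghost_component_def
    by (simp add: a_comm)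
qed

text \<open>Only the last summand \<open>[(p ^ n)] \<cdot> x n\<close> of the \<open>n\<close>-th
  ghost component involves \<open>x n\<close>, so the components are recovered one after another by
  dividing by \<open>p ^ n\<close>.\<close>

lemma ghost_component_inj:
  assumes "p_torsion_free p R"
    and "\<And>m. m \<le> n \<Longrightarrow> ghost_component p R m x = ghost_component p R m y"
    and "\<And>m. m \<le> n \<Longrightarrow> x m \<in> carrier R" "\<And>m. m \<le> n \<Longrightarrow> y m \<in> carrier R"
  shows "x n = y n"
  using assms(2-)
proof (induction n rule: less_induct)
  case (less n)
  let ?s = "\<lambda>x. \<Oplus>i\<in>{..<n}. [(p ^ i)] \<cdot> (x i [^] (p ^ (n - i)))"
  have "?s x = ?s y" using less by (intro finsum_cong') auto
  moreover have "?s x \<oplus> [(p ^ n)] \<cdot> x n = ?s y \<oplus> [(p ^ n)] \<cdot> y n"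
    using less ghost_component_last[of n x p] ghost_component_last[of n y p] by auto
  moreover have "?s y \<in> carrier R" using less by (intro finsum_closed) auto
  ultimately have "[(p ^ n)] \<cdot> x n = [(p ^ n)] \<cdot> y n" using less by simp
  then show ?case using p_torsion_freeD[OF assms(1)] less by blast
qed

end

text \<open>Instantiated by the integer polynomials with the substitution of \<open>p\<close>-th
  powers of the variables, which yields the Witt polynomials, and by \<open>A\<close> with its Witt
  vector Frobenius.\<close>

locale frobenius_lift = cring +
  fixes p :: nat and \<phi> :: "'a \<Rightarrow> 'a"
  assumes prime_p: "prime p" and odd_p: "odd p"
    and torsion_free: "p_torsion_free p R"
    and \<phi>_hom: "\<phi> \<in> ring_hom R R"
    and \<phi>_cong: "a \<in> carrier R \<Longrightarrow> pcong R p 1 (\<phi> a) (a [^] p)"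
begin

sublocale \<phi>: ring_hom_cring R R \<phi>
  by unfold_locales (rule \<phi>_hom)

lemma \<phi>_add_pow: "a \<in> carrier R \<Longrightarrow> \<phi> ([(n::nat)] \<cdot> a) = [n] \<cdot> \<phi> a"
  by (rule add_pow_mult_ring_hom[OF is_cring \<phi>_hom])

lemma \<phi>_pow: "a \<in> carrier R \<Longrightarrow> \<phi> (a [^] (n::nat)) = \<phi> a [^] n"
  by (induction n) simp_all

text \<open>The congruence of \<phi>(x_i) with x_i^p modulo p improves to modulus p^(n-i+1) after
  raising to the power p^(n-i), and the factor p^i raises it to p^(n+1). The right-hand sum is the
  next ghost component without its last term.\<close>

lemma \<phi>_ghost_sum_cong:
  assumes x: "\<And>i. i \<le> n \<Longrightarrow> x i \<in> carrier R"
  shows "pcong R p (Suc n) (\<phi> (ghost_component p R n x))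
    (\<Oplus>i\<in>{..<Suc n}. [(p ^ i)] \<cdot> (x i [^] (p ^ (Suc n - i))))"
proof -
  have "\<phi> (ghost_component p R n x) =
      (\<Oplus>i\<in>{..<Suc n}. [(p ^ i)] \<cdot> (\<phi> (x i) [^] (p ^ (n - i))))"
    unfolding ghost_component_def
    by (subst \<phi>.hom_finsum)
      (auto simp: x \<phi>_add_pow \<phi>_pow lessThan_Suc_atMost intro!: finsum_cong')
  moreover have "pcong R p (Suc n) (\<Oplus>i\<in>{..<Suc n}. [(p ^ i)] \<cdot> (\<phi> (x i) [^] (p ^ (n - i))))
      (\<Oplus>i\<in>{..<Suc n}. [(p ^ i)] \<cdot> (x i [^] (p ^ (Suc n - i))))"
  proof (rule pcong_finsum)
    fix i assume i: "i \<in> {..<Suc n}"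
    have "pcong R p (Suc (n - i)) (\<phi> (x i) [^] (p ^ (n - i))) ((x i [^] p) [^] (p ^ (n - i)))"
      using i x by (intro pcong_pow_p_power \<phi>_cong) auto
    also have "(x i [^] p) [^] (p ^ (n - i)) = x i [^] (p ^ (Suc n - i))"
      using i x by (simp add: nat_pow_pow Suc_diff_le)
    finally have "pcong R p (i + Suc (n - i)) ([(p ^ i)] \<cdot> (\<phi> (x i) [^] (p ^ (n - i))))
        ([(p ^ i)] \<cdot> (x i [^] (p ^ (Suc n - i))))"
      using i x by (intro pcong_scale) auto
    then show "pcong R p (Suc n) ([(p ^ i)] \<cdot> (\<phi> (x i) [^] (p ^ (n - i))))
        ([(p ^ i)] \<cdot> (x i [^] (p ^ (Suc n - i))))"
      using i by simp
  qed (use x in auto)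
  ultimately show ?thesis by simp
qed

lemma \<phi>_ghost_cong:
  assumes x: "\<And>i. i \<le> Suc n \<Longrightarrow> x i \<in> carrier R"
  shows "pcong R p (Suc n) (\<phi> (ghost_component p R n x)) (ghost_component p R (Suc n) x)"
proof (rule pcong_trans)
  show "pcong R p (Suc n) (\<phi> (ghost_component p R n x))
      (\<Oplus>i\<in>{..<Suc n}. [(p ^ i)] \<cdot> (x i [^] (p ^ (Suc n - i))))"
    using x by (intro \<phi>_ghost_sum_cong) auto
  have *: "(\<Oplus>i\<in>{..<Suc n}. [(p ^ i)] \<cdot> (x i [^] (p ^ (Suc n - i)))) \<in> carrier R"
    using x by (intro finsum_closed) auto
  show "pcong R p (Suc n) (\<Oplus>i\<in>{..<Suc n}. [(p ^ i)] \<cdot> (x i [^] (p ^ (Suc n - i))))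
      (ghost_component p R (Suc n) x)"
    using x by (intro pcong_sym[OF _ *] pcong_I[OF ghost_component_last]) auto
qed (use x in auto)

text \<open>The part of \<open>w n\<close> contributed by the components below \<open>n\<close> is
  congruent to \<open>w n\<close> modulo \<open>p ^ n\<close>, by the hypothesis together with
  \<open>\<phi>_ghost_sum_cong\<close>. The cofactor of that congruence is taken as the
  \<open>n\<close>-th component.\<close>

lemma dwork:
  assumes w: "\<And>n. w n \<in> carrier R" and cong: "\<And>n. pcong R p (Suc n) (\<phi> (w n)) (w (Suc n))"
  shows "\<exists>x. range x \<subseteq> carrier R \<and> (\<forall>n. ghost_component p R n x = w n)"
proof -
  \<comment> \<open>The guard supplies the membership in the carrier under which the sum may be
    rewritten when \<open>x\<close> changes from \<open>n\<close> on, as the dependent choice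
    requires. It is discharged by the choices already made.\<close>
  let ?P = "\<lambda>x n r. r \<in> carrier R \<and> ((\<forall>i<n. x i \<in> carrier R) \<longrightarrow>
    w n = (\<Oplus>i\<in>{..<n}. [(p ^ i)] \<cdot> (x i [^] (p ^ (n - i)))) \<oplus> [(p ^ n)] \<cdot> r)"
  have ghost: "x i \<in> carrier R \<and> ghost_component p R i x = w i"
    if "\<And>i. i < n \<Longrightarrow> ?P x i (x i)" "i < n" for x n i
    using that by (subst ghost_component_last) force+
  have "\<exists>x. \<forall>n. ?P x n (x n)"
  proof (rule dependent_wellorder_choice)
    show "?P f n r = ?P g n r" if "\<And>y. y < n \<Longrightarrow> f y = g y" for r f g n
    proof -
      have "(\<Oplus>i\<in>{..<n}. [(p ^ i)] \<cdot> (f i [^] (p ^ (n - i)))) =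
          (\<Oplus>i\<in>{..<n}. [(p ^ i)] \<cdot> (g i [^] (p ^ (n - i))))" if "\<forall>i<n. g i \<in> carrier R"
        using that \<open>\<And>y. y < n \<Longrightarrow> f y = g y\<close> by (intro finsum_cong') auto
      then show ?thesis using that by auto
    qed
    show "\<exists>r. ?P x n r" if x: "\<And>i. i < n \<Longrightarrow> ?P x i (x i)" for n x
    proof (cases n)
      case 0
      then show ?thesis using w[of 0] by auto
    next
      case (Suc m)
      let ?s = "\<Oplus>i\<in>{..<Suc m}. [(p ^ i)] \<cdot> (x i [^] (p ^ (Suc m - i)))"
      have xc: "x i \<in> carrier R" if "i \<le> m" for i using x Suc that by simp
      have s: "?s \<in> carrier R" using xc by (intro finsum_closed) auto
      have "pcong R p (Suc m) (\<phi> (w m)) ?s"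
        using \<phi>_ghost_sum_cong[of m x] xc ghost[of n x m, OF x] Suc by simp
      then have "pcong R p (Suc m) (w (Suc m)) ?s"
        using cong[of m] s w by (meson pcong_sym pcong_trans)
      then show ?thesis unfolding Suc pcong_def by blast
    qed
  qed
  then obtain x where x: "\<And>n. ?P x n (x n)" by blast
  show ?thesis
  proof (intro exI conjI allI)
    show "range x \<subseteq> carrier R" using x by auto
    show "ghost_component p R n x = w n" for n
      using ghost[of "Suc n" x n] x by simp
  qed
qed

end


section \<open>Existence of the Witt polynomials\<close>

lemma freshman_prime:
  fixes a b :: "'r::comm_ring_1"
  assumes "prime p"
  shows "\<exists>c. (a + b) ^ p = a ^ p + b ^ p + of_nat p * c"
proof -
  have p: "p > 0" using assms by (simp add: prime_gt_0_nat)
  have "of_nat p dvd (\<Sum>k\<in>{0<..<p}. of_nat (p choose k) * a ^ k * b ^ (p - k))"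
  proof (rule dvd_sum)
    fix k assume "k \<in> {0<..<p}"
    then have "p dvd (p choose k)" using assms by (intro dvd_choose_prime) auto
    then show "of_nat p dvd of_nat (p choose k) * a ^ k * b ^ (p - k)"
      by (auto elim!: dvdE simp: mult.assoc)
  qed
  then obtain c where c: "(\<Sum>k\<in>{0<..<p}. of_nat (p choose k) * a ^ k * b ^ (p - k)) = of_nat p * c"
    by blast
  have "{..p} = insert 0 (insert p {0<..<p})" using p by auto
  then have "(a + b) ^ p = a ^ p + b ^ p + of_nat p * c"
    unfolding binomial_ring c[symmetric] using p by simp
  then show ?thesis by blast
qed

lemma (in cring) pcong_freshman:
  assumes "prime p" "a \<in> carrier R" "b \<in> carrier R"
  shows "pcong R p 1 ((a \<oplus> b) [^] p) (a [^] p \<oplus> b [^] p)"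
proof -
  obtain q where "(mpoly_var a + mpoly_var b) ^ p = mpoly_var a ^ p + mpoly_var b ^ p + of_nat p * q"
    using freshman_prime[OF assms(1)] by blast
  from arg_cong[OF this, of "ceval R"]
  have "(a \<oplus> b) [^] p = a [^] p \<oplus> b [^] p \<oplus> [(p ^ 1)] \<cdot> ceval R q"
    using assms(2,3) by (simp only: ceval_simps(2,5,9) ceval_of_nat_mult power_one_right)
  from pcong_I[OF this] show ?thesis by simp
qed

text \<open>Control of the variables is needed because component \<open>i\<close> of a sum or
  product of truncated vectors may be computed only from components up to \<open>i\<close>.\<close>

definition mpolys_in :: "'v set \<Rightarrow> 'v int_mpoly set" where
  "mpolys_in U = {q. \<forall>m\<in>Poly_Mapping.keys q. Poly_Mapping.keys m \<subseteq> U}"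

lemma mpolys_in_add: "q \<in> mpolys_in U \<Longrightarrow> r \<in> mpolys_in U \<Longrightarrow> q + r \<in> mpolys_in U"
  using keys_add[of q r] by (auto simp: mpolys_in_def)

lemma mpolys_in_uminus: "q \<in> mpolys_in U \<Longrightarrow> - q \<in> mpolys_in U"
  by (auto simp: mpolys_in_def in_keys_iff)

lemma mpolys_in_minus: "q \<in> mpolys_in U \<Longrightarrow> r \<in> mpolys_in U \<Longrightarrow> q - r \<in> mpolys_in U"
  using mpolys_in_add[OF _ mpolys_in_uminus] by (metis diff_conv_add_uminus)

lemma mpolys_in_mult:
  assumes "q \<in> mpolys_in U" "r \<in> mpolys_in U"
  shows "q * r \<in> mpolys_in U"
proof -
  have "Poly_Mapping.keys (a + b) \<subseteq> U"
    if "a \<in> Poly_Mapping.keys q" "b \<in> Poly_Mapping.keys r" for a b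
    using that assms keys_add[of a b] unfolding mpolys_in_def by blast
  then show ?thesis using keys_mult[of q r] unfolding mpolys_in_def by blast
qed

lemma mpolys_in_single: "Poly_Mapping.keys m \<subseteq> U \<Longrightarrow> Poly_Mapping.single m c \<in> mpolys_in U"
  by (auto simp: mpolys_in_def)

lemma mpolys_in_0: "0 \<in> mpolys_in U"
  by (simp add: mpolys_in_def)

lemma mpolys_in_of_nat: "of_nat n \<in> mpolys_in U"
  using mpolys_in_single[of 0 U "int n"] by simp

lemma mpolys_in_1: "1 \<in> mpolys_in U"
  using mpolys_in_of_nat[of 1 U] by simp

lemma mpolys_in_var: "v \<in> U \<Longrightarrow> mpoly_var v \<in> mpolys_in U"
  unfolding mpoly_var_def by (rule mpolys_in_single) auto

lemma mpolys_in_power: "q \<in> mpolys_in U \<Longrightarrow> q ^ n \<in> mpolys_in U"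
  by (induction n) (simp_all add: mpolys_in_mult mpolys_in_1)

lemma mpolys_in_sum: "(\<And>s. s \<in> S \<Longrightarrow> f s \<in> mpolys_in U) \<Longrightarrow> sum f S \<in> mpolys_in U"
  by (induction S rule: infinite_finite_induct) (simp_all add: mpolys_in_add mpolys_in_0)

lemma lookup_of_nat_mult:
  "Poly_Mapping.lookup (of_nat n * (q :: 'v int_mpoly)) m = int n * Poly_Mapping.lookup q m"
  by (induction n) (simp_all add: distrib_right lookup_add)

lemma mpolys_in_cancel: "n > 0 \<Longrightarrow> of_nat n * q \<in> mpolys_in U \<Longrightarrow> q \<in> mpolys_in U"
  unfolding mpolys_in_def by (auto simp: in_keys_iff lookup_of_nat_mult)

lemma mpolys_in_ghost_poly:
  assumes "\<And>i. i \<le> n \<Longrightarrow> x i \<in> mpolys_in U"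
  shows "ghost_poly p x n \<in> mpolys_in U"
  unfolding ghost_poly_def of_nat_power[symmetric]
  using assms by (intro mpolys_in_sum mpolys_in_mult mpolys_in_of_nat mpolys_in_power) auto

lemma ghost_poly_last:
  "ghost_poly p x n = (\<Sum>i<n. of_nat p ^ i * x i ^ (p ^ (n - i))) + of_nat p ^ n * x n"
  by (simp add: ghost_poly_def lessThan_Suc_atMost[symmetric])

text \<open>The last term of the \<open>n\<close>-th ghost polynomial is a difference of polynomials
  in the variables \<open>U\<close>, and dividing it by \<open>p ^ n\<close> does not change the
  monomials that occur.\<close>

lemma mpolys_in_of_ghost_poly:
  assumes "p > 0" and "\<And>m. m \<le> n \<Longrightarrow> ghost_poly p S m \<in> mpolys_in U"
  shows "S n \<in> mpolys_in U"
  using assms(2)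
proof (induction n rule: less_induct)
  case (less n)
  let ?s = "\<Sum>i<n. of_nat p ^ i * S i ^ (p ^ (n - i))"
  have "?s \<in> mpolys_in U"
    unfolding of_nat_power[symmetric] using less
    by (intro mpolys_in_sum mpolys_in_mult mpolys_in_of_nat mpolys_in_power) auto
  then have "ghost_poly p S n - ?s \<in> mpolys_in U" using less by (intro mpolys_in_minus) auto
  then have "of_nat (p ^ n) * S n \<in> mpolys_in U" by (simp add: ghost_poly_last)
  then show ?case using assms(1) mpolys_in_cancel[of "p ^ n" "S n" U] by (simp del: of_nat_power)
qed

section \<open>The Frobenius lift on integer polynomials and the universal Witt polynomials\<close>

locale odd_prime =
  fixes p :: nat
  assumes prime_p: "prime p" and odd_p: "odd p"
begin

lemma p_pos: "p > 0"
  using prime_p by (simp add: prime_gt_0_nat)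

lemma mpoly_p_torsion_free: "p_torsion_free p (class_ring :: 'v int_mpoly ring)"
  unfolding p_torsion_free_def
proof (intro ballI impI)
  fix q :: "'v int_mpoly" assume "[p] \<cdot>\<^bsub>class_ring\<^esub> q = \<zero>\<^bsub>class_ring\<^esub>"
  then have "int p * Poly_Mapping.lookup q m = 0" for m
    by (simp add: lookup_of_nat_mult[symmetric])
  then show "q = \<zero>\<^bsub>class_ring\<^esub>" using p_pos by (intro poly_mapping_eqI) simp
qed

abbreviation mpoly_frob :: "'v int_mpoly \<Rightarrow> 'v int_mpoly" where
  "mpoly_frob \<equiv> mpoly_eval class_ring (\<lambda>v. mpoly_var v ^ p)"

lemma mpoly_frob_simps:
  "mpoly_frob (mpoly_var v) = mpoly_var v ^ p" "mpoly_frob 1 = 1"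
  "mpoly_frob (q + r) = mpoly_frob q + mpoly_frob r" "mpoly_frob (q * r) = mpoly_frob q * mpoly_frob r"
  "mpoly_frob (- q) = - mpoly_frob q"
  by (simp_all add: class_ring.mpoly_eval_add class_ring.mpoly_eval_mult class_ring.mpoly_eval_uminus)

text \<open>On variables the congruence is an equality, and it passes to sums by the binomial
  theorem modulo \<open>p\<close>, to products directly, and to negatives because \<open>p\<close>
  is odd.\<close>

lemma mpoly_frobenius_lift: "frobenius_lift (class_ring :: 'v int_mpoly ring) p mpoly_frob"
proof unfold_locales
  show "mpoly_frob \<in> ring_hom (class_ring :: 'v int_mpoly ring) class_ring"
    by (rule class_ring.mpoly_eval_ring_hom) simp
  fix q :: "'v int_mpoly"
  have "\<exists>c. mpoly_frob q = q ^ p + of_nat p * c"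
  proof (induction q rule: mpoly_var_induct)
    case (uminus q)
    then obtain c where "mpoly_frob q = q ^ p + of_nat p * c" by blast
    then have "mpoly_frob (- q) = (- q) ^ p + of_nat p * (- c)"
      using odd_p by (simp add: mpoly_frob_simps)
    then show ?case by blast
  next
    case (add q r)
    then obtain c d where "mpoly_frob q = q ^ p + of_nat p * c" "mpoly_frob r = r ^ p + of_nat p * d"
      by blast
    moreover obtain e where "(q + r) ^ p = q ^ p + r ^ p + of_nat p * e"
      using freshman_prime[OF prime_p] by blast
    ultimately have "mpoly_frob (q + r) = (q + r) ^ p + of_nat p * (c + d - e)"
      by (simp add: mpoly_frob_simps algebra_simps)
    then show ?case by blast
  next
    case (mult q r)
    then obtain c d where "mpoly_frob q = q ^ p + of_nat p * c" "mpoly_frob r = r ^ p + of_nat p * d"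
      by blast
    then have "mpoly_frob (q * r) = (q * r) ^ p + of_nat p * (c * r ^ p + q ^ p * d + of_nat p * c * d)"
      by (simp add: mpoly_frob_simps algebra_simps power_mult_distrib)
    then show ?case by blast
  qed (auto simp: mpoly_frob_simps intro!: exI[of _ 0])
  then show "pcong class_ring p 1 (mpoly_frob q) (q [^]\<^bsub>class_ring\<^esub> p)"
    by (auto simp: pcong_def)
qed (use prime_p odd_p mpoly_p_torsion_free in auto)

lemma ghost_poly_inj:
  fixes S T :: "nat \<Rightarrow> 'v int_mpoly"
  assumes "\<And>n. ghost_poly p S n = ghost_poly p T n"
  shows "S = T"
  using class_ring.ghost_component_inj[OF mpoly_p_torsion_free, of _ S T] assms by auto

text \<open>Existence is Dwork's lemma, uniqueness is injectivity of the ghost components. Together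
  they make the definite descriptions of the Witt polynomials denote.\<close>

lemma dwork_mpoly:
  fixes w :: "nat \<Rightarrow> 'v int_mpoly"
  assumes "\<And>n. pcong class_ring p (Suc n) (mpoly_frob (w n)) (w (Suc n))"
  shows "\<exists>!S. \<forall>n. ghost_poly p S n = w n"
proof -
  interpret frobenius_lift "class_ring :: 'v int_mpoly ring" p mpoly_frob
    by (rule mpoly_frobenius_lift)
  show ?thesis
  proof (rule ex_ex1I)
    show "\<exists>S. \<forall>n. ghost_poly p S n = w n" using dwork[of w] assms by auto
    show "S = T" if "\<forall>n. ghost_poly p S n = w n" "\<forall>n. ghost_poly p T n = w n" for S T
      using that by (intro ghost_poly_inj) simp
  qed
qed

lemma mpoly_frob_ghost_poly_cong:
  "pcong class_ring p (Suc n) (mpoly_frob (ghost_poly p x n)) (ghost_poly p x (Suc n))"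
  for x :: "nat \<Rightarrow> 'v int_mpoly"
proof -
  interpret frobenius_lift "class_ring :: 'v int_mpoly ring" p mpoly_frob
    by (rule mpoly_frobenius_lift)
  show ?thesis using \<phi>_ghost_cong[of n x] by simp
qed

lemma ghost_poly_witt_add_poly:
  "ghost_poly p (witt_add_poly p) n =
     ghost_poly p (\<lambda>i. mpoly_var (Inl i)) n + ghost_poly p (\<lambda>i. mpoly_var (Inr i)) n"
proof -
  have "\<exists>!S. \<forall>n. ghost_poly p S n = ghost_poly p (\<lambda>i. mpoly_var (Inl i)) n
      + ghost_poly p (\<lambda>i. mpoly_var (Inr i) :: (nat + nat) int_mpoly) n"
    using class_ring.pcong_add[OF mpoly_frob_ghost_poly_cong mpoly_frob_ghost_poly_cong]
    by (intro dwork_mpoly) (simp add: mpoly_frob_simps)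
  from theI'[OF this] show ?thesis unfolding witt_add_poly_def by blast
qed

lemma ghost_poly_witt_mult_poly:
  "ghost_poly p (witt_mult_poly p) n =
     ghost_poly p (\<lambda>i. mpoly_var (Inl i)) n * ghost_poly p (\<lambda>i. mpoly_var (Inr i)) n"
proof -
  have "\<exists>!S. \<forall>n. ghost_poly p S n = ghost_poly p (\<lambda>i. mpoly_var (Inl i)) n
      * ghost_poly p (\<lambda>i. mpoly_var (Inr i) :: (nat + nat) int_mpoly) n"
    using class_ring.pcong_mult[OF mpoly_frob_ghost_poly_cong mpoly_frob_ghost_poly_cong]
    by (intro dwork_mpoly) (simp add: mpoly_frob_simps)
  from theI'[OF this] show ?thesis unfolding witt_mult_poly_def by blast
qed

lemma ghost_poly_witt_frob_poly:
  "ghost_poly p (witt_frob_poly p) n = ghost_poly p mpoly_var (Suc n)"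
proof -
  have "\<exists>!S. \<forall>n. ghost_poly p S n = ghost_poly p (mpoly_var :: nat \<Rightarrow> nat int_mpoly) (Suc n)"
    by (intro dwork_mpoly class_ring.pcong_mono[OF mpoly_frob_ghost_poly_cong]) simp
  from theI'[OF this] show ?thesis unfolding witt_frob_poly_def by blast
qed

lemma witt_add_poly_in: "witt_add_poly p n \<in> mpolys_in (Inl ` {..n} \<union> Inr ` {..n})"
  by (rule mpolys_in_of_ghost_poly[OF p_pos])
    (auto simp: ghost_poly_witt_add_poly intro!: mpolys_in_add mpolys_in_ghost_poly mpolys_in_var)

lemma witt_mult_poly_in: "witt_mult_poly p n \<in> mpolys_in (Inl ` {..n} \<union> Inr ` {..n})"
  by (rule mpolys_in_of_ghost_poly[OF p_pos])
    (auto simp: ghost_poly_witt_mult_poly intro!: mpolys_in_mult mpolys_in_ghost_poly mpolys_in_var)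

lemma witt_frob_poly_in: "witt_frob_poly p n \<in> mpolys_in {..Suc n}"
  by (rule mpolys_in_of_ghost_poly[OF p_pos])
    (auto simp: ghost_poly_witt_frob_poly intro!: mpolys_in_ghost_poly mpolys_in_var)

text \<open>By induction the terms below \<open>n\<close> in the defining equation of the Frobenius
  polynomials agree, modulo p^(n+1), with the corresponding terms of the ghost polynomial of index
  \<open>n + 1\<close>. What remains is p^n times the claim. In characteristic \<open>p\<close> this
  says that Frobenius acts componentwise.\<close>

lemma witt_frob_poly_cong:
  "pcong class_ring p 1 (witt_frob_poly p n) (mpoly_var n ^ p)"
proof (induction n rule: less_induct)
  case (less n)
  let ?F = "witt_frob_poly p" and ?R = "class_ring :: nat int_mpoly ring"
  define s where "s x = (\<Sum>i<n. of_nat p ^ i * x i ^ (p ^ (n - i)))" for x :: "nat \<Rightarrow> nat int_mpoly"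
  let ?t = "s (\<lambda>i. mpoly_var i ^ p)"
  have "pcong ?R p (Suc n) (s ?F) ?t"
    unfolding s_def
  proof (rule class_ring.pcong_finsum[unfolded class_ring_finsum])
    fix i assume "i \<in> {..<n}"
    then have "pcong ?R p (i + Suc (n - i)) ([(p ^ i)] \<cdot>\<^bsub>?R\<^esub> (?F i [^]\<^bsub>?R\<^esub> (p ^ (n - i))))
      ([(p ^ i)] \<cdot>\<^bsub>?R\<^esub> ((mpoly_var i ^ p) [^]\<^bsub>?R\<^esub> (p ^ (n - i))))"
      using less by (intro class_ring.pcong_scale class_ring.pcong_pow_p_power) auto
    then show "pcong ?R p (Suc n) (of_nat p ^ i * ?F i ^ (p ^ (n - i)))
      (of_nat p ^ i * (mpoly_var i ^ p) ^ (p ^ (n - i)))"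
      using \<open>i \<in> {..<n}\<close> by simp
  qed auto
  then obtain c where c: "s ?F = ?t + of_nat (p ^ Suc n) * c" by (auto simp: pcong_def)
  have t: "(\<Sum>i<n. of_nat p ^ i * mpoly_var i ^ (p ^ (Suc n - i))) = ?t"
    unfolding s_def by (intro sum.cong refl) (auto simp: power_mult[symmetric] Suc_diff_le)
  have "s ?F + of_nat p ^ n * ?F n = ghost_poly p ?F n"
    by (simp add: s_def ghost_poly_last)
  also have "\<dots> = ?t + of_nat p ^ n * mpoly_var n ^ p + of_nat p ^ Suc n * mpoly_var (Suc n)"
    unfolding ghost_poly_witt_frob_poly ghost_poly_last[of p mpoly_var "Suc n"] t[symmetric] by simp
  finally have "of_nat (p ^ n) * ?F n = of_nat (p ^ n) * (mpoly_var n ^ p + of_nat p * (mpoly_var (Suc n) - c))"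
    unfolding c by (simp add: algebra_simps)
  then have "?F n = mpoly_var n ^ p + of_nat p * (mpoly_var (Suc n) - c)"
    using class_ring.p_torsion_freeD[OF mpoly_p_torsion_free,
        of n "?F n" "mpoly_var n ^ p + of_nat p * (mpoly_var (Suc n) - c)"]
    by simp
  then show ?case by (auto simp: pcong_def)
qed

end


section \<open>Rings of Witt vectors\<close>

text \<open>Treats W(R) and its truncations at once: the ghost component of index \<open>n\<close>
  reads all components up to \<open>n\<close>, so the index set has to be closed downwards.\<close>

definition initial_segment :: "nat set \<Rightarrow> bool" where
  "initial_segment I \<longleftrightarrow> (\<forall>i\<in>I. {..i} \<subseteq> I)"

lemma initial_segment_UNIV [simp]: "initial_segment UNIV"
  and initial_segment_lessThan [simp]: "initial_segment {..<n}"
  by (auto simp: initial_segment_def)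

lemma initial_segmentD: "initial_segment I \<Longrightarrow> i \<in> I \<Longrightarrow> j \<le> i \<Longrightarrow> j \<in> I"
  by (auto simp: initial_segment_def)

lemma witt_ring_carrier [simp]: "carrier (witt_ring_on p R I) = I \<rightarrow>\<^sub>E carrier R"
  by (simp add: witt_ring_on_def)

lemma witt_ring_one: "\<one>\<^bsub>witt_ring_on p R I\<^esub> = teichmueller R I \<one>\<^bsub>R\<^esub>"
  by (simp add: witt_ring_on_def teichmueller_def)

lemma witt_ring_zero: "\<zero>\<^bsub>witt_ring_on p R I\<^esub> = teichmueller R I \<zero>\<^bsub>R\<^esub>"
  by (auto simp: witt_ring_on_def teichmueller_def)

lemma witt_ring_add:
  "x \<oplus>\<^bsub>witt_ring_on p R I\<^esub> y = (\<lambda>i\<in>I. mpoly_eval R (case_sum x y) (witt_add_poly p i))"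
  by (simp add: witt_ring_on_def)

lemma witt_ring_mult:
  "x \<otimes>\<^bsub>witt_ring_on p R I\<^esub> y = (\<lambda>i\<in>I. mpoly_eval R (case_sum x y) (witt_mult_poly p i))"
  by (simp add: witt_ring_on_def)

locale witt_vectors = cring R + odd_prime p for R (structure) and p
begin

abbreviation W where "W I \<equiv> witt_ring_on p R I"

abbreviation "WU \<equiv> W UNIV"

abbreviation "vec I \<equiv> I \<rightarrow>\<^sub>E carrier R"

abbreviation "ghost \<equiv> ghost_component p R"

abbreviation "frob \<equiv> witt_frob p R"

abbreviation "ver \<equiv> witt_ver R"

abbreviation "teich \<equiv> teichmueller R"

abbreviation "Wt n \<equiv> W {..<n}"

text \<open>Extension by zero. Evaluation is a homomorphism only for valuations with values in the
  carrier everywhere, which a truncated vector does not provide.\<close>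

abbreviation (input) zext where
  "zext I x \<equiv> (\<lambda>i. if i \<in> I then x i else \<zero>)"

lemma range_zext:
  "x \<in> vec I \<Longrightarrow> y \<in> vec I \<Longrightarrow>
    range (case_sum (zext I x) (zext I y)) \<subseteq> carrier R"
  by (auto split: sum.split)

lemma mpoly_eval_zext:
  assumes x: "x \<in> vec I" "y \<in> vec I" and I: "initial_segment I" "i \<in> I"
    and q: "q \<in> mpolys_in (Inl ` {..i} \<union> Inr ` {..i})"
  shows "mpoly_eval R (case_sum x y) q =
    mpoly_eval R (case_sum (zext I x) (zext I y)) q"
  using q x initial_segmentD[OF I] unfolding mpolys_in_def
  by (intro mpoly_eval_cong[of "Inl ` {..i} \<union> Inr ` {..i}"]) (auto simp: PiE_iff)

lemma witt_add_closed [simp]: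
  assumes "initial_segment I" "x \<in> vec I" "y \<in> vec I"
  shows "x \<oplus>\<^bsub>W I\<^esub> y \<in> vec I"
  using mpoly_eval_closed[OF range_zext[OF assms(2,3)]]
  by (auto simp: witt_ring_add mpoly_eval_zext[OF assms(2,3,1)] witt_add_poly_in)

lemma witt_mult_closed [simp]:
  assumes "initial_segment I" "x \<in> vec I" "y \<in> vec I"
  shows "x \<otimes>\<^bsub>W I\<^esub> y \<in> vec I"
  using mpoly_eval_closed[OF range_zext[OF assms(2,3)]]
  by (auto simp: witt_ring_mult mpoly_eval_zext[OF assms(2,3,1)] witt_mult_poly_in)

lemma ghost_closed:
  assumes "x \<in> vec I" "initial_segment I" "n \<in> I"
  shows "ghost n x \<in> carrier R"
  using assms initial_segmentD[OF assms(2,3)] by (intro ghost_component_closed) auto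

lemma ghost_zext:
  assumes "x \<in> vec I" "initial_segment I" "n \<in> I"
  shows "ghost n (zext I x) = ghost n x"
  using assms(1) initial_segmentD[OF assms(2,3)] by (intro ghost_component_cong) auto

text \<open>Common core of the formulas for sums and products: evaluation commutes with forming
  ghost polynomials, and the polynomials up to index \<open>n\<close> do not see where
  \<open>x\<close> and \<open>y\<close> were extended by zero.\<close>

lemma ghost_operation:
  assumes x: "x \<in> vec I" "y \<in> vec I" and I: "initial_segment I" "n \<in> I"
    and S: "\<And>i. S i \<in> mpolys_in (Inl ` {..i} \<union> Inr ` {..i})"
  shows "ghost n (\<lambda>i\<in>I. mpoly_eval R (case_sum x y) (S i)) =
    mpoly_eval R (case_sum (zext I x) (zext I y)) (ghost_poly p S n)"
proof -
  note r = range_zext[OF x]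
  have "mpoly_eval R (case_sum x y) (S i) =
      mpoly_eval R (case_sum (zext I x) (zext I y)) (S i)" if "i \<le> n" for i
    using mpoly_eval_zext[OF x I(1) initial_segmentD[OF I that] S] .
  then show ?thesis
    unfolding mpoly_eval_ghost_poly[OF r] using initial_segmentD[OF I] mpoly_eval_closed[OF r]
    by (intro ghost_component_cong) auto
qed

lemma ghost_add:
  assumes x: "x \<in> vec I" "y \<in> vec I" and I: "initial_segment I" "n \<in> I"
  shows "ghost n (x \<oplus>\<^bsub>W I\<^esub> y) = ghost n x \<oplus> ghost n y"
  using range_zext[OF x] ghost_zext[OF x(1) I] ghost_zext[OF x(2) I]
  by (simp add: witt_ring_add ghost_operation[OF x I witt_add_poly_in] ghost_poly_witt_add_poly
      mpoly_eval_add mpoly_eval_ghost_poly)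

lemma ghost_mult:
  assumes x: "x \<in> vec I" "y \<in> vec I" and I: "initial_segment I" "n \<in> I"
  shows "ghost n (x \<otimes>\<^bsub>W I\<^esub> y) = ghost n x \<otimes> ghost n y"
  using range_zext[OF x] ghost_zext[OF x(1) I] ghost_zext[OF x(2) I]
  by (simp add: witt_ring_mult ghost_operation[OF x I witt_mult_poly_in] ghost_poly_witt_mult_poly
      mpoly_eval_mult mpoly_eval_ghost_poly)

lemma teichmueller_closed [simp]: "r \<in> carrier R \<Longrightarrow> teich I r \<in> vec I"
  by (auto simp: teichmueller_def)

lemma ghost_teichmueller:
  assumes "r \<in> carrier R" "initial_segment I" "n \<in> I"
  shows "ghost n (teich I r) = r [^] (p ^ n)"
proof -
  have "ghost n (teich I r) =
      (\<Oplus>i\<in>insert 0 {1..n}. [(p ^ i)] \<cdot> ((if i = 0 then r else \<zero>) [^] (p ^ (n - i))))"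
    unfolding ghost_component_def using assms initial_segmentD[OF assms(2,3)]
    by (intro finsum_cong') (auto simp: teichmueller_def)
  also have "\<dots> = r [^] (p ^ n) \<oplus> (\<Oplus>i\<in>{1..n}. [(p ^ i)] \<cdot> ((if i = 0 then r else \<zero>) [^] (p ^ (n - i))))"
    using assms by (subst finsum_insert) auto
  also have "(\<Oplus>i\<in>{1..n}. [(p ^ i)] \<cdot> ((if i = 0 then r else \<zero>) [^] (p ^ (n - i)))) = (\<Oplus>i\<in>{1..n}. \<zero>)"
    using p_pos by (intro finsum_cong') (auto simp: nat_pow_zero)
  finally show ?thesis using assms by simp
qed

lemma ghost_one: "initial_segment I \<Longrightarrow> n \<in> I \<Longrightarrow> ghost n \<one>\<^bsub>W I\<^esub> = \<one>"
  by (simp add: witt_ring_one ghost_teichmueller)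

lemma ghost_zero: "initial_segment I \<Longrightarrow> n \<in> I \<Longrightarrow> ghost n \<zero>\<^bsub>W I\<^esub> = \<zero>"
  using p_pos by (simp add: witt_ring_zero ghost_teichmueller nat_pow_zero)

lemma ghost_ring_hom:
  "initial_segment I \<Longrightarrow> n \<in> I \<Longrightarrow> ghost n \<in> ring_hom (W I) R"
  by (rule ring_hom_memI) (auto simp: ghost_add ghost_mult ghost_one ghost_closed[where I = I])

lemma witt_frob_closed:
  assumes x: "x \<in> vec J" and J: "initial_segment J" "\<And>i. i \<in> I \<Longrightarrow> Suc i \<in> J"
  shows "frob I x \<in> vec I"
proof -
  have "mpoly_eval R x (witt_frob_poly p i) = mpoly_eval R (zext J x) (witt_frob_poly p i)"
    if "i \<in> I" for i
    using witt_frob_poly_in[of i] x initial_segmentD[OF J(1) J(2)[OF that]] unfolding mpolys_in_def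
    by (intro mpoly_eval_cong[of "{..Suc i}"]) auto
  moreover have "range (zext J x) \<subseteq> carrier R" using x by auto
  ultimately show ?thesis by (auto simp: witt_frob_def)
qed

lemma ghost_frob:
  assumes x: "x \<in> vec J" and J: "initial_segment J" "Suc n \<in> J"
    and I: "initial_segment I" "n \<in> I"
  shows "ghost n (frob I x) = ghost (Suc n) x"
proof -
  let ?x = "zext J x"
  have r: "range ?x \<subseteq> carrier R" using x by auto
  have "mpoly_eval R x (witt_frob_poly p i) = mpoly_eval R ?x (witt_frob_poly p i)" if "i \<le> n" for i
    using witt_frob_poly_in[of i] x initial_segmentD[OF J] that unfolding mpolys_in_def
    by (intro mpoly_eval_cong[of "{..Suc i}"]) auto
  then have "ghost n (frob I x) =
      ghost n (\<lambda>i. mpoly_eval R ?x (witt_frob_poly p i))"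
    using initial_segmentD[OF I] mpoly_eval_closed[OF r]
    by (intro ghost_component_cong) (auto simp: witt_frob_def)
  also have "\<dots> = mpoly_eval R ?x (ghost_poly p (witt_frob_poly p) n)"
    by (simp add: mpoly_eval_ghost_poly[OF r])
  also have "\<dots> = ghost (Suc n) ?x"
    by (simp add: ghost_poly_witt_frob_poly mpoly_eval_ghost_poly[OF r] mpoly_eval_var[OF r])
  also have "\<dots> = ghost (Suc n) x"
    using x initial_segmentD[OF J] by (intro ghost_component_cong) auto
  finally show ?thesis .
qed

lemma witt_ver_closed:
  assumes x: "x \<in> vec J" and J: "\<And>i. Suc i \<in> I \<Longrightarrow> i \<in> J"
  shows "ver I x \<in> vec I"
  using PiE_mem[OF x] J by (auto simp: witt_ver_def split: nat.split)

lemma ghost_ver_0: "0 \<in> I \<Longrightarrow> ghost 0 (ver I x) = \<zero>"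
  by (simp add: ghost_component_def witt_ver_def)

text \<open>The term at index 0 vanishes. Reindexing the others by one place keeps the exponents
  \<open>p ^ (n - i)\<close> and leaves one factor \<open>p\<close> over.\<close>

lemma ghost_ver_Suc:
  assumes x: "x \<in> vec J" and J: "initial_segment J" "n \<in> J"
    and I: "initial_segment I" "Suc n \<in> I"
  shows "ghost (Suc n) (ver I x) = [p] \<cdot> ghost n x"
proof -
  have xc: "x i \<in> carrier R" if "i \<le> n" for i using x initial_segmentD[OF J] that by auto
  let ?t = "\<lambda>i. [(p ^ i)] \<cdot> (ver I x i [^] (p ^ (Suc n - i)))"
  have t: "?t i \<in> carrier R" if "i \<le> Suc n" for i
    using xc initial_segmentD[OF I] that by (cases i) (auto simp: witt_ver_def)
  have "{..Suc n} = insert 0 (Suc ` {..n})" by (simp add: atMost_Suc_eq_insert_0)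
  moreover have "(\<Oplus>i\<in>insert 0 (Suc ` {..n}). [(p ^ i)] \<cdot> (ver I x i [^] (p ^ (Suc n - i)))) =
      (\<Oplus>i\<in>Suc ` {..n}. [(p ^ i)] \<cdot> (ver I x i [^] (p ^ (Suc n - i))))"
  proof (subst finsum_insert)
    have "?t 0 = \<zero>"
      using initial_segmentD[OF I] p_pos by (simp add: witt_ver_def nat_pow_zero)
    moreover have "(\<Oplus>i\<in>Suc ` {..n}. ?t i) \<in> carrier R"
      using t by (intro finsum_closed) auto
    ultimately show "?t 0 \<oplus> (\<Oplus>i\<in>Suc ` {..n}. ?t i) = (\<Oplus>i\<in>Suc ` {..n}. ?t i)"
      by (simp only: l_zero)
  qed ((rule t funcsetI | force)+)
  moreover have "\<dots> = (\<Oplus>i\<in>{..n}. [(p ^ Suc i)] \<cdot> (ver I x (Suc i) [^] (p ^ (Suc n - Suc i))))"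
    using xc initial_segmentD[OF I] by (subst finsum_reindex) (auto simp: witt_ver_def)
  moreover have "\<dots> = (\<Oplus>i\<in>{..n}. ([p] \<cdot> \<one>) \<otimes> ([(p ^ i)] \<cdot> (x i [^] (p ^ (n - i)))))"
    using xc initial_segmentD[OF I]
    by (intro finsum_cong') (auto simp: witt_ver_def add_pow_ldistr add.nat_pow_pow mult.commute)
  moreover have "\<dots> = [p] \<cdot> ghost n x"
    unfolding ghost_component_def using xc
    by (subst finsum_rdistr[symmetric]) (auto simp: add_pow_ldistr)
  ultimately show ?thesis unfolding ghost_component_def[of p R "Suc n"] by simp
qed

lemma witt_eqI:
  assumes tf: "p_torsion_free p R"
    and x: "x \<in> vec I" "y \<in> vec I" and I: "initial_segment I"
    and ghost: "\<And>n. n \<in> I \<Longrightarrow> ghost n x = ghost n y"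
  shows "x = y"
proof (rule PiE_ext[OF x])
  fix n assume n: "n \<in> I"
  show "x n = y n"
    by (rule ghost_component_inj[OF tf, of n]) (use x initial_segmentD[OF I n] ghost in auto)
qed

text \<open>As \<open>p\<close> is odd, the additive inverse of a Witt vector is computed componentwise.\<close>

lemma ghost_uminus:
  assumes x: "x \<in> vec I" and I: "initial_segment I" "n \<in> I"
  shows "ghost n (\<lambda>i\<in>I. \<ominus> x i) = \<ominus> ghost n x"
proof -
  have xc: "x i \<in> carrier R" if "i \<le> n" for i using x initial_segmentD[OF I] that by auto
  have odd: "(\<ominus> a) [^] (p ^ m) = \<ominus> (a [^] (p ^ m))" if "a \<in> carrier R" for a m
  proof -
    have "(- mpoly_var a) ^ (p ^ m) = - (mpoly_var a ^ (p ^ m))"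
      using odd_p by simp
    from arg_cong[OF this, of "ceval R"] show ?thesis using that by simp
  qed
  have "ghost n (\<lambda>i\<in>I. \<ominus> x i) =
      (\<Oplus>i\<in>{..n}. (\<ominus> \<one>) \<otimes> ([(p ^ i)] \<cdot> (x i [^] (p ^ (n - i)))))"
    unfolding ghost_component_def using xc initial_segmentD[OF I]
    by (intro finsum_cong') (auto simp: odd add.nat_pow_inv l_minus)
  also have "\<dots> = \<ominus> ghost n x"
    unfolding ghost_component_def using xc
    by (subst finsum_rdistr[symmetric]) (auto simp: l_minus intro!: finsum_closed)
  finally show ?thesis .
qed

text \<open>The ghost components embed \<open>W I\<close> into a product of copies of
  \<open>R\<close> and carry its operations to the componentwise ones, so the ring axioms are
  inherited once closure and negatives are available.\<close>

lemma witt_ring_torsion_free_cring: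
  assumes tf: "p_torsion_free p R" and I: "initial_segment I"
  shows "cring (W I)"
proof (intro cringI abelian_groupI comm_monoidI)
  note [simp] = I ghost_closed[where I = I] ghost_add ghost_mult ghost_one ghost_zero
  have [simp]: "\<one>\<^bsub>W I\<^esub> \<in> vec I" "\<zero>\<^bsub>W I\<^esub> \<in> vec I"
    by (simp_all add: witt_ring_one witt_ring_zero)
  fix x assume x: "x \<in> carrier (W I)"
  then have neg: "(\<lambda>i\<in>I. \<ominus> x i) \<in> vec I" by auto
  have "(\<lambda>i\<in>I. \<ominus> x i) \<oplus>\<^bsub>W I\<^esub> x = \<zero>\<^bsub>W I\<^esub>"
    by (rule witt_eqI[OF tf, where I = I]) (use x neg in \<open>simp_all add: ghost_uminus l_neg\<close>)
  then show "\<exists>y\<in>carrier (W I). y \<oplus>\<^bsub>W I\<^esub> x = \<zero>\<^bsub>W I\<^esub>"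
    by (intro bexI[of _ "\<lambda>i\<in>I. \<ominus> x i"]) (use neg in simp_all)
  show "\<one>\<^bsub>W I\<^esub> \<otimes>\<^bsub>W I\<^esub> x = x" "\<zero>\<^bsub>W I\<^esub> \<oplus>\<^bsub>W I\<^esub> x = x"
    by (rule witt_eqI[OF tf, where I = I]; use x in simp)+
  fix y assume y: "y \<in> carrier (W I)"
  show "x \<oplus>\<^bsub>W I\<^esub> y = y \<oplus>\<^bsub>W I\<^esub> x" "x \<otimes>\<^bsub>W I\<^esub> y = y \<otimes>\<^bsub>W I\<^esub> x"
    by (rule witt_eqI[OF tf, where I = I]; use x y in \<open>simp add: a_comm m_comm\<close>)+
  fix z assume z: "z \<in> carrier (W I)"
  show "x \<oplus>\<^bsub>W I\<^esub> y \<oplus>\<^bsub>W I\<^esub> z = x \<oplus>\<^bsub>W I\<^esub> (y \<oplus>\<^bsub>W I\<^esub> z)"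
    "x \<otimes>\<^bsub>W I\<^esub> y \<otimes>\<^bsub>W I\<^esub> z = x \<otimes>\<^bsub>W I\<^esub> (y \<otimes>\<^bsub>W I\<^esub> z)"
    "(x \<oplus>\<^bsub>W I\<^esub> y) \<otimes>\<^bsub>W I\<^esub> z = x \<otimes>\<^bsub>W I\<^esub> z \<oplus>\<^bsub>W I\<^esub> y \<otimes>\<^bsub>W I\<^esub> z"
    by (rule witt_eqI[OF tf, where I = I]; use x y z in \<open>simp add: a_assoc m_assoc l_distr\<close>)+
qed (simp_all add: I witt_ring_one witt_ring_zero)

end

lemma (in witt_vectors) ghost_ver:
  assumes "x \<in> vec UNIV"
  shows "ghost n (ver UNIV x) =
    (case n of 0 \<Rightarrow> \<zero> | Suc m \<Rightarrow> [p] \<cdot> ghost m x)"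
  using assms by (cases n) (simp_all add: ghost_ver_0 ghost_ver_Suc[where J = UNIV])

section \<open>Identities of Witt vectors over torsion-free rings and their descent\<close>

locale torsion_free_witt_vectors = witt_vectors +
  assumes torsion_free: "p_torsion_free p R"
begin

lemma witt_cring: "initial_segment I \<Longrightarrow> cring (W I)"
  by (rule witt_ring_torsion_free_cring[OF torsion_free])

lemmas witt_ext = witt_eqI[OF torsion_free]

text \<open>Each identity is read off from ghost components: \<open>F\<close> shifts them,
  \<open>V\<close> shifts them the other way and multiplies by \<open>p\<close>, and
  \<open>T r\<close> has components \<open>r [^] (p ^ n)\<close>.\<close>

lemma frob_torsion_free:
  assumes x: "x \<in> vec UNIV" and y: "y \<in> vec UNIV"
    and r: "r \<in> carrier R" and s: "s \<in> carrier R"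
  defines "F \<equiv> frob UNIV" and "V \<equiv> ver UNIV" and "T \<equiv> teich UNIV"
  shows "F (x \<oplus>\<^bsub>WU\<^esub> y) = F x \<oplus>\<^bsub>WU\<^esub> F y"
    and "F (x \<otimes>\<^bsub>WU\<^esub> y) = F x \<otimes>\<^bsub>WU\<^esub> F y"
    and "V (x \<oplus>\<^bsub>WU\<^esub> y) = V x \<oplus>\<^bsub>WU\<^esub> V y"
    and "F (V x) = [p] \<cdot>\<^bsub>WU\<^esub> x"
    and "x \<otimes>\<^bsub>WU\<^esub> V y = V (F x \<otimes>\<^bsub>WU\<^esub> y)"
    and "T (r \<otimes> s) = T r \<otimes>\<^bsub>WU\<^esub> T s"
    and "F (T r) = T (r [^] p)"
    and "T (x 0) \<oplus>\<^bsub>WU\<^esub> V (\<lambda>i. x (Suc i)) = x"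
proof -
  interpret W: cring "WU" by (rule witt_cring) simp
  have Fc: "F z \<in> vec UNIV" if "z \<in> vec UNIV" for z
    unfolding F_def using that by (rule witt_frob_closed) simp_all
  have Vc: "V z \<in> vec UNIV" if "z \<in> vec UNIV" for z
    unfolding V_def using that by (rule witt_ver_closed) simp_all
  have Tc: "T a \<in> vec UNIV" if "a \<in> carrier R" for a
    unfolding T_def using that by simp
  have gF: "ghost n (F z) = ghost (Suc n) z"
    if "z \<in> vec UNIV" for z n
    unfolding F_def using that by (rule ghost_frob) simp_all
  have gV: "ghost n (V z) =
      (case n of 0 \<Rightarrow> \<zero> | Suc m \<Rightarrow> [p] \<cdot> ghost m z)"
    if "z \<in> vec UNIV" for z n
    unfolding V_def using that by (rule ghost_ver)
  have gT: "ghost n (T a) = a [^] (p ^ n)" if "a \<in> carrier R" for a n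
    unfolding T_def using that by (simp add: ghost_teichmueller)
  have gp: "ghost n ([m] \<cdot>\<^bsub>WU\<^esub> z) = [m] \<cdot> ghost n z"
    if "z \<in> vec UNIV" for z n and m :: nat
    using that by (intro W.add_pow_mult_ring_hom[OF is_cring ghost_ring_hom]) simp_all
  have pc: "[m] \<cdot>\<^bsub>WU\<^esub> z \<in> vec UNIV" if "z \<in> vec UNIV" for z and m :: nat
    using W.add.nat_pow_closed[of z m] that by simp
  note ext = witt_ext[OF _ _ initial_segment_UNIV]
  note simps = Fc Vc Tc gF gV gT gp pc ghost_add ghost_mult ghost_closed[where I = UNIV]
  show "F (x \<oplus>\<^bsub>WU\<^esub> y) = F x \<oplus>\<^bsub>WU\<^esub> F y" "F (x \<otimes>\<^bsub>WU\<^esub> y) = F x \<otimes>\<^bsub>WU\<^esub> F y"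
    by (rule ext; use x y in \<open>simp add: simps\<close>)+
  show "V (x \<oplus>\<^bsub>WU\<^esub> y) = V x \<oplus>\<^bsub>WU\<^esub> V y"
    by (rule ext; use x y in \<open>simp add: simps add.nat_pow_distrib split: nat.split\<close>)
  show "F (V x) = [p] \<cdot>\<^bsub>WU\<^esub> x"
    by (rule ext; use x y in \<open>simp add: simps\<close>)
  show "x \<otimes>\<^bsub>WU\<^esub> V y = V (F x \<otimes>\<^bsub>WU\<^esub> y)"
    by (rule ext; use x y in \<open>simp add: simps add_pow_rdistr split: nat.split\<close>)
  show "T (r \<otimes> s) = T r \<otimes>\<^bsub>WU\<^esub> T s"
    by (rule ext; use r s in \<open>simp add: simps nat_pow_distrib\<close>)
  show "F (T r) = T (r [^] p)"
    by (rule ext; use r in \<open>simp add: simps nat_pow_pow mult.commute\<close>)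
  have x': "x i \<in> carrier R" for i using x by auto
  then have shift: "(\<lambda>i. x (Suc i)) \<in> vec UNIV" by auto
  \<comment> \<open>Needed for the decomposition of \<open>x\<close> into a Teichmueller lift and a
    Verschiebung: all terms except the one of \<open>x 0\<close> contain a factor \<open>p\<close>,
    and taking it out leaves a ghost component of the shifted vector.\<close>
  have gx: "ghost (Suc n) x =
      x 0 [^] (p ^ Suc n) \<oplus> [p] \<cdot> ghost n (\<lambda>i. x (Suc i))" for n
  proof -
    let ?t = "\<lambda>i. [(p ^ i)] \<cdot> (x i [^] (p ^ (Suc n - i)))"
    have "ghost (Suc n) x = (\<Oplus>i\<in>insert 0 (Suc ` {..n}). ?t i)"
      unfolding ghost_component_def by (simp add: atMost_Suc_eq_insert_0)
    also have "\<dots> = ?t 0 \<oplus> (\<Oplus>i\<in>Suc ` {..n}. ?t i)"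
      using x' by (subst finsum_insert) auto
    also have "(\<Oplus>i\<in>Suc ` {..n}. ?t i) = (\<Oplus>i\<in>{..n}. ?t (Suc i))"
      using x' by (subst finsum_reindex) auto
    also have "\<dots> = (\<Oplus>i\<in>{..n}. ([p] \<cdot> \<one>) \<otimes> ([(p ^ i)] \<cdot> (x (Suc i) [^] (p ^ (n - i)))))"
      using x' by (intro finsum_cong') (auto simp: add_pow_ldistr add.nat_pow_pow mult.commute)
    also have "\<dots> = [p] \<cdot> ghost n (\<lambda>i. x (Suc i))"
      unfolding ghost_component_def using x'
      by (subst finsum_rdistr[symmetric]) (auto simp: add_pow_ldistr)
    finally show ?thesis using x' by simp
  qed
  have "ghost n (T (x 0) \<oplus>\<^bsub>WU\<^esub> V (\<lambda>i. x (Suc i))) = ghost n x" for n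
    using x' shift by (cases n) (simp_all add: simps gx ghost_component_0)
  then show "T (x 0) \<oplus>\<^bsub>WU\<^esub> V (\<lambda>i. x (Suc i)) = x"
    by (intro ext) (use x x' shift in \<open>simp_all add: Tc Vc\<close>)
qed

end

text \<open>Identities between Witt vectors descend from the torsion-free ring of Witt vectors over the
  polynomial ring, which maps onto \<open>W(R)\<close> by functoriality.\<close>

context witt_vectors
begin

abbreviation (input) "WP \<equiv> witt_ring p (class_ring :: 'a int_mpoly ring)"

definition witt_lift :: "(nat \<Rightarrow> 'a int_mpoly) \<Rightarrow> nat \<Rightarrow> 'a" where
  "witt_lift X = (\<lambda>i. ceval R (X i))"

lemma witt_lift_closed [simp]: "witt_lift X \<in> vec UNIV"
  by (auto simp: witt_lift_def)

lemma witt_lift_surj: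
  assumes "x \<in> vec UNIV"
  obtains X where "x = witt_lift X"
  using assms that[of "\<lambda>i. mpoly_var (x i)"] by (auto simp: witt_lift_def PiE_iff)

lemma ceval_mpoly_eval:
  "ceval R (mpoly_eval class_ring f q) = mpoly_eval R (\<lambda>v. ceval R (f v)) q"
  by (rule hom_mpoly_eval[OF cring_class_ring is_cring ceval_hom]) simp

lemma case_sum_comp: "(\<lambda>v. h (case_sum f g v)) = case_sum (\<lambda>i. h (f i)) (\<lambda>i. h (g i))"
  by (auto split: sum.split)

lemma witt_lift_simps:
  "witt_lift (X \<oplus>\<^bsub>WP\<^esub> Y) = witt_lift X \<oplus>\<^bsub>WU\<^esub> witt_lift Y"
  "witt_lift (X \<otimes>\<^bsub>WP\<^esub> Y) = witt_lift X \<otimes>\<^bsub>WU\<^esub> witt_lift Y"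
  "witt_lift \<one>\<^bsub>WP\<^esub> = \<one>\<^bsub>WU\<^esub>" "witt_lift \<zero>\<^bsub>WP\<^esub> = \<zero>\<^bsub>WU\<^esub>"
  "witt_lift (witt_frob p class_ring UNIV X) = frob UNIV (witt_lift X)"
  "witt_lift (witt_ver class_ring UNIV X) = ver UNIV (witt_lift X)"
  "witt_lift (teichmueller class_ring UNIV q) = teich UNIV (ceval R q)"
  by (auto simp: witt_lift_def witt_ring_add witt_ring_mult witt_ring_one witt_ring_zero witt_frob_def
      witt_ver_def teichmueller_def ceval_mpoly_eval case_sum_comp split: nat.split)

lemma witt_lift_hom: "witt_lift \<in> ring_hom WP WU"
  by (rule ring_hom_memI) (auto simp: witt_lift_simps)

lemma mpoly_torsion_free_witt_vectors:
  "torsion_free_witt_vectors (class_ring :: 'v int_mpoly ring) p"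
  by unfold_locales (rule mpoly_p_torsion_free)

text \<open>W(R) is the image of the Witt vectors over the polynomial ring under
  \<open>witt_lift\<close>, hence a ring; commutativity is then lifted separately.\<close>

lemma witt_ring_cring: "cring WU"
proof -
  interpret P: torsion_free_witt_vectors "class_ring :: 'a int_mpoly ring" p
    by (rule mpoly_torsion_free_witt_vectors)
  interpret WP: cring WP by (rule P.witt_cring) simp
  have "witt_lift ` carrier WP = carrier WU"
  proof (intro equalityI subsetI)
    fix x assume "x \<in> carrier WU"
    then show "x \<in> witt_lift ` carrier WP" by (auto elim: witt_lift_surj)
  qed (use witt_lift_closed in force)
  \<comment> \<open>The general lemma on images yields a record that overrides the fields
    \<open>carrier\<close> and \<open>zero\<close> of \<open>WU\<close>, and both overrides agree
    with the original fields.\<close>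
  then have "WU\<lparr>carrier := witt_lift ` carrier WP, zero := witt_lift \<zero>\<^bsub>WP\<^esub>\<rparr> = WU"
    by (simp add: witt_lift_simps)
  moreover have "ring (WU\<lparr>carrier := witt_lift ` carrier WP, zero := witt_lift \<zero>\<^bsub>WP\<^esub>\<rparr>)"
    by (rule WP.ring_hom_imp_img_ring[OF witt_lift_hom])
  ultimately interpret WU: ring WU by simp
  show ?thesis
  proof unfold_locales
    fix x y assume "x \<in> carrier WU" "y \<in> carrier WU"
    then obtain X Y where "x = witt_lift X" "y = witt_lift Y" by (metis witt_lift_surj witt_ring_carrier)
    then show "x \<otimes>\<^bsub>WU\<^esub> y = y \<otimes>\<^bsub>WU\<^esub> x" using WP.m_comm[of X Y] by (simp flip: witt_lift_simps)
  qed
qed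

lemma witt_add_pow_lift: "witt_lift ([(n::nat)] \<cdot>\<^bsub>WP\<^esub> X) = [n] \<cdot>\<^bsub>WU\<^esub> witt_lift X"
proof -
  interpret P: torsion_free_witt_vectors "class_ring :: 'a int_mpoly ring" p
    by (rule mpoly_torsion_free_witt_vectors)
  interpret WP: cring WP by (rule P.witt_cring) simp
  show ?thesis by (rule WP.add_pow_mult_ring_hom[OF witt_ring_cring witt_lift_hom]) simp
qed

lemma witt_identities:
  assumes x: "x \<in> vec UNIV" and y: "y \<in> vec UNIV"
    and r: "r \<in> carrier R" and s: "s \<in> carrier R"
  shows frob_add: "frob UNIV (x \<oplus>\<^bsub>WU\<^esub> y) = frob UNIV x \<oplus>\<^bsub>WU\<^esub> frob UNIV y"
    and frob_mult: "frob UNIV (x \<otimes>\<^bsub>WU\<^esub> y) = frob UNIV x \<otimes>\<^bsub>WU\<^esub> frob UNIV y"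
    and ver_add: "ver UNIV (x \<oplus>\<^bsub>WU\<^esub> y) = ver UNIV x \<oplus>\<^bsub>WU\<^esub> ver UNIV y"
    and frob_ver: "frob UNIV (ver UNIV x) = [p] \<cdot>\<^bsub>WU\<^esub> x"
    and mult_ver: "x \<otimes>\<^bsub>WU\<^esub> ver UNIV y = ver UNIV (frob UNIV x \<otimes>\<^bsub>WU\<^esub> y)"
    and teichmueller_mult: "teich UNIV (r \<otimes> s) = teich UNIV r \<otimes>\<^bsub>WU\<^esub> teich UNIV s"
    and frob_teichmueller: "frob UNIV (teich UNIV r) = teich UNIV (r [^] p)"
    and teichmueller_ver: "teich UNIV (x 0) \<oplus>\<^bsub>WU\<^esub> ver UNIV (\<lambda>i. x (Suc i)) = x"
proof -
  interpret P: torsion_free_witt_vectors "class_ring :: 'a int_mpoly ring" p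
    by (rule mpoly_torsion_free_witt_vectors)
  obtain X Y where x': "x = witt_lift X" and y': "y = witt_lift Y"
    using x y by (metis witt_lift_surj)
  have r': "r = ceval R (mpoly_var r)" and s': "s = ceval R (mpoly_var s)"
    using r s by simp_all
  have x0: "x 0 = ceval R (X 0)" "(\<lambda>i. x (Suc i)) = witt_lift (\<lambda>i. X (Suc i))"
    by (simp_all add: x' witt_lift_def)
  note P = P.frob_torsion_free[of X Y "mpoly_var r" "mpoly_var s", simplified,
      THEN arg_cong[of _ _ witt_lift], unfolded witt_lift_simps witt_add_pow_lift
      ceval_simps(6,9), folded x' y' r' s']
  show "frob UNIV (x \<oplus>\<^bsub>WU\<^esub> y) = frob UNIV x \<oplus>\<^bsub>WU\<^esub> frob UNIV y"
    "frob UNIV (x \<otimes>\<^bsub>WU\<^esub> y) = frob UNIV x \<otimes>\<^bsub>WU\<^esub> frob UNIV y"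
    "ver UNIV (x \<oplus>\<^bsub>WU\<^esub> y) = ver UNIV x \<oplus>\<^bsub>WU\<^esub> ver UNIV y"
    "frob UNIV (ver UNIV x) = [p] \<cdot>\<^bsub>WU\<^esub> x"
    "x \<otimes>\<^bsub>WU\<^esub> ver UNIV y = ver UNIV (frob UNIV x \<otimes>\<^bsub>WU\<^esub> y)"
    "teich UNIV (r \<otimes> s) = teich UNIV r \<otimes>\<^bsub>WU\<^esub> teich UNIV s"
    "frob UNIV (teich UNIV r) = teich UNIV (r [^] p)"
    "teich UNIV (x 0) \<oplus>\<^bsub>WU\<^esub> ver UNIV (\<lambda>i. x (Suc i)) = x"
    unfolding x0 by (fact P)+
qed

text \<open>The \<open>n\<close>-th Frobenius polynomial differs from the \<open>p\<close>-th power
  of the \<open>n\<close>-th variable by a multiple of \<open>p\<close>, which evaluates to zero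
  here.\<close>

lemma frob_char_p:
  assumes "[p] \<cdot> \<one> = \<zero>" "x \<in> vec UNIV"
  shows "frob UNIV x = (\<lambda>i. x i [^] p)"
proof
  fix n
  obtain c where "witt_frob_poly p n = mpoly_var n ^ p + of_nat p * c"
    using witt_frob_poly_cong[of n] by (auto simp: pcong_def)
  moreover have "range x \<subseteq> carrier R" using assms(2) by auto
  moreover have "[p] \<cdot> mpoly_eval R x c = \<zero>"
    using assms(1) \<open>range x \<subseteq> carrier R\<close> by (subst add_pow_mult_one) simp_all
  moreover have "x n \<in> carrier R" using assms(2) by auto
  ultimately show "frob UNIV x n = x n [^] p"
    by (simp add: witt_frob_def mpoly_eval_add mpoly_eval_power mpoly_eval_of_nat_mult)
qed

end


section \<open>Witt vectors over a ring with a bijective Frobenius lift\<close>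

locale bijective_frobenius_lift = frobenius_lift R p \<phi> for R (structure) and p \<phi> +
  assumes \<phi>_bij: "bij_betw \<phi> (carrier R) (carrier R)"
begin

sublocale torsion_free_witt_vectors R p
  by unfold_locales (rule prime_p odd_p torsion_free)+

abbreviation "\<psi> \<equiv> inv_into (carrier R) \<phi>"

lemma \<phi>_\<psi>: "a \<in> carrier R \<Longrightarrow> \<phi> (\<psi> a) = a"
  using \<phi>_bij by (simp add: bij_betw_def f_inv_into_f)

lemma \<psi>_\<phi>: "a \<in> carrier R \<Longrightarrow> \<psi> (\<phi> a) = a"
  using \<phi>_bij by (simp add: bij_betw_def)

lemma \<psi>_closed: "a \<in> carrier R \<Longrightarrow> \<psi> a \<in> carrier R"
  using \<phi>_bij by (simp add: bij_betw_def inv_into_into)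

lemma \<psi>_hom: "\<psi> \<in> ring_hom R R"
proof (rule ring_hom_memI)
  fix a b assume ab: "a \<in> carrier R" "b \<in> carrier R"
  then show "\<psi> (a \<otimes> b) = \<psi> a \<otimes> \<psi> b" "\<psi> (a \<oplus> b) = \<psi> a \<oplus> \<psi> b"
    using \<psi>_\<phi>[of "\<psi> a \<otimes> \<psi> b"] \<psi>_\<phi>[of "\<psi> a \<oplus> \<psi> b"] by (simp_all add: \<phi>_\<psi> \<psi>_closed)
next
  show "\<psi> \<one> = \<one>" using \<psi>_\<phi>[of \<one>] by simp
qed (rule \<psi>_closed)

lemma funpow_ring_hom: "h \<in> ring_hom R R \<Longrightarrow> h ^^ n \<in> ring_hom R R"
proof (induction n)
  case 0
  then show ?case by (auto intro: ring_hom_memI)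
next
  case (Suc n)
  then show ?case using ring_hom_trans[of "h ^^ n" R R h R] by (simp add: comp_def)
qed

lemmas \<phi>_funpow_hom = funpow_ring_hom[OF \<phi>_hom]
lemmas \<psi>_funpow_hom = funpow_ring_hom[OF \<psi>_hom]
lemmas \<phi>_funpow_closed = ring_hom_closed[OF \<phi>_funpow_hom]
lemmas \<psi>_funpow_closed = ring_hom_closed[OF \<psi>_funpow_hom]

lemma \<psi>_\<phi>_funpow: "a \<in> carrier R \<Longrightarrow> (\<psi> ^^ n) ((\<phi> ^^ n) a) = a"
proof (induction n)
  case (Suc n)
  then show ?case by (subst funpow_Suc_right) (simp add: \<psi>_\<phi> \<phi>_funpow_closed)
qed simp

lemma \<phi>_\<psi>_funpow: "a \<in> carrier R \<Longrightarrow> (\<phi> ^^ n) ((\<psi> ^^ n) a) = a"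
proof (induction n)
  case (Suc n)
  then show ?case by (subst funpow_Suc_right) (simp add: \<phi>_\<psi> \<psi>_funpow_closed)
qed simp

text \<open>Follows the description in \<open>s_phi\<close> clause by clause, so that the two are
  identified by unfolding.\<close>

definition is_ghost_section :: "('a \<Rightarrow> nat \<Rightarrow> 'a) \<Rightarrow> bool" where
  "is_ghost_section s \<longleftrightarrow> s \<in> ring_hom R WU \<and> s \<in> extensional (carrier R) \<and>
     (\<forall>a\<in>carrier R. frob UNIV (s a) = s (\<phi> a)) \<and>
     (\<forall>a\<in>carrier R. \<forall>n. ghost n (s a) = (\<phi> ^^ n) a)"

text \<open>Dwork's lemma applies to the sequence of iterates \<phi>^n(a), for which its congruences
  are equalities. Since the iterates of \<phi> are ring homomorphisms and ghost components are
  faithful, the resulting map is a homomorphism and is unique.\<close>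

lemma ghost_section_ex1: "\<exists>!s. is_ghost_section s"
proof (rule ex_ex1I)
  have "\<exists>x. x \<in> vec UNIV \<and> (\<forall>n. ghost n x = (\<phi> ^^ n) a)"
    if a: "a \<in> carrier R" for a
    using dwork[of "\<lambda>n. (\<phi> ^^ n) a"] \<phi>_funpow_closed[OF a] by auto
  then obtain f where f: "\<And>a. a \<in> carrier R \<Longrightarrow> f a \<in> vec UNIV"
      "\<And>a n. a \<in> carrier R \<Longrightarrow> ghost n (f a) = (\<phi> ^^ n) a"
    by metis
  note hom = ring_hom_add[OF \<phi>_funpow_hom] ring_hom_mult[OF \<phi>_funpow_hom] ring_hom_one[OF \<phi>_funpow_hom]
  have "f (a \<oplus> b) = f a \<oplus>\<^bsub>WU\<^esub> f b" "f (a \<otimes> b) = f a \<otimes>\<^bsub>WU\<^esub> f b"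
    if "a \<in> carrier R" "b \<in> carrier R" for a b
    by (rule witt_ext[OF _ _ initial_segment_UNIV]; use that f in \<open>simp add: ghost_add ghost_mult hom\<close>)+
  moreover have "f \<one> = \<one>\<^bsub>WU\<^esub>"
    by (rule witt_ext[OF _ _ initial_segment_UNIV]; use f in \<open>simp add: witt_ring_one ghost_teichmueller hom\<close>)
  moreover have "frob UNIV (f a) = f (\<phi> a)" if a: "a \<in> carrier R" for a
  proof (rule witt_ext[OF _ _ initial_segment_UNIV])
    show "frob UNIV (f a) \<in> vec UNIV"
      using f(1)[OF a] by (rule witt_frob_closed) simp_all
    show "ghost n (frob UNIV (f a)) = ghost n (f (\<phi> a))" for n
      using ghost_frob[OF f(1)[OF a], of n UNIV] f(2) a by (simp add: funpow_swap1)
  qed (use f a in auto)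
  ultimately have "is_ghost_section (restrict f (carrier R))"
    unfolding is_ghost_section_def using f by (auto intro!: ring_hom_memI)
  then show "\<exists>s. is_ghost_section s" by blast
  fix s t assume st: "is_ghost_section s" "is_ghost_section t"
  show "s = t"
  proof (rule extensionalityI)
    fix a assume a: "a \<in> carrier R"
    show "s a = t a"
    proof (rule witt_ext[OF _ _ initial_segment_UNIV])
      show "s a \<in> vec UNIV" "t a \<in> vec UNIV"
        using st a by (metis is_ghost_section_def ring_hom_closed witt_ring_carrier)+
    qed (use st a in \<open>simp add: is_ghost_section_def\<close>)
  qed (use st in \<open>auto simp: is_ghost_section_def\<close>)
qed

definition "ghost_section = (THE s. is_ghost_section s)"

lemma is_ghost_section: "is_ghost_section ghost_section"
  unfolding ghost_section_def by (rule theI'[OF ghost_section_ex1])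

lemma ghost_section_closed: "a \<in> carrier R \<Longrightarrow> ghost_section a \<in> vec UNIV"
  using is_ghost_section unfolding is_ghost_section_def by (metis ring_hom_closed witt_ring_carrier)

lemma ghost_ghost_section:
  "a \<in> carrier R \<Longrightarrow> ghost n (ghost_section a) = (\<phi> ^^ n) a"
  using is_ghost_section by (simp add: is_ghost_section_def)

lemma ghost_restrict:
  assumes "x \<in> vec UNIV \<or> x \<in> vec J \<and> initial_segment J \<and> m \<in> J" "m < n"
  shows "ghost m (restrict x {..<n}) = ghost m x"
  using assms initial_segmentD[of J m] by (intro ghost_component_cong) auto

text \<open>The ghost components of a Witt vector, twisted so that they form a sequence \<open>g\<close> with
  \<open>g\<^sub>i \<equiv> g\<^sub>i\<^sub>-\<^sub>1\<close> modulo \<open>p\<^sup>i\<close>. The coefficients of \<open>x\<close> in the basis \<open>V\<^sup>i(1)\<close> are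
  \<open>(g\<^sub>i - g\<^sub>i\<^sub>-\<^sub>1) / p\<^sup>i\<close>.\<close>

definition tghost :: "nat \<Rightarrow> (nat \<Rightarrow> 'a) \<Rightarrow> 'a" where
  "tghost m x = (\<psi> ^^ m) (ghost m x)"

lemma tghost_hom: "m < n \<Longrightarrow> tghost m \<in> ring_hom (Wt n) R"
  using ring_hom_trans[OF ghost_ring_hom \<psi>_funpow_hom, of "{..<n}" m m]
  by (simp add: tghost_def[abs_def] comp_def)

lemma tghost_simps:
  assumes "m < n" "x \<in> vec {..<n}" "y \<in> vec {..<n}"
  shows tghost_closed: "tghost m x \<in> carrier R"
    and tghost_add: "tghost m (x \<oplus>\<^bsub>Wt n\<^esub> y) = tghost m x \<oplus> tghost m y"
    and tghost_mult: "tghost m (x \<otimes>\<^bsub>Wt n\<^esub> y) = tghost m x \<otimes> tghost m y"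
    and tghost_one: "tghost m \<one>\<^bsub>Wt n\<^esub> = \<one>"
  using assms ring_hom_closed[OF tghost_hom[OF assms(1)]]
    ring_hom_add[OF tghost_hom[OF assms(1)]] ring_hom_mult[OF tghost_hom[OF assms(1)]]
    ring_hom_one[OF tghost_hom[OF assms(1)]]
  by simp_all

lemma tghost_ext:
  assumes "x \<in> vec {..<n}" "y \<in> vec {..<n}"
    and "\<And>m. m < n \<Longrightarrow> tghost m x = tghost m y"
  shows "x = y"
proof (rule witt_ext[OF assms(1,2) initial_segment_lessThan])
  fix m assume m: "m \<in> {..<n}"
  have "(\<phi> ^^ m) (tghost m z) = ghost m z" if "z \<in> vec {..<n}" for z
    unfolding tghost_def using ghost_closed[OF that initial_segment_lessThan m]
    by (rule \<phi>_\<psi>_funpow)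
  then show "ghost m x = ghost m y" using assms m by (metis lessThan_iff)
qed

lemma tghost_restrict:
  "x \<in> vec {..<Suc n} \<Longrightarrow> m < n \<Longrightarrow> tghost m (restrict x {..<n}) = tghost m x"
  unfolding tghost_def using ghost_restrict[of x "{..<Suc n}" m n] by simp

lemma tghost_teichmueller:
  "r \<in> carrier R \<Longrightarrow> m < n \<Longrightarrow> tghost m (teich {..<n} r) = (\<psi> ^^ m) (r [^] (p ^ m))"
  by (simp add: tghost_def ghost_teichmueller)

lemma tghost_frob:
  assumes "x \<in> vec {..<Suc n}" "m < n"
  shows "tghost m (frob {..<n} x) = \<phi> (tghost (Suc m) x)"
proof -
  have "ghost (Suc m) x \<in> carrier R"
    using assms by (intro ghost_closed[where I = "{..<Suc n}"]) auto
  then show ?thesis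
    using ghost_frob[OF assms(1), of m "{..<n}"] assms(2)
    by (simp add: tghost_def \<phi>_\<psi> \<psi>_funpow_closed)
qed

lemma tghost_ver_0: "tghost 0 (ver {..<Suc n} x) = \<zero>"
  by (simp add: tghost_def ghost_ver_0)

lemma tghost_ver_Suc:
  assumes "x \<in> vec {..<n}" "m < n"
  shows "tghost (Suc m) (ver {..<Suc n} x) = [p] \<cdot> \<psi> (tghost m x)"
proof -
  have g: "ghost m x \<in> carrier R"
    using assms by (intro ghost_closed[where I = "{..<n}"]) auto
  then show ?thesis
    using ghost_ver_Suc[OF assms(1), of m "{..<Suc n}"] assms(2)
    by (simp add: tghost_def add_pow_mult_ring_hom[OF is_cring \<psi>_hom]
        add_pow_mult_ring_hom[OF is_cring \<psi>_funpow_hom] \<psi>_funpow_closed)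
qed

text \<open>The convention g_(-1) = 0, which lets the coefficient formula include the index
  0.\<close>

definition prev_ghost :: "nat \<Rightarrow> (nat \<Rightarrow> 'a) \<Rightarrow> 'a" where
  "prev_ghost i x = (case i of 0 \<Rightarrow> \<zero> | Suc m \<Rightarrow> tghost m x)"

lemma prev_ghost_simps [simp]:
  "prev_ghost 0 x = \<zero>" "prev_ghost (Suc m) x = tghost m x"
  by (simp_all add: prev_ghost_def)

lemma prev_ghost_closed:
  "i < n \<Longrightarrow> x \<in> vec {..<n} \<Longrightarrow> prev_ghost i x \<in> carrier R"
  by (cases i) (auto intro: tghost_closed[where n = n])

text \<open>Dwork's congruence between \<phi>(w_m) and w_(m+1) modulo p^(m+1) is transported by the
  homomorphism \<psi>^(m+1), and \<psi>^(m+1) \<phi> is \<psi>^m. At index 0 the modulus is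
  1.\<close>

lemma tghost_cong_previous:
  assumes "i < n" "x \<in> vec {..<n}"
  shows "pcong R p i (tghost i x) (prev_ghost i x)"
proof (cases i)
  case 0
  have "tghost 0 x \<in> carrier R" using assms 0 by (intro tghost_closed[where n = n]) auto
  then show ?thesis unfolding 0 by (intro pcong_I[of _ _ _ _ "tghost 0 x"]) simp_all
next
  case (Suc m)
  have x: "x j \<in> carrier R" if "j \<le> Suc m" for j
    using that assms(1) Suc PiE_mem[OF assms(2), of j] by simp
  have c: "ghost j x \<in> carrier R" if "j \<le> Suc m" for j
    using x that by (intro ghost_component_closed) auto
  have "pcong R p (Suc m) ((\<psi> ^^ Suc m) (\<phi> (ghost m x)))
      ((\<psi> ^^ Suc m) (ghost (Suc m) x))"
    by (rule pcong_hom[OF \<phi>_ghost_cong _ is_cring \<psi>_funpow_hom]) (use x c in auto)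
  also have "(\<psi> ^^ Suc m) (\<phi> (ghost m x)) = tghost m x"
    unfolding tghost_def using c by (subst funpow_Suc_right) (simp add: \<psi>_\<phi>)
  finally have "pcong R p (Suc m) (tghost m x) (tghost (Suc m) x)"
    by (simp add: tghost_def)
  then show ?thesis unfolding Suc prev_ghost_simps
    by (rule pcong_sym) (use assms Suc in \<open>auto intro: tghost_closed[where n = n]\<close>)
qed

lemma tghost_cong:
  assumes "i \<le> m" "m < n" "x \<in> vec {..<n}"
  shows "pcong R p i (tghost m x) (tghost i x)"
  using assms(1,2)
proof (induction m rule: dec_induct)
  case base
  then show ?case using assms by (intro pcong_refl tghost_closed)
next
  case (step m)
  have "pcong R p i (tghost (Suc m) x) (tghost m x)"
    using tghost_cong_previous[of "Suc m" n x] step assms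
    by (intro pcong_mono[of p "Suc m" _ _ i]) auto
  moreover have "pcong R p i (tghost m x) (tghost i x)" using step by simp
  moreover have "tghost i x \<in> carrier R"
    using step assms by (intro tghost_closed[where n = n]) auto
  ultimately show ?case by (rule pcong_trans)
qed

section \<open>The expansion of a truncated Witt vector in the elements V^i(1)\<close>

definition ver_power :: "nat \<Rightarrow> nat \<Rightarrow> nat \<Rightarrow> 'a" where
  "ver_power n i = restrict ((ver UNIV ^^ i) \<one>\<^bsub>WU\<^esub>) {..<n}"

lemma ver_power_aux:
  "(ver UNIV ^^ i) \<one>\<^bsub>WU\<^esub> \<in> vec UNIV \<and>
   ghost m ((ver UNIV ^^ i) \<one>\<^bsub>WU\<^esub>) =
     (if i \<le> m then [(p ^ i)] \<cdot> \<one> else \<zero>)"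
proof (induction i arbitrary: m)
  case 0
  then show ?case using ghost_one[of UNIV m] by (simp add: witt_ring_one)
next
  case (Suc i)
  let ?v = "(ver UNIV ^^ i) \<one>\<^bsub>WU\<^esub>"
  have v: "?v \<in> vec UNIV" using Suc by blast
  then have "ver UNIV ?v \<in> vec UNIV" by (rule witt_ver_closed) simp
  moreover have "ghost l ?v = (if i \<le> l then [(p ^ i)] \<cdot> \<one> else \<zero>)" for l
    using Suc by blast
  ultimately show ?case
    using v by (auto simp: ghost_ver add.nat_pow_pow mult.commute split: nat.split)
qed

lemma ver_power_closed: "ver_power n i \<in> vec {..<n}"
  unfolding ver_power_def using ver_power_aux[of i] by auto

lemma tghost_ver_power:
  assumes "m < n"
  shows "tghost m (ver_power n i) = (if i \<le> m then [(p ^ i)] \<cdot> \<one> else \<zero>)"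
proof -
  interpret h: ring_hom_cring R R "\<psi> ^^ m" by unfold_locales (rule \<psi>_funpow_hom)
  show ?thesis
    using ver_power_aux[of i m] assms
    by (simp add: tghost_def ver_power_def ghost_restrict
        add_pow_mult_ring_hom[OF is_cring \<psi>_funpow_hom] del: funpow.simps)
qed

lemma tghost_ghost_section:
  "a \<in> carrier R \<Longrightarrow> m < n \<Longrightarrow> tghost m (restrict (ghost_section a) {..<n}) = a"
  by (simp add: tghost_def ghost_restrict ghost_section_closed ghost_ghost_section \<psi>_\<phi>_funpow)

definition is_coeffs :: "nat \<Rightarrow> (nat \<Rightarrow> 'a) \<Rightarrow> (nat \<Rightarrow> 'a) \<Rightarrow> bool" where
  "is_coeffs n x a \<longleftrightarrow> a \<in> vec {..<n} \<and>
     x = (\<Oplus>\<^bsub>Wt n\<^esub>i\<in>{..<n}. restrict (ghost_section (a i)) {..<n} \<otimes>\<^bsub>Wt n\<^esub> ver_power n i)"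

lemma eq_iff_tghost:
  assumes "x \<in> vec {..<n}" "y \<in> vec {..<n}"
    and "\<And>m. m < n \<Longrightarrow> tghost m y = g m"
  shows "x = y \<longleftrightarrow> (\<forall>m<n. tghost m x = g m)"
proof
  assume "\<forall>m<n. tghost m x = g m"
  with assms show "x = y" by (intro tghost_ext[OF assms(1,2)]) simp
qed (use assms(3) in blast)

text \<open>In twisted components the section of \<open>a i\<close> is constantly
  \<open>a i\<close>, and V^i(1) is p^i from index \<open>i\<close> on and zero before. Hence the
  expansion says that each component of \<open>x\<close> is a partial sum.\<close>

lemma is_coeffs_iff_sum:
  assumes x: "x \<in> vec {..<n}"
  shows "is_coeffs n x a \<longleftrightarrow> a \<in> vec {..<n} \<and>
    (\<forall>m<n. tghost m x = (\<Oplus>i\<in>{..m}. [(p ^ i)] \<cdot> a i))"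
proof (cases "a \<in> vec {..<n}")
  case True
  interpret Wn: cring "Wt n" by (rule witt_cring) simp
  let ?t = "\<lambda>i. restrict (ghost_section (a i)) {..<n} \<otimes>\<^bsub>Wt n\<^esub> ver_power n i"
  let ?y = "\<Oplus>\<^bsub>Wt n\<^esub>i\<in>{..<n}. ?t i"
  have a: "a i \<in> carrier R" if "i < n" for i using True that by auto
  have s: "restrict (ghost_section (a i)) {..<n} \<in> vec {..<n}" if "i < n" for i
    using ghost_section_closed[OF a[OF that]] by auto
  have t: "?t i \<in> carrier (Wt n)" if "i < n" for i
    using s[OF that] ver_power_closed by simp
  have "?y \<in> carrier (Wt n)"
    by (rule Wn.finsum_closed) (use t in blast)
  then have y: "?y \<in> vec {..<n}"
    unfolding witt_ring_carrier .
  have "tghost m ?y = (\<Oplus>i\<in>{..m}. [(p ^ i)] \<cdot> a i)" if m: "m < n" for m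
  proof -
    interpret h: ring_hom_cring "Wt n" R "tghost m"
      by unfold_locales (rule tghost_hom[OF m])
    have "tghost m ?y = (\<Oplus>i\<in>{..<n}. tghost m (?t i))"
      using h.hom_finsum[of ?t "{..<n}"] t by (simp only: comp_def Pi_def lessThan_iff) blast
    also have "\<dots> = (\<Oplus>i\<in>{..<n}. a i \<otimes> (if i \<le> m then [(p ^ i)] \<cdot> \<one> else \<zero>))"
    proof (rule finsum_cong')
      fix i assume "i \<in> {..<n}"
      then have i: "i < n" by simp
      show "tghost m (?t i) = a i \<otimes> (if i \<le> m then [(p ^ i)] \<cdot> \<one> else \<zero>)"
        unfolding tghost_mult[OF m s[OF i] ver_power_closed] tghost_ver_power[OF m]
          tghost_ghost_section[OF a[OF i] m] ..
    qed (use a in auto)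
    also have "\<dots> = (\<Oplus>i\<in>{..m}. [(p ^ i)] \<cdot> a i)"
      by (rule add.finprod_mono_neutral_cong_right) (use a m in \<open>auto simp: add_pow_rdistr\<close>)
    finally show ?thesis .
  qed
  from eq_iff_tghost[OF x y this] True show ?thesis unfolding is_coeffs_def by blast
qed (simp add: is_coeffs_def)

text \<open>Subtracting consecutive partial sums gives this recursion, and induction on the index
  rebuilds the sums from it.\<close>

lemma is_coeffs_iff:
  assumes x: "x \<in> vec {..<n}"
  shows "is_coeffs n x a \<longleftrightarrow> a \<in> vec {..<n} \<and>
    (\<forall>i<n. tghost i x = prev_ghost i x \<oplus> [(p ^ i)] \<cdot> a i)"
proof (cases "a \<in> vec {..<n}")
  case True
  then have a: "a i \<in> carrier R" if "i < n" for i using that by auto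
  let ?s = "\<lambda>m. \<Oplus>i\<in>{..m}. [(p ^ i)] \<cdot> a i"
  have Suc: "?s (Suc m) = ?s m \<oplus> [(p ^ Suc m)] \<cdot> a (Suc m)" if "Suc m < n" for m
    using a that by (subst finsum_Suc) (auto simp: a_comm intro!: finsum_closed)
  have z: "?s 0 = \<zero> \<oplus> [(p ^ 0)] \<cdot> a 0" if "0 < n" using a[OF that] by simp
  have "(\<forall>m<n. tghost m x = ?s m) \<longleftrightarrow>
      (\<forall>i<n. tghost i x = prev_ghost i x \<oplus> [(p ^ i)] \<cdot> a i)"
  proof (intro iffI allI impI)
    fix i assume *: "\<forall>m<n. tghost m x = ?s m" "i < n"
    show "tghost i x = prev_ghost i x \<oplus> [(p ^ i)] \<cdot> a i"
    proof (cases i)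
      case 0
      then show ?thesis using * z by simp
    next
      case (Suc j)
      then show ?thesis using * \<open>\<And>m. Suc m < n \<Longrightarrow> ?s (Suc m) = _\<close>[of j] by simp
    qed
  next
    fix m assume *: "\<forall>i<n. tghost i x = prev_ghost i x \<oplus> [(p ^ i)] \<cdot> a i" "m < n"
    from *(2) show "tghost m x = ?s m"
    proof (induction m)
      case 0
      then show ?case using *(1) z by simp
    next
      case (Suc m)
      then show ?case using *(1) \<open>\<And>m. Suc m < n \<Longrightarrow> ?s (Suc m) = _\<close>[of m] by simp
    qed
  qed
  then show ?thesis using is_coeffs_iff_sum[OF x] by simp
qed (simp add: is_coeffs_def)

text \<open>Existence is the congruence of neighbouring twisted components, uniqueness is
  cancellation of \<open>p ^ i\<close>. This makes the description in \<open>ver_coeffs\<close>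
  denote.\<close>

lemma is_coeffs_ex1:
  assumes x: "x \<in> vec {..<n}"
  shows "\<exists>!a. is_coeffs n x a"
proof (rule ex_ex1I)
  have "\<exists>c. c \<in> carrier R \<and> tghost i x = prev_ghost i x \<oplus> [(p ^ i)] \<cdot> c" if "i < n" for i
    using tghost_cong_previous[OF that x] by (auto simp: pcong_def)
  then obtain c where "\<And>i. i < n \<Longrightarrow> c i \<in> carrier R \<and>
      tghost i x = prev_ghost i x \<oplus> [(p ^ i)] \<cdot> c i"
    by metis
  then have "is_coeffs n x (restrict c {..<n})" unfolding is_coeffs_iff[OF x] by auto
  then show "\<exists>a. is_coeffs n x a" by blast
  fix a b assume "is_coeffs n x a" "is_coeffs n x b"
  then have ab: "a \<in> vec {..<n}" "b \<in> vec {..<n}"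
    and eq: "\<And>i. i < n \<Longrightarrow> prev_ghost i x \<oplus> [(p ^ i)] \<cdot> a i = prev_ghost i x \<oplus> [(p ^ i)] \<cdot> b i"
    unfolding is_coeffs_iff[OF x] by auto
  show "a = b"
  proof (rule PiE_ext[OF ab])
    fix i assume "i \<in> {..<n}"
    then have i: "i < n" and c: "a i \<in> carrier R" "b i \<in> carrier R" using ab by auto
    have "[(p ^ i)] \<cdot> a i = [(p ^ i)] \<cdot> b i"
      using eq[OF i] c prev_ghost_closed[OF i x] by simp
    then show "a i = b i" using p_torsion_freeD[OF torsion_free] c by blast
  qed
qed

definition coeffs :: "nat \<Rightarrow> (nat \<Rightarrow> 'a) \<Rightarrow> nat \<Rightarrow> 'a" where
  "coeffs n x = (THE a. is_coeffs n x a)"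

context
  fixes n :: nat and x :: "nat \<Rightarrow> 'a"
  assumes x: "x \<in> vec {..<n}"
begin

lemma is_coeffs_coeffs: "is_coeffs n x (coeffs n x)"
  unfolding coeffs_def by (rule theI'[OF is_coeffs_ex1[OF x]])

lemma coeffs_closed: "i < n \<Longrightarrow> coeffs n x i \<in> carrier R"
  using is_coeffs_coeffs by (auto simp: is_coeffs_def)

lemma coeffs_eq: "i < n \<Longrightarrow> tghost i x = prev_ghost i x \<oplus> [(p ^ i)] \<cdot> coeffs n x i"
  using is_coeffs_coeffs is_coeffs_iff[OF x] by blast

lemma coeffs_unique:
  assumes i: "i < n" and b: "b \<in> carrier R"
    and eq: "tghost i x = prev_ghost i x \<oplus> [(p ^ i)] \<cdot> b"
  shows "coeffs n x i = b"
proof -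
  have "[(p ^ i)] \<cdot> coeffs n x i = [(p ^ i)] \<cdot> b"
    using eq coeffs_eq[OF i] coeffs_closed[OF i] b prev_ghost_closed[OF i x] by simp
  then show ?thesis using p_torsion_freeD[OF torsion_free] coeffs_closed[OF i] b by blast
qed

text \<open>The sum over all coefficients is the last twisted component, and all components from
  index \<open>i\<close> on agree modulo \<open>p ^ i\<close>. This turns the action given by
  coefficients into multiplication by a value of the homomorphism \<open>tghost i\<close>.\<close>

lemma coeffs_sum_cong:
  assumes i: "i < n"
  shows "pcong R p i (\<Oplus>j\<in>{..<n}. [(p ^ j)] \<cdot> coeffs n x j) (tghost i x)"
proof -
  obtain m where m: "n = Suc m" using i by (cases n) auto
  have "(\<Oplus>j\<in>{..<n}. [(p ^ j)] \<cdot> coeffs n x j) = tghost m x"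
    using is_coeffs_coeffs is_coeffs_iff_sum[OF x] m by (simp add: lessThan_Suc_atMost)
  then show ?thesis using tghost_cong[OF _ _ x, of i m] i m by simp
qed

end

end


section \<open>Witt vectors of a perfect ring of characteristic \<open>p\<close>\<close>

text \<open>Applied to \<open>v = V y\<close>, whose square is \<open>p\<close> times
  \<open>V (y \<otimes> y)\<close>, to see that its \<open>p\<close>-th power is divisible by
  \<open>p\<close>.\<close>

lemma (in cring) pow_add_two:
  assumes "v \<in> carrier R" "w \<in> carrier R" "v \<otimes> v = [(n::nat)] \<cdot> w"
  shows "v [^] (m + 2 :: nat) = [n] \<cdot> (w \<otimes> v [^] m)"
proof -
  have "v [^] (m + 2) = v [^] m \<otimes> (v \<otimes> v)"
    using assms(1) by (simp add: m_assoc)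
  then show ?thesis using assms by (simp add: add_pow_rdistr m_comm)
qed

locale perfect_ring_witt_vectors = witt_vectors k p for k (structure) and p +
  assumes perfect: "perfect_ring_of_char p k"
begin

abbreviation "A \<equiv> witt_ring p k"

sublocale A: cring A
  by (rule witt_ring_cring)

lemma char_p: "[p] \<cdot> \<one> = \<zero>"
  using perfect by (simp add: perfect_ring_of_char_def)

lemma power_p_bij: "bij_betw (\<lambda>x. x [^] p) (carrier k) (carrier k)"
  using perfect by (simp add: perfect_ring_of_char_def)

lemma phi_eq: "x \<in> vec UNIV \<Longrightarrow> phi p k x = (\<lambda>i. x i [^] p)"
  unfolding phi_def by (rule frob_char_p[OF char_p])

text \<open>Multiplication by \<open>p\<close> is Frobenius after Verschiebung, and in
  characteristic \<open>p\<close> the former is the componentwise \<open>p\<close>-th power.\<close>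

lemma add_pow_p_eq:
  assumes "x \<in> vec UNIV"
  shows "[p] \<cdot>\<^bsub>A\<^esub> x = (\<lambda>i. case i of 0 \<Rightarrow> \<zero> | Suc j \<Rightarrow> x j [^] p)"
proof -
  have "witt_ver k UNIV x \<in> vec UNIV" using assms by (rule witt_ver_closed) simp
  from frob_char_p[OF char_p this]
  have eq: "[p] \<cdot>\<^bsub>A\<^esub> x = (\<lambda>i. witt_ver k UNIV x i [^] p)"
    by (simp add: frob_ver[OF assms assms zero_closed zero_closed])
  show ?thesis
  proof
    show "([p] \<cdot>\<^bsub>A\<^esub> x) i = (case i of 0 \<Rightarrow> \<zero> | Suc j \<Rightarrow> x j [^] p)" for i
      unfolding eq using p_pos by (cases i) (simp_all add: witt_ver_def nat_pow_zero)
  qed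
qed

text \<open>Up to a shift the components of \<open>p x\<close> are the \<open>p\<close>-th powers of
  those of \<open>x\<close>, and the \<open>p\<close>-th power map of \<open>k\<close> is
  injective.\<close>

lemma A_torsion_free: "p_torsion_free p A"
  unfolding p_torsion_free_def
proof (intro ballI impI)
  fix x assume x: "x \<in> carrier A" and eq: "[p] \<cdot>\<^bsub>A\<^esub> x = \<zero>\<^bsub>A\<^esub>"
  have zero: "\<zero>\<^bsub>A\<^esub> = (\<lambda>i. \<zero>)" by (auto simp: witt_ring_zero teichmueller_def)
  have "x j = \<zero>" for j
  proof -
    have "x j [^] p = \<zero> [^] p"
      using fun_cong[OF eq, of "Suc j"] x p_pos by (simp add: add_pow_p_eq zero nat_pow_zero)
    then show ?thesis
      using power_p_bij x by (auto simp: bij_betw_def inj_on_def PiE_iff)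
  qed
  then show "x = \<zero>\<^bsub>A\<^esub>" by (auto simp: zero)
qed

lemma teichmueller_pow:
  assumes "r \<in> carrier k"
  shows "teichmueller k UNIV (r [^] (n::nat)) = teichmueller k UNIV r [^]\<^bsub>A\<^esub> n"
proof (induction n)
  case 0
  then show ?case by (simp add: witt_ring_one)
next
  case (Suc n)
  have "\<zero>\<^bsub>A\<^esub> \<in> vec UNIV" using A.zero_closed by simp
  from teichmueller_mult[OF this this _ assms] Suc assms show ?case by simp
qed

text \<open>Write x = t + V y with t the Teichmueller lift of the first component. Frobenius sends x
  to t^p + p y, while x^p is congruent to t^p + (V y)^p modulo p, and (V y)^2 = p V(y^2) makes the
  last term divisible by p.\<close>

lemma phi_cong:
  assumes x: "x \<in> carrier A"
  shows "pcong A p 1 (phi p k x) (x [^]\<^bsub>A\<^esub> p)"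
proof -
  let ?V = "witt_ver k UNIV" and ?T = "teichmueller k UNIV" and ?F = "witt_frob p k UNIV"
  define y where "y = (\<lambda>i. x (Suc i))"
  define t where "t = ?T (x 0)"
  have x0: "x 0 \<in> carrier k" using x by auto
  have y: "y \<in> vec UNIV" using x by (auto simp: y_def)
  have V: "?V z \<in> vec UNIV" if "z \<in> vec UNIV" for z
    using that by (rule witt_ver_closed) simp
  have t: "t \<in> carrier A" "?V y \<in> carrier A" using x0 V[OF y] by (simp_all add: t_def)
  note identities = witt_identities[OF _ _ x0 x0]
  have decomposition: "x = t \<oplus>\<^bsub>A\<^esub> ?V y"
    using identities(8)[of x x] x by (simp add: t_def y_def)
  have "?F t = t [^]\<^bsub>A\<^esub> p"
    using identities(7)[OF y y] teichmueller_pow[OF x0] by (simp add: t_def)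
  moreover have "?F (?V y) = [p] \<cdot>\<^bsub>A\<^esub> y" by (rule identities(4)[OF y y])
  ultimately have "phi p k x = t [^]\<^bsub>A\<^esub> p \<oplus>\<^bsub>A\<^esub> [(p ^ 1)] \<cdot>\<^bsub>A\<^esub> y"
    using identities(1)[of t "?V y"] t by (simp add: phi_def decomposition)
  then have "pcong A p 1 (phi p k x) (t [^]\<^bsub>A\<^esub> p)" using y by (intro A.pcong_I) simp_all
  moreover have "pcong A p 1 (x [^]\<^bsub>A\<^esub> p) (t [^]\<^bsub>A\<^esub> p \<oplus>\<^bsub>A\<^esub> ?V y [^]\<^bsub>A\<^esub> p)"
    unfolding decomposition using t by (intro A.pcong_freshman prime_p)
  moreover have "pcong A p 1 (t [^]\<^bsub>A\<^esub> p \<oplus>\<^bsub>A\<^esub> ?V y [^]\<^bsub>A\<^esub> p) (t [^]\<^bsub>A\<^esub> p)"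
  proof -
    obtain m where m: "p = m + 2" using prime_ge_2_nat[OF prime_p] by (metis add.commute le_Suc_ex)
    have yy: "y \<otimes>\<^bsub>A\<^esub> y \<in> carrier A" using y by simp
    have "?V y \<otimes>\<^bsub>A\<^esub> ?V y = ?V ([p] \<cdot>\<^bsub>A\<^esub> (y \<otimes>\<^bsub>A\<^esub> y))"
      using identities(5)[of "?V y" y] identities(4)[OF y y] t y
      by (simp add: A.add_pow_ldistr)
    also have "\<dots> = [p] \<cdot>\<^bsub>A\<^esub> ?V (y \<otimes>\<^bsub>A\<^esub> y)"
    proof -
      have "?V ([n] \<cdot>\<^bsub>A\<^esub> (y \<otimes>\<^bsub>A\<^esub> y)) = [n] \<cdot>\<^bsub>A\<^esub> ?V (y \<otimes>\<^bsub>A\<^esub> y)" for n :: nat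
      proof (induction n)
        case 0
        show ?case by (auto simp: witt_ver_def witt_ring_zero teichmueller_def split: nat.split)
      next
        case (Suc n)
        have "[n] \<cdot>\<^bsub>A\<^esub> (y \<otimes>\<^bsub>A\<^esub> y) \<in> carrier A" using yy by blast
        then show ?case using Suc identities(3)[of "[n] \<cdot>\<^bsub>A\<^esub> (y \<otimes>\<^bsub>A\<^esub> y)" "y \<otimes>\<^bsub>A\<^esub> y"] yy
          by simp
      qed
      then show ?thesis .
    qed
    finally have "?V y [^]\<^bsub>A\<^esub> (m + 2) = [p] \<cdot>\<^bsub>A\<^esub> (?V (y \<otimes>\<^bsub>A\<^esub> y) \<otimes>\<^bsub>A\<^esub> ?V y [^]\<^bsub>A\<^esub> m)"
      using V[of "y \<otimes>\<^bsub>A\<^esub> y"] yy by (intro A.pow_add_two t(2)) simp_all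
    then have "?V y [^]\<^bsub>A\<^esub> p = [p] \<cdot>\<^bsub>A\<^esub> (?V (y \<otimes>\<^bsub>A\<^esub> y) \<otimes>\<^bsub>A\<^esub> ?V y [^]\<^bsub>A\<^esub> m)"
      unfolding m[symmetric] .
    moreover have "?V (y \<otimes>\<^bsub>A\<^esub> y) \<otimes>\<^bsub>A\<^esub> ?V y [^]\<^bsub>A\<^esub> m \<in> carrier A"
      using V[of "y \<otimes>\<^bsub>A\<^esub> y"] yy by (intro A.m_closed A.nat_pow_closed t(2)) simp
    ultimately show ?thesis
      using t by (intro A.pcong_I[of _ _ _ _ "?V (y \<otimes>\<^bsub>A\<^esub> y) \<otimes>\<^bsub>A\<^esub> ?V y [^]\<^bsub>A\<^esub> m"]) simp_all
  qed
  moreover have "t [^]\<^bsub>A\<^esub> p \<in> carrier A" "x [^]\<^bsub>A\<^esub> p \<in> carrier A"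
    using A.nat_pow_closed t x by blast+
  ultimately show ?thesis using A.pcong_trans A.pcong_sym by meson
qed

text \<open>Both properties are inherited from the \<open>p\<close>-th power map of
  \<open>k\<close>, one component at a time.\<close>

lemma phi_bij: "bij_betw (phi p k) (carrier A) (carrier A)"
proof (rule bij_betw_imageI)
  show "inj_on (phi p k) (carrier A)"
  proof (rule inj_onI, rule ext)
    fix x y i assume xy: "x \<in> carrier A" "y \<in> carrier A" and eq: "phi p k x = phi p k y"
    have "x i [^] p = y i [^] p" using fun_cong[OF eq, of i] xy by (simp add: phi_eq)
    then show "x i = y i" using power_p_bij xy by (auto simp: bij_betw_def inj_on_def PiE_iff)
  qed
  show "phi p k ` carrier A = carrier A"
  proof (intro equalityI subsetI)
    fix y assume "y \<in> phi p k ` carrier A"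
    then show "y \<in> carrier A" by (auto simp: phi_eq PiE_iff)
  next
    fix y assume y: "y \<in> carrier A"
    have "\<exists>a\<in>carrier k. y i = a [^] p" for i
    proof -
      have "y i \<in> (\<lambda>x. x [^] p) ` carrier k" using power_p_bij y by (auto simp: bij_betw_def)
      then show ?thesis by blast
    qed
    then obtain x where "\<And>i. x i \<in> carrier k" "\<And>i. y i = x i [^] p" by metis
    moreover from this have "x \<in> vec UNIV" by auto
    ultimately have "x \<in> carrier A" "y = phi p k x" using phi_eq[of x] by auto
    then show "y \<in> phi p k ` carrier A" by blast
  qed
qed

lemma phi_hom: "phi p k \<in> ring_hom A A"
proof (rule ring_hom_memI)
  fix x y assume xy: "x \<in> carrier A" "y \<in> carrier A"
  then show "phi p k (x \<otimes>\<^bsub>A\<^esub> y) = phi p k x \<otimes>\<^bsub>A\<^esub> phi p k y"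
    "phi p k (x \<oplus>\<^bsub>A\<^esub> y) = phi p k x \<oplus>\<^bsub>A\<^esub> phi p k y"
    unfolding phi_def using witt_identities(1,2)[OF _ _ zero_closed zero_closed, of x y] by simp_all
next
  show "phi p k \<one>\<^bsub>A\<^esub> = \<one>\<^bsub>A\<^esub>" using p_pos
    by (auto simp: phi_eq witt_ring_one teichmueller_def nat_pow_zero)
next
  fix x assume "x \<in> carrier A"
  then show "phi p k x \<in> carrier A" using phi_bij by (metis bij_betwE)
qed

lemma A_bijective_frobenius_lift: "bijective_frobenius_lift A p (phi p k)"
  by unfold_locales
    (rule prime_p odd_p A_torsion_free phi_hom phi_cong phi_bij | assumption)+

text \<open>The inverse of an integer prime to \<open>p\<close> is assembled componentwise from its inverses modulo
  the powers of \<open>p\<close>, since the first \<open>n\<close> components of a multiple of \<open>p\<^sup>n\<close> vanish.\<close>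

lemma restrict_cong:
  assumes "pcong A p n x y" "y \<in> carrier A" "i < n"
  shows "x i = y i"
proof -
  obtain c where c: "c \<in> carrier A" "x = y \<oplus>\<^bsub>A\<^esub> [(p ^ n)] \<cdot>\<^bsub>A\<^esub> c" using assms by (auto simp: pcong_def)
  have pn: "[(p ^ n)] \<cdot>\<^bsub>A\<^esub> c \<in> carrier A \<and> (\<forall>i<n. ([(p ^ n)] \<cdot>\<^bsub>A\<^esub> c) i = \<zero>)" for n
  proof (induction n)
    case (Suc n)
    have "[(p ^ Suc n)] \<cdot>\<^bsub>A\<^esub> c = [p] \<cdot>\<^bsub>A\<^esub> ([(p ^ n)] \<cdot>\<^bsub>A\<^esub> c)"
      using c by (simp add: A.add.nat_pow_pow mult.commute)
    moreover have "([(p ^ n)] \<cdot>\<^bsub>A\<^esub> c) i \<in> carrier k" for i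
      using A.add.nat_pow_closed[OF c(1)] by auto
    ultimately show ?case using Suc p_pos
      by (auto simp: add_pow_p_eq nat_pow_zero split: nat.split)
  qed (use c in simp)
  let ?z = "[(p ^ n)] \<cdot>\<^bsub>A\<^esub> c"
  have "x i = mpoly_eval k (case_sum y ?z) (witt_add_poly p i)"
    using c(2) by (simp add: witt_ring_add)
  also have "\<dots> = mpoly_eval k (case_sum y \<zero>\<^bsub>A\<^esub>) (witt_add_poly p i)"
  proof (rule mpoly_eval_cong[of "Inl ` {..i} \<union> Inr ` {..i}"])
    show "\<forall>m\<in>Poly_Mapping.keys (witt_add_poly p i). Poly_Mapping.keys m \<subseteq> Inl ` {..i} \<union> Inr ` {..i}"
      using witt_add_poly_in by (simp add: mpolys_in_def)
  qed (use assms pn[of n] in \<open>auto simp: witt_ring_zero teichmueller_def\<close>)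
  also have "\<dots> = (y \<oplus>\<^bsub>A\<^esub> \<zero>\<^bsub>A\<^esub>) i" by (simp add: witt_ring_add)
  finally show ?thesis using assms(2) by (simp del: witt_ring_carrier)
qed

lemma A_unit:
  assumes b: "\<not> int p dvd b"
  shows "\<exists>y\<in>carrier A. [b] \<cdot>\<^bsub>A\<^esub> \<one>\<^bsub>A\<^esub> \<otimes>\<^bsub>A\<^esub> y = \<one>\<^bsub>A\<^esub>"
proof -
  have "prime (int p)" using prime_p by simp
  then have coprime: "coprime b (int p ^ n)" for n
    using b by (metis coprime_power_right_iff prime_imp_coprime coprime_commute)
  have "\<exists>u v. u * b + v * int p ^ n = 1" for n
    using bezout_int[of b "int p ^ n"] coprime[of n] by simp
  \<comment> \<open>By Bezout, \<open>c n\<close> inverts \<open>b\<close> modulo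
    \<open>p ^ n\<close>.\<close>
  then obtain c v where cv: "\<And>n. c n * b + v n * int p ^ n = 1" by metis
  let ?J = "\<lambda>z :: int. [z] \<cdot>\<^bsub>A\<^esub> \<one>\<^bsub>A\<^esub>"
  have J: "?J z \<in> carrier A" for z by (rule A.add.int_pow_closed[OF A.one_closed])
  have J_cong: "pcong A p n (?J x) (?J y)" if "x = y + int p ^ n * z" for x y z n
  proof (rule A.pcong_I[OF _ J])
    have "?J (int p ^ n * z) = [(int (p ^ n))] \<cdot>\<^bsub>A\<^esub> ?J z"
      using A.add.int_pow_pow[OF A.one_closed, of "int (p ^ n)" z] by (simp add: mult.commute)
    also have "\<dots> = [(p ^ n)] \<cdot>\<^bsub>A\<^esub> ?J z"
      unfolding add_pow_def by (rule int_pow_int)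
    finally have "?J (int p ^ n * z) = [(p ^ n)] \<cdot>\<^bsub>A\<^esub> ?J z" .
    then show "?J x = ?J y \<oplus>\<^bsub>A\<^esub> [(p ^ n)] \<cdot>\<^bsub>A\<^esub> ?J z"
      by (simp only: that A.add.int_pow_mult[OF A.one_closed])
  qed
  \<comment> \<open>Component \<open>j\<close> is determined by a congruence modulo p^(j+1), so the
    inverse at that precision is consulted. Any higher precision gives the same component, as
    \<open>y_eq\<close> shows.\<close>
  define y where "y j = ?J (c (Suc j)) j" for j
  have y: "y \<in> carrier A" using J by (auto simp: y_def PiE_iff)
  have y_eq: "y i = ?J (c n) i" if "i < n" for i n
  proof -
    have "int p ^ Suc i dvd int p ^ n" using that by (intro le_imp_power_dvd) simp
    then obtain w where w: "int p ^ n = int p ^ Suc i * w" by blast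
    have "b * (c n - c (Suc i)) = int p ^ Suc i * (v (Suc i) - v n * w)"
      using cv[of n] cv[of "Suc i"] unfolding w by (simp add: algebra_simps)
    then have "int p ^ Suc i dvd c n - c (Suc i)"
      using coprime[of "Suc i"] by (metis coprime_commute coprime_dvd_mult_right_iff dvd_triv_left)
    then obtain z where "c n = c (Suc i) + int p ^ Suc i * z" by (metis add_diff_cancel_left' diff_add_cancel dvdE add.commute)
    from restrict_cong[OF J_cong[OF this] J, of i] show ?thesis by (simp add: y_def)
  qed
  have "(?J b \<otimes>\<^bsub>A\<^esub> y) i = \<one>\<^bsub>A\<^esub> i" for i
  proof -
    have "(?J b \<otimes>\<^bsub>A\<^esub> y) i = mpoly_eval k (case_sum (?J b) y) (witt_mult_poly p i)"
      by (simp add: witt_ring_mult)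
    \<comment> \<open>The \<open>i\<close>-th multiplication polynomial reads components up to
      \<open>i\<close> only, and there \<open>y\<close> agrees with an actual inverse modulo
      p^(i+1).\<close>
    also have "\<dots> = mpoly_eval k (case_sum (?J b) (?J (c (Suc i)))) (witt_mult_poly p i)"
    proof (rule mpoly_eval_cong[of "Inl ` {..i} \<union> Inr ` {..i}"])
      show "\<forall>m\<in>Poly_Mapping.keys (witt_mult_poly p i). Poly_Mapping.keys m \<subseteq> Inl ` {..i} \<union> Inr ` {..i}"
        using witt_mult_poly_in by (simp add: mpolys_in_def)
      have J': "?J z j \<in> carrier k" for z j using J[of z] by auto
      show "case_sum (?J b) (?J (c (Suc i))) l \<in> carrier k" for l
        using J' by (simp split: sum.split)
      show "case_sum (?J b) y l = case_sum (?J b) (?J (c (Suc i))) l"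
        if "l \<in> Inl ` {..i} \<union> Inr ` {..i}" for l
        using that y_eq[of _ "Suc i"] by auto
    qed
    also have "\<dots> = (?J b \<otimes>\<^bsub>A\<^esub> ?J (c (Suc i))) i"
      by (simp add: witt_ring_mult)
    also have "?J b \<otimes>\<^bsub>A\<^esub> ?J (c (Suc i)) = ?J (b * c (Suc i))"
      using A.add_pow_rdistr_int[OF J A.one_closed, of b "c (Suc i)"] A.r_one[OF J]
        A.add.int_pow_pow[OF A.one_closed, of "c (Suc i)" b] by simp
    also have "\<dots> i = ?J 1 i"
    proof (rule restrict_cong[OF J_cong J])
      show "b * c (Suc i) = 1 + int p ^ Suc i * (- v (Suc i))"
        using cv[of "Suc i"] by (simp add: algebra_simps)
    qed simp
    also have "?J 1 = \<one>\<^bsub>A\<^esub>" by (rule A.add.int_pow_1[OF A.one_closed])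
    finally show ?thesis .
  qed
  then show ?thesis using y by (intro bexI[of _ y] ext)
qed

end

text \<open>A rational has many representing fractions, so its image is first a relation: y solves b
  y = a for some fraction a/b with b prime to p. Cross multiplication and cancellation of units show
  that y depends on the rational alone.\<close>

lemma (in cring) integers_localized_hom:
  assumes p: "prime p"
    and unit: "\<And>b. \<not> int p dvd b \<Longrightarrow> \<exists>y\<in>carrier R. [b] \<cdot> \<one> \<otimes> y = \<one>"
  shows "\<exists>h. h \<in> ring_hom (integers_localized_at p) R"
proof -
  let ?Z = "integers_localized_at p"
  let ?J = "\<lambda>z :: int. [z] \<cdot> \<one>"
  have J: "?J z \<in> carrier R" for z by (rule add.int_pow_closed) simp
  have J_add: "?J (a + b) = ?J a \<oplus> ?J b" for a b by (simp add: add.int_pow_mult)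
  have J_mult: "?J (a * b) = ?J a \<otimes> ?J b" for a b
    using add_pow_rdistr_int[OF J one_closed, of a b] r_one[OF J]
      add.int_pow_pow[OF one_closed, of b a] by simp
  define quotient where "quotient q y \<longleftrightarrow> y \<in> carrier R \<and>
    (\<exists>a b. \<not> int p dvd b \<and> q = (of_int a / of_int b :: rat) \<and> ?J b \<otimes> y = ?J a)" for q y
  have quotientI: "quotient (of_int a / of_int b) y"
    if "\<not> int p dvd b" "y \<in> carrier R" "?J b \<otimes> y = ?J a" for a b y
    unfolding quotient_def using that by blast
  have nz: "of_int b \<noteq> (0::rat)" if "\<not> int p dvd b" for b using that by auto
  have cancel: "y = z" if b: "\<not> int p dvd b" and yz: "y \<in> carrier R" "z \<in> carrier R" "?J b \<otimes> y = ?J b \<otimes> z" for b y z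
  proof -
    obtain u where u: "u \<in> carrier R" "?J b \<otimes> u = \<one>" using unit[OF b] by blast
    have u_mult: "u \<otimes> (?J b \<otimes> x) = x" if "x \<in> carrier R" for x
      using u(1) that J[of b] m_comm[OF u(1) J[of b]]
      by (simp add: m_assoc[symmetric] u(2))
    have "y = u \<otimes> (?J b \<otimes> y)" by (rule u_mult[OF yz(1), symmetric])
    also have "\<dots> = z" unfolding yz(3) by (rule u_mult[OF yz(2)])
    finally show ?thesis .
  qed
  have dvd: "\<not> int p dvd b * d" if "\<not> int p dvd b" "\<not> int p dvd d" for b d
    using p that prime_dvd_mult_iff[of "int p"] by simp
  have carrier: "of_int a / of_int b \<in> carrier ?Z" if "\<not> int p dvd b" for a b
    using that by (auto simp: integers_localized_at_def)
  have exists: "\<exists>y. quotient q y" if q: "q \<in> carrier ?Z" for q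
  proof -
    obtain a b where ab: "\<not> int p dvd b" "q = of_int a / of_int b"
      using q by (auto simp: integers_localized_at_def)
    obtain u where u: "u \<in> carrier R" "?J b \<otimes> u = \<one>" using unit[OF ab(1)] by blast
    have "?J b \<otimes> (?J a \<otimes> u) = ?J a \<otimes> (?J b \<otimes> u)" using u(1) J by (simp add: m_ac)
    then have "?J b \<otimes> (?J a \<otimes> u) = ?J a" using u(2) J by simp
    then have "quotient q (?J a \<otimes> u)" unfolding quotient_def using ab u J by blast
    then show ?thesis ..
  qed
  have unique: "y = z" if yz: "quotient q y" "quotient q z" for q y z
  proof -
    obtain a b where ab: "\<not> int p dvd b" "q = of_int a / of_int b" "?J b \<otimes> y = ?J a" "y \<in> carrier R"
      using yz by (auto simp: quotient_def)
    obtain c d where cd: "\<not> int p dvd d" "q = of_int c / of_int d" "?J d \<otimes> z = ?J c" "z \<in> carrier R"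
      using yz by (auto simp: quotient_def)
    have "of_int (a * d) = (of_int (c * b) :: rat)"
      using ab(2) cd(2) nz[OF ab(1)] nz[OF cd(1)] by (simp add: field_simps)
    then have eq: "a * d = c * b" by (simp only: of_int_eq_iff)
    have "?J (b * d) \<otimes> y = ?J d \<otimes> (?J b \<otimes> y)" "?J (b * d) \<otimes> z = ?J b \<otimes> (?J d \<otimes> z)"
      using ab(4) cd(4) J by (simp_all add: J_mult m_ac)
    then have "?J (b * d) \<otimes> y = ?J (b * d) \<otimes> z"
      unfolding ab(3) cd(3) J_mult[symmetric] using eq by (simp add: mult.commute)
    then show ?thesis using cancel dvd ab cd by blast
  qed
  define h where "h q = (SOME y. quotient q y)" for q
  have h: "quotient q (h q)" if "q \<in> carrier ?Z" for q
    unfolding h_def using exists[OF that] by (rule someI_ex)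
  have h_eq: "h q = y" if "quotient q y" "q \<in> carrier ?Z" for q y
    using unique[OF h[OF that(2)] that(1)] .
  have ops: "q \<otimes>\<^bsub>?Z\<^esub> r = q * r" "q \<oplus>\<^bsub>?Z\<^esub> r = q + r"
    "\<one>\<^bsub>?Z\<^esub> = 1" for q r
    by (simp_all add: integers_localized_at_def)
  have "h \<in> ring_hom ?Z R"
  proof (rule ring_hom_memI)
    fix q r assume qr: "q \<in> carrier ?Z" "r \<in> carrier ?Z"
    obtain a b where ab: "\<not> int p dvd b" "q = of_int a / of_int b" "?J b \<otimes> h q = ?J a" "h q \<in> carrier R"
      using h[OF qr(1)] by (auto simp: quotient_def)
    obtain c d where cd: "\<not> int p dvd d" "r = of_int c / of_int d" "?J d \<otimes> h r = ?J c" "h r \<in> carrier R"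
      using h[OF qr(2)] by (auto simp: quotient_def)
    have "?J (b * d) \<otimes> (h q \<otimes> h r) = (?J b \<otimes> h q) \<otimes> (?J d \<otimes> h r)"
      using ab(4) cd(4) J by (simp add: J_mult m_ac)
    also have "\<dots> = ?J (a * c)" by (simp add: ab(3) cd(3) J_mult)
    finally have "quotient (of_int (a * c) / of_int (b * d)) (h q \<otimes> h r)"
      using ab cd dvd[OF ab(1) cd(1)] by (intro quotientI m_closed)
    then have "quotient (q * r) (h q \<otimes> h r)" using ab(2) cd(2) by simp
    moreover have "q * r \<in> carrier ?Z"
      using carrier[OF dvd[OF ab(1) cd(1)], of "a * c"] ab(2) cd(2) by simp
    ultimately show "h (q \<otimes>\<^bsub>?Z\<^esub> r) = h q \<otimes> h r"
      using h_eq by (simp only: ops)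
    have "?J (b * d) \<otimes> (h q \<oplus> h r) = ?J d \<otimes> (?J b \<otimes> h q) \<oplus> ?J b \<otimes> (?J d \<otimes> h r)"
      using ab(4) cd(4) J by (simp add: J_mult r_distr m_ac)
    also have "\<dots> = ?J (d * a + b * c)" by (simp add: ab(3) cd(3) J_mult J_add)
    finally have "quotient (of_int (d * a + b * c) / of_int (b * d)) (h q \<oplus> h r)"
      using ab cd dvd[OF ab(1) cd(1)] by (intro quotientI a_closed)
    moreover have sum: "q + r = of_int (d * a + b * c) / of_int (b * d)"
      unfolding ab(2) cd(2) using nz[OF ab(1)] nz[OF cd(1)] by (simp add: field_simps)
    ultimately have "quotient (q + r) (h q \<oplus> h r)" by (simp only:)
    moreover have "q + r \<in> carrier ?Z"
      using carrier[OF dvd[OF ab(1) cd(1)], of "d * a + b * c"] unfolding sum .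
    ultimately show "h (q \<oplus>\<^bsub>?Z\<^esub> r) = h q \<oplus> h r"
      using h_eq by (simp only: ops)
  next
    show "h q \<in> carrier R" if "q \<in> carrier ?Z" for q
      using h[OF that] by (simp add: quotient_def)
    have p1: "\<not> int p dvd 1" using p not_prime_1 by auto
    then have "quotient 1 \<one>" using quotientI[OF p1 one_closed, of 1] J by simp
    moreover have "1 \<in> carrier ?Z"
      using carrier[OF p1, of 1] by simp
    ultimately show "h \<one>\<^bsub>?Z\<^esub> = \<one>"
      using h_eq by (simp only: ops)
  qed
  then show ?thesis by blast
qed

lemma (in cring) pcong_0 [simp]:
  assumes "a \<in> carrier R" "b \<in> carrier R"
  shows "pcong R p 0 a b"
proof -
  have "a = b \<oplus> (a \<ominus> b)" using assms by algebra
  then show ?thesis using assms by (intro pcong_I[of _ _ _ _ "a \<ominus> b"]) simp_all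
qed

text \<open>With \<open>u = v + p\<^sup>i a\<close> one has \<open>(u\<^sup>p - v\<^sup>p) / p\<^sup>i\<^sup>+\<^sup>1 \<equiv> u\<^sup>p\<^sup>-\<^sup>1 a\<close> modulo \<open>p\<^sup>i\<close>. This uses that \<open>p\<close>
  divides the binomial coefficient \<open>p choose 2\<close>, that is, that \<open>p\<close> is odd.\<close>

lemma power_p_difference:
  fixes u a :: "'r::comm_ring_1"
  assumes "odd p"
  shows "\<exists>q. u ^ p = (u - of_nat (p ^ Suc i) * a) ^ p
      + of_nat (p ^ Suc (Suc i)) * (u ^ (p - 1) * a + of_nat (p ^ Suc i) * q)"
proof -
  obtain m where m: "p = 2 * m + 1" using assms by (elim oddE)
  have choose: "(p choose 2) = p * m"
    unfolding m by (simp add: choose_two)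
  define z where "z = of_nat (p ^ Suc i) * a"
  obtain c where c: "(u + - z) ^ p = u ^ p + of_nat p * u ^ (p - 1) * (- z)
      + of_nat (p choose 2) * u ^ (p - 2) * (- z) ^ 2 + (- z) ^ 3 * c"
    using binomial_expansion3 by blast
  have "u ^ p = (u - z) ^ p + of_nat p * u ^ (p - 1) * z
      - of_nat (p * m) * u ^ (p - 2) * z ^ 2 + z ^ 3 * c"
    using c unfolding choose by (simp add: algebra_simps power3_eq_cube power2_eq_square)
  \<comment> \<open>With z = p^(i+1) a, the quadratic term carries p^(2i+3), one factor coming from
    \<open>p choose 2 = p * m\<close>, and the cubic remainder carries p^(3i+3). Both are multiples
    of p^(i+2) p^(i+1).\<close>
  also have "\<dots> = (u - z) ^ p + of_nat (p ^ Suc (Suc i)) * (u ^ (p - 1) * a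
      + of_nat (p ^ Suc i) * (of_nat (p ^ i) * a ^ 3 * c - of_nat m * u ^ (p - 2) * a ^ 2))"
    unfolding z_def by (simp add: algebra_simps power3_eq_cube power2_eq_square)
  finally show ?thesis unfolding z_def by blast
qed

text \<open>The polynomial identity is evaluated at \<open>u\<close> and \<open>a\<close> and
  divided by p^(i+2); the quotient \<open>c\<close> is pinned down because \<open>R\<close> has no
  torsion.\<close>

lemma (in cring) pcong_power_p_difference:
  assumes "odd p" "a \<in> carrier R" "u \<in> carrier R" "v \<in> carrier R" "c \<in> carrier R"
    and tf: "p_torsion_free p R"
    and u: "u = v \<oplus> [(p ^ Suc i)] \<cdot> a"
    and c: "u [^] p = v [^] p \<oplus> [(p ^ Suc (Suc i))] \<cdot> c"
  shows "pcong R p (Suc i) c (u [^] (p - 1) \<otimes> a)"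
proof -
  let ?u = "mpoly_var u" and ?a = "mpoly_var a"
  obtain q where "?u ^ p = (?u - of_nat (p ^ Suc i) * ?a) ^ p
      + of_nat (p ^ Suc (Suc i)) * (?u ^ (p - 1) * ?a + of_nat (p ^ Suc i) * q)"
    using power_p_difference[OF assms(1)] by blast
  from arg_cong[OF this, of "ceval R"]
  have "u [^] p = (u \<ominus> [(p ^ Suc i)] \<cdot> a) [^] p
      \<oplus> [(p ^ Suc (Suc i))] \<cdot> (ceval R (?u ^ (p - 1) * ?a) \<oplus> [(p ^ Suc i)] \<cdot> ceval R q)"
    using assms by (simp only: ceval_simps(2,5,8,9) ceval_of_nat_mult)
  also have "ceval R (?u ^ (p - 1) * ?a) = u [^] (p - 1) \<otimes> a"
    using assms by simp
  also have "u \<ominus> [(p ^ Suc i)] \<cdot> a = v"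
    unfolding u using assms add.nat_pow_closed[of a "p ^ Suc i"] by algebra
  finally have "v [^] p \<oplus> [(p ^ Suc (Suc i))] \<cdot> c = v [^] p
      \<oplus> [(p ^ Suc (Suc i))] \<cdot> (u [^] (p - 1) \<otimes> a \<oplus> [(p ^ Suc i)] \<cdot> ceval R q)"
    unfolding c .
  then have "[(p ^ Suc (Suc i))] \<cdot> c =
      [(p ^ Suc (Suc i))] \<cdot> (u [^] (p - 1) \<otimes> a \<oplus> [(p ^ Suc i)] \<cdot> ceval R q)"
    using assms by (simp del: power_Suc)
  from p_torsion_freeD[OF tf this] have "c = u [^] (p - 1) \<otimes> a \<oplus> [(p ^ Suc i)] \<cdot> ceval R q"
    using assms by simp
  from pcong_I[OF this] show ?thesis by simp
qed

section \<open>Operations on truncated Witt vectors in twisted ghost components, and their effect on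
  coefficients\<close>

context bijective_frobenius_lift
begin

sublocale \<psi>: ring_hom_cring R R \<psi>
  by unfold_locales (rule \<psi>_hom)

lemma trunc_cring: "cring (Wt n)"
  by (rule witt_cring) simp

lemma trunc_frob_closed:
  "x \<in> vec {..<Suc n} \<Longrightarrow> frob {..<n} x \<in> vec {..<n}"
  by (rule witt_frob_closed[where J = "{..<Suc n}"]) simp_all

lemma trunc_ver_closed:
  "x \<in> vec {..<n} \<Longrightarrow> ver {..<Suc n} x \<in> vec {..<Suc n}"
  by (rule witt_ver_closed[where J = "{..<n}"]) simp_all

lemma trunc_restrict_closed:
  "x \<in> vec {..<Suc n} \<Longrightarrow> restrict x {..<n} \<in> vec {..<n}"
  by (simp add: PiE_iff)

lemma tghost_ver:
  assumes "x \<in> vec {..<n}" "m < Suc n"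
  shows "tghost m (ver {..<Suc n} x) = [p] \<cdot> \<psi> (prev_ghost m x)"
  using assms by (cases m) (simp_all add: tghost_ver_0 tghost_ver_Suc)

text \<open>In twisted components Frobenius reads \<phi>(g_(m+1)) and Verschiebung reads p
  \<psi>(g_(m-1)), while restriction forgets the last component. This and most of the following
  identities are compared in these components.\<close>

lemma trunc_frob_hom: "frob {..<n} \<in> ring_hom (Wt (Suc n)) (Wt n)"
proof (rule ring_hom_memI)
  fix x y assume "x \<in> carrier (Wt (Suc n))" "y \<in> carrier (Wt (Suc n))"
  then have x: "x \<in> vec {..<Suc n}" and y: "y \<in> vec {..<Suc n}" by simp_all
  show "frob {..<n} (x \<otimes>\<^bsub>Wt (Suc n)\<^esub> y) =
      frob {..<n} x \<otimes>\<^bsub>Wt n\<^esub> frob {..<n} y"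
    "frob {..<n} (x \<oplus>\<^bsub>Wt (Suc n)\<^esub> y) =
      frob {..<n} x \<oplus>\<^bsub>Wt n\<^esub> frob {..<n} y"
    by (rule tghost_ext[where n = n];
        use x y in \<open>simp add: trunc_frob_closed tghost_mult tghost_add tghost_frob
          tghost_closed[where n = "Suc n"]\<close>)+
next
  show "frob {..<n} \<one>\<^bsub>Wt (Suc n)\<^esub> = \<one>\<^bsub>Wt n\<^esub>"
  proof (rule tghost_ext)
    have one: "\<one>\<^bsub>Wt (Suc n)\<^esub> \<in> vec {..<Suc n}" "\<one>\<^bsub>Wt n\<^esub> \<in> vec {..<n}"
      by (simp_all add: witt_ring_one)
    show "frob {..<n} \<one>\<^bsub>Wt (Suc n)\<^esub> \<in> vec {..<n}"
      by (rule trunc_frob_closed[OF one(1)])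
    show "\<one>\<^bsub>Wt n\<^esub> \<in> vec {..<n}" by (rule one(2))
    show "tghost m (frob {..<n} \<one>\<^bsub>Wt (Suc n)\<^esub>) = tghost m \<one>\<^bsub>Wt n\<^esub>"
      if "m < n" for m
      using that one by (simp add: tghost_frob tghost_one[where x = "\<one>\<^bsub>Wt n\<^esub>" and y = "\<one>\<^bsub>Wt n\<^esub>"]
        tghost_one[where x = "\<one>\<^bsub>Wt (Suc n)\<^esub>" and y = "\<one>\<^bsub>Wt (Suc n)\<^esub>"])
  qed
qed (simp add: trunc_frob_closed)

lemma trunc_restrict_hom: "(\<lambda>x. restrict x {..<n}) \<in> ring_hom (Wt (Suc n)) (Wt n)"
proof (rule ring_hom_memI)
  fix x y assume "x \<in> carrier (Wt (Suc n))" "y \<in> carrier (Wt (Suc n))"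
  then have x: "x \<in> vec {..<Suc n}" and y: "y \<in> vec {..<Suc n}" by simp_all
  note simps = trunc_restrict_closed tghost_mult tghost_add tghost_restrict
  show "restrict (x \<otimes>\<^bsub>Wt (Suc n)\<^esub> y) {..<n} = restrict x {..<n} \<otimes>\<^bsub>Wt n\<^esub> restrict y {..<n}"
    by (rule tghost_ext[where n = n]) (use x y in \<open>simp_all add: simps del: restrict_PiE\<close>)
  show "restrict (x \<oplus>\<^bsub>Wt (Suc n)\<^esub> y) {..<n} = restrict x {..<n} \<oplus>\<^bsub>Wt n\<^esub> restrict y {..<n}"
    by (rule tghost_ext[where n = n]) (use x y in \<open>simp_all add: simps del: restrict_PiE\<close>)
next
  show "restrict \<one>\<^bsub>Wt (Suc n)\<^esub> {..<n} = \<one>\<^bsub>Wt n\<^esub>"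
    unfolding witt_ring_one teichmueller_def by (rule ext) simp
next
  show "restrict x {..<n} \<in> carrier (Wt n)" if "x \<in> carrier (Wt (Suc n))" for x
    using trunc_restrict_closed that unfolding witt_ring_carrier by blast
qed

lemma trunc_ver_add:
  assumes "x \<in> vec {..<n}" "y \<in> vec {..<n}"
  shows "ver {..<Suc n} (x \<oplus>\<^bsub>Wt n\<^esub> y) =
    ver {..<Suc n} x \<oplus>\<^bsub>Wt (Suc n)\<^esub> ver {..<Suc n} y"
proof (rule tghost_ext)
  fix m assume m: "m < Suc n"
  show "tghost m (ver {..<Suc n} (x \<oplus>\<^bsub>Wt n\<^esub> y)) =
      tghost m (ver {..<Suc n} x \<oplus>\<^bsub>Wt (Suc n)\<^esub> ver {..<Suc n} y)"
    using assms m by (cases m) (simp_all add: tghost_ver trunc_ver_closed tghost_add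
        tghost_closed[where n = n] add.nat_pow_distrib \<psi>_closed)
qed (use assms in \<open>simp_all add: trunc_ver_closed\<close>)

lemma trunc_ver_frob_mult:
  assumes "x \<in> vec {..<Suc n}" "y \<in> vec {..<n}"
  shows "ver {..<Suc n} (frob {..<n} x \<otimes>\<^bsub>Wt n\<^esub> y) =
    x \<otimes>\<^bsub>Wt (Suc n)\<^esub> ver {..<Suc n} y"
proof (rule tghost_ext)
  fix m assume m: "m < Suc n"
  show "tghost m (ver {..<Suc n} (frob {..<n} x \<otimes>\<^bsub>Wt n\<^esub> y)) =
      tghost m (x \<otimes>\<^bsub>Wt (Suc n)\<^esub> ver {..<Suc n} y)"
    using assms m by (cases m) (simp_all add: tghost_ver trunc_ver_closed trunc_frob_closed
        tghost_mult tghost_frob tghost_closed[where n = n]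
        tghost_closed[where n = "Suc n"] add_pow_rdistr \<psi>_closed \<psi>_\<phi>)
qed (use assms in \<open>simp_all add: trunc_ver_closed trunc_frob_closed\<close>)

lemma tghost_add_pow:
  assumes "x \<in> vec {..<n}" "m < n"
  shows "tghost m ([(l::nat)] \<cdot>\<^bsub>Wt n\<^esub> x) = [l] \<cdot> tghost m x"
  using assms by (intro cring.add_pow_mult_ring_hom[OF trunc_cring is_cring tghost_hom]) simp_all

lemma trunc_frob_ver:
  assumes "x \<in> vec {..<n}"
  shows "frob {..<n} (ver {..<Suc n} x) = [p] \<cdot>\<^bsub>Wt n\<^esub> x"
proof (rule tghost_ext)
  interpret Wn: cring "Wt n" by (rule trunc_cring)
  show "[p] \<cdot>\<^bsub>Wt n\<^esub> x \<in> vec {..<n}"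
    using Wn.add.nat_pow_closed[of x p] assms by simp
  fix m assume m: "m < n"
  show "tghost m (frob {..<n} (ver {..<Suc n} x)) =
      tghost m ([p] \<cdot>\<^bsub>Wt n\<^esub> x)"
    using assms m by (simp add: tghost_frob trunc_ver_closed tghost_ver \<phi>_add_pow \<psi>_closed
        tghost_closed[where n = n] \<phi>_\<psi> tghost_add_pow)
qed (use assms in \<open>simp add: trunc_ver_closed trunc_frob_closed\<close>)

lemma trunc_frob_restrict:
  assumes "x \<in> vec {..<Suc (Suc n)}"
  shows "frob {..<n} (restrict x {..<Suc n}) = restrict (frob {..<Suc n} x) {..<n}"
  by (rule tghost_ext[where n = n];
      use assms in \<open>simp add: trunc_frob_closed trunc_restrict_closed tghost_frob tghost_restrict
      del: restrict_PiE\<close>)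

lemma trunc_ver_restrict:
  "ver {..<Suc n} (restrict x {..<n}) = restrict (ver {..<Suc (Suc n)} x) {..<Suc n}"
  by (auto simp: witt_ver_def split: nat.split)

lemma prev_ghost_simps':
  assumes "i < n" "x \<in> vec {..<n}" "y \<in> vec {..<n}"
  shows "prev_ghost i (x \<oplus>\<^bsub>Wt n\<^esub> y) = prev_ghost i x \<oplus> prev_ghost i y"
    and "prev_ghost i (x \<otimes>\<^bsub>Wt n\<^esub> y) = prev_ghost i x \<otimes> prev_ghost i y"
  using assms by (cases i; simp add: tghost_add tghost_mult)+

lemma coeffs_zero:
  assumes "i < n"
  shows "coeffs n \<zero>\<^bsub>Wt n\<^esub> i = \<zero>"
proof (rule coeffs_unique)
  interpret Wn: cring "Wt n" by (rule trunc_cring)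
  show "\<zero>\<^bsub>Wt n\<^esub> \<in> vec {..<n}" using Wn.zero_closed by simp
  have "tghost m \<zero>\<^bsub>Wt n\<^esub> = \<zero>" if "m < n" for m
    using ring_hom_zero[OF tghost_hom[OF that] Wn.ring_axioms ring_axioms] .
  then show "tghost i \<zero>\<^bsub>Wt n\<^esub> = prev_ghost i \<zero>\<^bsub>Wt n\<^esub> \<oplus> [(p ^ i)] \<cdot> \<zero>"
    using assms by (cases i) simp_all
qed (use assms in auto)

lemma coeffs_add:
  assumes i: "i < n" and x: "x \<in> vec {..<n}" and y: "y \<in> vec {..<n}"
  shows "coeffs n (x \<oplus>\<^bsub>Wt n\<^esub> y) i = coeffs n x i \<oplus> coeffs n y i"
proof (rule coeffs_unique)
  show "tghost i (x \<oplus>\<^bsub>Wt n\<^esub> y) =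
      prev_ghost i (x \<oplus>\<^bsub>Wt n\<^esub> y) \<oplus> [(p ^ i)] \<cdot> (coeffs n x i \<oplus> coeffs n y i)"
    unfolding tghost_add[OF i x y] prev_ghost_simps'[OF i x y] coeffs_eq[OF x i] coeffs_eq[OF y i]
    using prev_ghost_closed[OF i x] prev_ghost_closed[OF i y] coeffs_closed[OF x i] coeffs_closed[OF y i]
    by (simp add: add.nat_pow_distrib a_ac)
qed (use assms coeffs_closed in auto)

text \<open>The product rule for differences is exact with the previous component of
  \<open>x\<close> as the factor of the second term. Replacing it by the current component, through
  which \<open>x\<close> acts, costs a multiple of \<open>p ^ i\<close>.\<close>

lemma coeffs_mult:
  assumes i: "i < n" and x: "x \<in> vec {..<n}" and y: "y \<in> vec {..<n}"
  shows "pcong R p i (coeffs n (x \<otimes>\<^bsub>Wt n\<^esub> y) i)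
    (tghost i y \<otimes> coeffs n x i \<oplus> tghost i x \<otimes> coeffs n y i)"
proof -
  note closed = prev_ghost_closed[OF i x] prev_ghost_closed[OF i y]
    coeffs_closed[OF x i] coeffs_closed[OF y i]
    tghost_closed[OF i x x] tghost_closed[OF i y y]
  have "coeffs n (x \<otimes>\<^bsub>Wt n\<^esub> y) i =
      tghost i y \<otimes> coeffs n x i \<oplus> prev_ghost i x \<otimes> coeffs n y i" (is "_ = ?c")
  proof (rule coeffs_unique)
    let ?q = "[(p ^ i)] \<cdot> \<one>"
    have q: "[(p ^ i)] \<cdot> a = ?q \<otimes> a" if "a \<in> carrier R" for a using that by (rule add_pow_mult_one)
    have eq: "tghost i x = prev_ghost i x \<oplus> ?q \<otimes> coeffs n x i"
      "tghost i y = prev_ghost i y \<oplus> ?q \<otimes> coeffs n y i"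
      using coeffs_eq[OF x i] coeffs_eq[OF y i]
      unfolding q[OF coeffs_closed[OF x i]] q[OF coeffs_closed[OF y i]] .
    have "tghost i x \<otimes> tghost i y =
        (prev_ghost i x \<oplus> ?q \<otimes> coeffs n x i) \<otimes> tghost i y"
      by (simp only: eq(1))
    also have "\<dots> = prev_ghost i x \<otimes> tghost i y \<oplus> ?q \<otimes> (tghost i y \<otimes> coeffs n x i)"
      using closed add.nat_pow_closed[OF one_closed, of "p ^ i"] by algebra
    also have "prev_ghost i x \<otimes> tghost i y =
        prev_ghost i x \<otimes> (prev_ghost i y \<oplus> ?q \<otimes> coeffs n y i)"
      by (simp only: eq(2))
    also have "\<dots> \<oplus> ?q \<otimes> (tghost i y \<otimes> coeffs n x i) =
        prev_ghost i x \<otimes> prev_ghost i y \<oplus> ?q \<otimes> ?c"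
      using closed add.nat_pow_closed[OF one_closed, of "p ^ i"] by algebra
    finally show "tghost i (x \<otimes>\<^bsub>Wt n\<^esub> y) =
        prev_ghost i (x \<otimes>\<^bsub>Wt n\<^esub> y) \<oplus> [(p ^ i)] \<cdot> ?c"
      unfolding tghost_mult[OF i x y] prev_ghost_simps'[OF i x y]
      by (subst q) (use closed in simp_all)
  qed (use assms closed in auto)
  moreover have "pcong R p i (prev_ghost i x) (tghost i x)"
    using closed by (intro pcong_sym[OF tghost_cong_previous[OF i x]])
  ultimately show ?thesis using closed by (auto intro!: pcong_add pcong_mult)
qed

lemma coeffs_restrict:
  assumes i: "i < n" and x: "x \<in> vec {..<Suc n}"
  shows "coeffs n (restrict x {..<n}) i = coeffs (Suc n) x i"
proof (rule coeffs_unique[OF trunc_restrict_closed[OF x] i])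
  have "prev_ghost i (restrict x {..<n}) = prev_ghost i x"
    using i x by (cases i) (simp_all add: tghost_restrict)
  then show "tghost i (restrict x {..<n}) =
      prev_ghost i (restrict x {..<n}) \<oplus> [(p ^ i)] \<cdot> coeffs (Suc n) x i"
    using i x coeffs_eq[OF x, of i] by (simp add: tghost_restrict)
qed (use i coeffs_closed[OF x, of i] in simp)

text \<open>Differences of neighbouring components are multiplied by \<open>p\<close> and shifted by
  one place; the higher power of \<open>p\<close> in the divisor absorbs this factor, so the
  coefficient itself carries none.\<close>

lemma coeffs_ver:
  assumes i: "i < n" and x: "x \<in> vec {..<n}"
  shows "coeffs (Suc n) (ver {..<Suc n} x) (Suc i) = \<psi> (coeffs n x i)"
proof (rule coeffs_unique[OF trunc_ver_closed[OF x]])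
  note closed = prev_ghost_closed[OF i x] coeffs_closed[OF x i]
  have "\<psi> (tghost i x) = \<psi> (prev_ghost i x) \<oplus> [(p ^ i)] \<cdot> \<psi> (coeffs n x i)"
    using coeffs_eq[OF x i] closed by (simp add: add_pow_mult_ring_hom[OF is_cring \<psi>_hom])
  then show "tghost (Suc i) (ver {..<Suc n} x) =
      prev_ghost (Suc i) (ver {..<Suc n} x) \<oplus> [(p ^ Suc i)] \<cdot> \<psi> (coeffs n x i)"
    using i x closed by (simp add: tghost_ver add.nat_pow_distrib add.nat_pow_pow \<psi>_closed mult.commute)
qed (use i coeffs_closed[OF x i] \<psi>_closed in simp_all)

text \<open>The twisted components u_j of [r] satisfy \<phi>(u_(l+1)) = u_l^p. Applying \<phi> to
  the recursion at index i + 1 therefore expresses \<phi> of the coefficient as a divided difference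
  of \<open>p\<close>-th powers, to which \<open>pcong_power_p_difference\<close> applies.\<close>

lemma coeffs_teichmueller:
  assumes i: "i < n" and r: "r \<in> carrier R"
  shows "pcong R p i (\<phi> (coeffs (Suc n) (teich {..<Suc n} r) (Suc i)))
    (tghost i (teich {..<n} r) [^] (p - 1) \<otimes> coeffs n (teich {..<n} r) i)"
proof -
  let ?T = "teich {..<n} r" and ?T' = "teich {..<Suc n} r"
  have T: "?T \<in> vec {..<n}" "?T' \<in> vec {..<Suc n}" using r by simp_all
  define c where "c = coeffs (Suc n) ?T' (Suc i)"
  define u where "u j = (\<psi> ^^ j) (r [^] (p ^ j))" for j
  have u: "u j \<in> carrier R" for j using r by (simp add: u_def \<psi>_funpow_closed)
  have c: "c \<in> carrier R" unfolding c_def using i by (intro coeffs_closed[OF T(2)]) simp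
  have a: "coeffs n ?T i \<in> carrier R" using i by (rule coeffs_closed[OF T(1)])
  show ?thesis
  proof (cases i)
    \<comment> \<open>There is no component before u_0, but modulo p^0 every congruence
      holds.\<close>
    case 0
    have "pcong R p 0 (\<phi> c) (tghost i ?T [^] (p - 1) \<otimes> coeffs n ?T i)"
      by (rule pcong_0) (use c a tghost_closed[OF i T(1) T(1)] in simp_all)
    then show ?thesis by (simp only: 0 c_def)
  next
    case (Suc j)
    have \<phi>_u: "\<phi> (u (Suc l)) = u l [^] p" for l
    proof -
      have "\<phi> (u (Suc l)) = (\<psi> ^^ l) (r [^] (p ^ Suc l))"
        unfolding u_def using r by (simp add: \<phi>_\<psi> \<psi>_funpow_closed del: power_Suc)
      also have "r [^] (p ^ Suc l) = (r [^] (p ^ l)) [^] p"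
        using r by (simp add: nat_pow_pow mult.commute)
      also have "(\<psi> ^^ l) \<dots> = u l [^] p"
      proof -
        interpret h: ring_hom_cring R R "\<psi> ^^ l" by unfold_locales (rule \<psi>_funpow_hom)
        have "(\<psi> ^^ l) (z [^] (m::nat)) = (\<psi> ^^ l) z [^] m" if "z \<in> carrier R" for z m
          by (induction m) (simp_all add: that del: funpow.simps)
        then show ?thesis using r by (simp add: u_def)
      qed
      finally show ?thesis .
    qed
    have tT: "tghost l ?T = u l" if "l < n" for l
      using that r by (simp add: tghost_teichmueller u_def)
    have tT': "tghost l ?T' = u l" if "l < Suc n" for l
      using that r by (simp add: tghost_teichmueller u_def)
    have eq: "u i = u j \<oplus> [(p ^ Suc j)] \<cdot> coeffs n ?T i"
      using coeffs_eq[OF T(1) i] tT[of i] tT[of j] i Suc by simp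
    have "u (Suc i) = u i \<oplus> [(p ^ Suc i)] \<cdot> c"
      using coeffs_eq[OF T(2), of "Suc i"] tT'[of i] tT'[of "Suc i"] i by (simp add: c_def)
    then have "u i [^] p = \<phi> (u i) \<oplus> [(p ^ Suc i)] \<cdot> \<phi> c"
      using u c unfolding \<phi>_u[symmetric] by (simp add: \<phi>_add_pow)
    then have "u i [^] p = u j [^] p \<oplus> [(p ^ Suc (Suc j))] \<cdot> \<phi> c"
      using \<phi>_u[of j] Suc by simp
    from pcong_power_p_difference[OF odd_p a u u _ torsion_free eq this] show ?thesis
      using c tT[OF i] Suc by (simp add: c_def)
  qed
qed

end


section \<open>The complex\<close>

text \<open>The two equations rewrite the constants of the complex, which mention
  \<open>witt_ring p k\<close> and \<open>phi p k\<close>, into the abstract \<open>A\<close> and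
  \<phi> for which everything above was proved.\<close>

locale perfect_witt_complex = bijective_frobenius_lift A p \<phi>
  for A :: "(nat \<Rightarrow> 'a) ring" (structure) and p \<phi> +
  fixes k :: "('a, 'b) ring_scheme"
  assumes A_eq: "witt_ring p k = A" and \<phi>_eq: "phi p k = \<phi>"
begin

lemma phi_inv_eq: "phi_inv p k = \<psi>"
  by (simp add: phi_inv_def A_eq \<phi>_eq)

lemma s_phi_eq: "s_phi p k = ghost_section"
  by (simp only: s_phi_def Let_def A_eq \<phi>_eq ghost_section_def is_ghost_section_def)

lemma ver_one_eq: "ver_one p k n i = ver_power n i"
  by (simp only: ver_one_def Let_def A_eq ver_power_def)

lemma ver_coeffs_eq: "ver_coeffs p k n = coeffs n"
  by (rule ext) (simp only: ver_coeffs_def Let_def A_eq s_phi_eq ver_one_eq coeffs_def is_coeffs_def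
      witt_ring_carrier)

abbreviation Q :: "nat \<Rightarrow> (nat \<Rightarrow> 'a) set ring" where
  "Q \<equiv> quot_p p k"

abbreviation cl :: "nat \<Rightarrow> (nat \<Rightarrow> 'a) \<Rightarrow> (nat \<Rightarrow> 'a) set" where
  "cl \<equiv> quot_class p k"

lemma p_ideal_eq: "p_ideal p k i = PIdl ([(p ^ i)] \<cdot> \<one>)"
  by (simp add: p_ideal_def A_eq Let_def)

lemma ideal_p_ideal: "ideal (p_ideal p k i) A"
  unfolding p_ideal_eq by (rule cgenideal_ideal) simp

lemma Q_eq: "Q i = A Quot p_ideal p k i"
  by (simp add: quot_p_def A_eq)

lemma cl_eq: "cl i a = p_ideal p k i +> a"
  by (simp add: quot_class_def A_eq)

lemma Q_cring: "cring (Q i)"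
  unfolding Q_eq by (rule ideal.quotient_is_cring[OF ideal_p_ideal is_cring])

lemma cl_hom: "cl i \<in> ring_hom A (Q i)"
  using ideal.rcos_ring_hom[OF ideal_p_ideal, of i] unfolding Q_eq cl_eq[abs_def] .

lemma carrier_Q: "carrier (Q i) = cl i ` carrier A"
  unfolding Q_eq cl_eq[abs_def] FactRing_def A_RCOSETS_def' by auto

lemma cl_eq_iff:
  assumes "a \<in> carrier A" "b \<in> carrier A"
  shows "cl i a = cl i b \<longleftrightarrow> pcong A p i a b"
proof -
  have "cl i a = cl i b \<longleftrightarrow> a \<ominus> b \<in> p_ideal p k i"
    unfolding cl_eq using quotient_eq_iff_same_a_r_cos[OF ideal_p_ideal assms] by blast
  also have "\<dots> \<longleftrightarrow> (\<exists>c\<in>carrier A. a \<ominus> b = [(p ^ i)] \<cdot> c)"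
  proof -
    have "x \<otimes> [(p ^ i)] \<cdot> \<one> = [(p ^ i)] \<cdot> x" if "x \<in> carrier A" for x
      using that by (simp add: add_pow_rdistr)
    then show ?thesis unfolding p_ideal_eq cgenideal_def mem_Collect_eq by metis
  qed
  also have "\<dots> \<longleftrightarrow> pcong A p i a b"
  proof -
    have "a \<ominus> b = z \<longleftrightarrow> a = b \<oplus> z" if z: "z \<in> carrier A" for z
    proof
      assume "a \<ominus> b = z"
      then have "b \<oplus> z = b \<oplus> (a \<ominus> b)" by simp
      also have "\<dots> = a" using assms by algebra
      finally show "a = b \<oplus> z" by simp
    next
      assume "a = b \<oplus> z"
      then have "a \<ominus> b = b \<oplus> z \<ominus> b" by simp
      also have "\<dots> = z" using assms(2) z by algebra
      finally show "a \<ominus> b = z" .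
    qed
    then show ?thesis unfolding pcong_def by auto
  qed
  finally show ?thesis .
qed

text \<open>The congruence hypothesis makes the image of the coset a singleton, and
  \<open>the_elem\<close> extracts its only member.\<close>

lemma quot_map_cl:
  assumes a: "a \<in> carrier A" and f: "\<And>b. b \<in> carrier A \<Longrightarrow> f b \<in> carrier A"
    and cong: "\<And>b. b \<in> carrier A \<Longrightarrow> pcong A p j b a \<Longrightarrow> pcong A p i (f b) (f a)"
  shows "quot_map p k i f (cl j a) = cl i (f a)"
proof -
  interpret I: ideal "p_ideal p k j" A by (rule ideal_p_ideal)
  have "cl i (f b) = cl i (f a)" if b: "b \<in> cl j a" for b
  proof -
    have bc: "b \<in> carrier A"
      using b a_r_coset_subset_G[OF I.a_subset a] unfolding cl_eq by blast
    have "cl j a = cl j b"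
      using a_repr_independence[OF b[unfolded cl_eq] a I.a_subgroup] unfolding cl_eq .
    then have "pcong A p j b a" using cl_eq_iff a bc by metis
    then show ?thesis using cl_eq_iff cong f a bc by blast
  qed
  moreover have "a \<in> cl j a" unfolding cl_eq using I.a_rcos_self[OF a] .
  ultimately have "(\<lambda>b. cl i (f b)) ` cl j a = {cl i (f a)}" by blast
  then show ?thesis unfolding quot_map_def by simp
qed

text \<open>Elements of degree one are classes of sequences in \<open>A\<close>. Entries from
  \<open>n\<close> on are ignored, so one sequence can represent an element and its restriction to a
  lower level.\<close>

definition cls :: "nat \<Rightarrow> (nat \<Rightarrow> nat \<Rightarrow> 'a) \<Rightarrow> nat \<Rightarrow> (nat \<Rightarrow> 'a) set" where
  "cls n a = (\<lambda>i\<in>{..<n}. cl i (a i))"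

definition seq :: "nat \<Rightarrow> (nat \<Rightarrow> nat \<Rightarrow> 'a) \<Rightarrow> bool" where
  "seq n a \<longleftrightarrow> (\<forall>i<n. a i \<in> carrier A)"

lemma seqD: "seq n a \<Longrightarrow> i < n \<Longrightarrow> a i \<in> carrier A"
  by (simp add: seq_def)

lemma cls_eqI:
  assumes "seq n a" "seq n b" "\<And>i. i < n \<Longrightarrow> pcong A p i (a i) (b i)"
  shows "cls n a = cls n b"
  unfolding cls_def using assms by (intro restrict_ext) (auto simp: cl_eq_iff seqD)

lemma cls_cong: "(\<And>i. i < n \<Longrightarrow> a i = b i) \<Longrightarrow> cls n a = cls n b"
  unfolding cls_def by (intro restrict_ext) simp

lemma cls_closed: "seq n a \<Longrightarrow> cls n a \<in> carrier (E1 p k n)"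
  by (auto simp: cls_def E1_def carrier_Q seqD)

lemma cls_cases:
  assumes "m \<in> carrier (E1 p k n)"
  obtains a where "seq n a" "m = cls n a"
proof -
  have m: "m \<in> {..<n} \<rightarrow>\<^sub>E UNIV" "\<And>i. i < n \<Longrightarrow> \<exists>a\<in>carrier A. m i = cl i a"
    using assms by (auto simp: E1_def carrier_Q PiE_iff)
  then obtain a where a: "\<And>i. i < n \<Longrightarrow> a i \<in> carrier A \<and> m i = cl i (a i)" by metis
  then have "m = cls n a" unfolding cls_def by (intro PiE_ext[OF m(1)]) auto
  with a show ?thesis by (intro that[of a]) (auto simp: seq_def)
qed

lemma cls_mult:
  assumes "seq n a" "seq n b"
  shows "cls n a \<otimes>\<^bsub>E1 p k n\<^esub> cls n b = cls n (\<lambda>i. a i \<oplus> b i)"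
  unfolding cls_def E1_def using assms
  by (auto simp: seq_def ring_hom_add[OF cl_hom] intro!: restrict_ext)

lemma E1_one: "\<one>\<^bsub>E1 p k n\<^esub> = cls n (\<lambda>i. \<zero>)"
  unfolding cls_def E1_def
  by (simp add: ring_hom_zero[OF cl_hom ring_axioms cring.axioms(1)[OF Q_cring]])

lemma E1_act_cls:
  assumes x: "x \<in> vec {..<n}" and a: "seq n a"
  shows "E1_act p k n x (cls n a) = cls n (\<lambda>i. tghost i x \<otimes> a i)"
proof -
  let ?s = "\<Oplus>j\<in>{..<n}. [(p ^ j)] \<cdot> coeffs n x j"
  have "cl i ?s \<otimes>\<^bsub>Q i\<^esub> cl i (a i) = cl i (tghost i x \<otimes> a i)" if i: "i < n" for i
  proof -
    have s: "?s \<in> carrier A" using coeffs_closed[OF x] by (intro finsum_closed) auto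
    have t: "tghost i x \<in> carrier A" by (rule tghost_closed[OF i x x])
    have "cl i ?s = cl i (tghost i x)" using coeffs_sum_cong[OF x i] cl_eq_iff[OF s t] by blast
    then show ?thesis using t seqD[OF a i] by (simp add: ring_hom_mult[OF cl_hom])
  qed
  then show ?thesis unfolding E1_act_def Let_def A_eq ver_coeffs_eq cls_def by (auto intro!: restrict_ext)
qed

section \<open>The total ring as a square-zero extension, computed on representatives\<close>

abbreviation "En \<equiv> E_ring p k"

abbreviation "gr \<equiv> E_gr p k"

abbreviation "dE \<equiv> E_d p k"

abbreviation "FE \<equiv> E_F p k"

abbreviation "VE \<equiv> E_V p k"

abbreviation "lamE \<equiv> E_lam p k"

definition el :: "nat \<Rightarrow> (nat \<Rightarrow> nat \<Rightarrow> 'a) \<Rightarrow> (nat \<Rightarrow> nat \<Rightarrow> 'a) \<Rightarrow> 'a E_elem" where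
  "el n x a = (x, cls n a)"

definition good :: "nat \<Rightarrow> (nat \<Rightarrow> nat \<Rightarrow> 'a) \<Rightarrow> (nat \<Rightarrow> nat \<Rightarrow> 'a) \<Rightarrow> bool" where
  "good n x a \<longleftrightarrow> x \<in> vec {..<n} \<and> seq n a"

lemma goodD: "good n x a \<Longrightarrow> x \<in> vec {..<n}" "good n x a \<Longrightarrow> seq n a"
  by (simp_all add: good_def)

lemma carrier_En: "carrier (En n) = (vec {..<n}) \<times> carrier (E1 p k n)"
  by (simp add: E_ring_def A_eq Let_def)

lemma el_closed [simp]: "good n x a \<Longrightarrow> el n x a \<in> carrier (En n)"
  by (simp add: carrier_En el_def good_def cls_closed)

lemma el_cases:
  assumes "z \<in> carrier (En n)"
  obtains x a where "good n x a" "z = el n x a"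
  using assms unfolding carrier_En good_def el_def by (auto elim!: cls_cases)

text \<open>For the Leibniz rule and the formula for F d[r], which hold only modulo
  \<open>p ^ i\<close> in component \<open>i\<close>. Identities that hold for the representatives
  themselves use \<open>el_cong\<close>.\<close>

lemma el_eqI:
  assumes "x = y" "seq n a" "seq n b" "\<And>i. i < n \<Longrightarrow> pcong A p i (a i) (b i)"
  shows "el n x a = el n y b"
  unfolding el_def using cls_eqI assms by simp

lemma el_cong: "x = y \<Longrightarrow> (\<And>i. i < n \<Longrightarrow> a i = b i) \<Longrightarrow> el n x a = el n y b"
  unfolding el_def using cls_cong[of n a b] by simp

abbreviation "zeros \<equiv> \<lambda>i::nat. \<zero>"

abbreviation "Wzero n \<equiv> \<zero>\<^bsub>Wt n\<^esub>"

lemma seq_zeros: "seq n zeros"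
  by (simp add: seq_def)

lemma seq_add: "seq n a \<Longrightarrow> seq n b \<Longrightarrow> seq n (\<lambda>i. a i \<oplus> b i)"
  by (simp add: seq_def)

lemma seq_act: "x \<in> vec {..<n} \<Longrightarrow> seq n a \<Longrightarrow> seq n (\<lambda>i. tghost i x \<otimes> a i)"
  by (auto simp: seq_def intro: m_closed tghost_closed)

lemma el_add:
  assumes "good n x a" "good n y b"
  shows "el n x a \<oplus>\<^bsub>En n\<^esub> el n y b = el n (x \<oplus>\<^bsub>Wt n\<^esub> y) (\<lambda>i. a i \<oplus> b i)"
  using assms by (simp add: E_ring_def A_eq Let_def el_def good_def cls_mult)

lemma el_mult:
  assumes "good n x a" "good n y b"
  shows "el n x a \<otimes>\<^bsub>En n\<^esub> el n y b = el n (x \<otimes>\<^bsub>Wt n\<^esub> y)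
    (\<lambda>i. tghost i x \<otimes> b i \<oplus> tghost i y \<otimes> a i)"
  using assms by (simp add: E_ring_def A_eq Let_def el_def good_def E1_act_cls cls_mult seq_act)

lemma el_one: "\<one>\<^bsub>En n\<^esub> = el n \<one>\<^bsub>Wt n\<^esub> zeros"
  by (simp add: E_ring_def A_eq Let_def el_def E1_one)

lemma el_zero: "\<zero>\<^bsub>En n\<^esub> = el n (Wzero n) zeros"
  by (simp add: E_ring_def A_eq Let_def el_def E1_one)

lemma W_consts_closed [simp]:
  "\<one>\<^bsub>Wt n\<^esub> \<in> vec {..<n}" "\<zero>\<^bsub>Wt n\<^esub> \<in> vec {..<n}"
  by (simp_all add: witt_ring_one witt_ring_zero)

lemma tghost_consts [simp]:
  assumes "m < n"
  shows "tghost m \<one>\<^bsub>Wt n\<^esub> = \<one>" "tghost m \<zero>\<^bsub>Wt n\<^esub> = \<zero>"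
proof -
  interpret Wn: cring "Wt n" by (rule trunc_cring)
  show "tghost m \<one>\<^bsub>Wt n\<^esub> = \<one>" using ring_hom_one[OF tghost_hom[OF assms]] .
  show "tghost m \<zero>\<^bsub>Wt n\<^esub> = \<zero>"
    using ring_hom_zero[OF tghost_hom[OF assms] Wn.ring_axioms ring_axioms] .
qed

lemma good_one: "good n \<one>\<^bsub>Wt n\<^esub> zeros"
  and good_zero: "good n (Wzero n) zeros"
  by (simp_all add: good_def seq_zeros)

lemma good_add: "good n x a \<Longrightarrow> good n y b \<Longrightarrow> good n (x \<oplus>\<^bsub>Wt n\<^esub> y) (\<lambda>i. a i \<oplus> b i)"
  by (simp add: good_def seq_add)

lemma good_mult: "good n x a \<Longrightarrow> good n y b \<Longrightarrow> good n (x \<otimes>\<^bsub>Wt n\<^esub> y)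
    (\<lambda>i. tghost i x \<otimes> b i \<oplus> tghost i y \<otimes> a i)"
  by (simp add: good_def seq_add seq_act)

definition Wneg :: "nat \<Rightarrow> (nat \<Rightarrow> nat \<Rightarrow> 'a) \<Rightarrow> nat \<Rightarrow> nat \<Rightarrow> 'a" where
  "Wneg n x = \<ominus>\<^bsub>Wt n\<^esub> x"

lemma good_neg: "good n x a \<Longrightarrow> good n (Wneg n x) (\<lambda>i. \<ominus> a i)"
  using cring.cring_simprules(3)[OF trunc_cring, of x n]
  by (simp add: good_def seq_def Wneg_def)

lemma el_neg:
  assumes "good n x a"
  shows "el n (Wneg n x) (\<lambda>i. \<ominus> a i) \<oplus>\<^bsub>En n\<^esub> el n x a = \<zero>\<^bsub>En n\<^esub>"
proof -
  interpret Wn: cring "Wt n" by (rule trunc_cring)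
  show ?thesis
    unfolding el_add[OF good_neg[OF assms] assms] el_zero
    by (rule el_cong) (use assms Wn.l_neg[of x] in \<open>auto simp: Wneg_def good_def seq_def l_neg\<close>)
qed

text \<open>Since \<open>tghost i\<close> is a ring homomorphism, multiplication on representatives
  is that of a square-zero extension, and the axioms in degree one become polynomial identities in
  \<open>A\<close>.\<close>

lemma En_cring: "cring (En n)"
proof (intro cringI abelian_groupI comm_monoidI)
  interpret Wn: cring "Wt n" by (rule trunc_cring)
  have Wc: "z \<in> carrier (Wt n)" if "z \<in> vec {..<n}" for z using that by simp
  fix u assume u: "u \<in> carrier (En n)"
  obtain x a where xa: "good n x a" and u_eq: "u = el n x a" using el_cases[OF u] .
  note x = goodD(1)[OF xa] and a = seqD[OF goodD(2)[OF xa]]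
  show "\<exists>v\<in>carrier (En n). v \<oplus>\<^bsub>En n\<^esub> u = \<zero>\<^bsub>En n\<^esub>"
    using el_neg[OF xa] el_closed[OF good_neg[OF xa]] u_eq by blast
  show "\<zero>\<^bsub>En n\<^esub> \<oplus>\<^bsub>En n\<^esub> u = u"
    unfolding u_eq el_zero el_add[OF good_zero xa]
    by (rule el_cong) (use Wn.l_zero[OF Wc[OF x]] a in auto)
  show "\<one>\<^bsub>En n\<^esub> \<otimes>\<^bsub>En n\<^esub> u = u"
    unfolding u_eq el_one el_mult[OF good_one xa]
    by (rule el_cong) (use Wn.l_one[OF Wc[OF x]] a tghost_closed[OF _ x x] in auto)
  fix v assume v: "v \<in> carrier (En n)"
  obtain y b where yb: "good n y b" and v_eq: "v = el n y b" using el_cases[OF v] .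
  note y = goodD(1)[OF yb] and b = seqD[OF goodD(2)[OF yb]]
  show "u \<oplus>\<^bsub>En n\<^esub> v \<in> carrier (En n)" "u \<otimes>\<^bsub>En n\<^esub> v \<in> carrier (En n)"
    unfolding u_eq v_eq el_add[OF xa yb] el_mult[OF xa yb]
    by (intro el_closed good_add good_mult xa yb)+
  show "u \<oplus>\<^bsub>En n\<^esub> v = v \<oplus>\<^bsub>En n\<^esub> u"
    unfolding u_eq v_eq el_add[OF xa yb] el_add[OF yb xa]
    by (rule el_cong) (use Wn.a_comm[OF Wc[OF x] Wc[OF y]] a b a_comm in auto)
  show "u \<otimes>\<^bsub>En n\<^esub> v = v \<otimes>\<^bsub>En n\<^esub> u"
    unfolding u_eq v_eq el_mult[OF xa yb] el_mult[OF yb xa]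
    by (rule el_cong) (use Wn.m_comm[OF Wc[OF x] Wc[OF y]] a b a_comm
        tghost_closed[OF _ x x] tghost_closed[OF _ y y] in auto)
  fix w assume w: "w \<in> carrier (En n)"
  obtain z c where zc: "good n z c" and w_eq: "w = el n z c" using el_cases[OF w] .
  note z = goodD(1)[OF zc] and c = seqD[OF goodD(2)[OF zc]]
  note t = tghost_closed[OF _ x x] tghost_closed[OF _ y y] tghost_closed[OF _ z z]
  note xy = good_add[OF xa yb] good_mult[OF xa yb] and yz = good_add[OF yb zc] good_mult[OF yb zc]
    and xz = good_mult[OF xa zc]
  show "u \<oplus>\<^bsub>En n\<^esub> v \<oplus>\<^bsub>En n\<^esub> w = u \<oplus>\<^bsub>En n\<^esub> (v \<oplus>\<^bsub>En n\<^esub> w)"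
    unfolding u_eq v_eq w_eq el_add[OF xa yb] el_add[OF yb zc] el_add[OF xy(1) zc] el_add[OF xa yz(1)]
    by (rule el_cong) (use Wn.a_assoc[OF Wc[OF x] Wc[OF y] Wc[OF z]] a b c a_assoc in auto)
  show "u \<otimes>\<^bsub>En n\<^esub> v \<otimes>\<^bsub>En n\<^esub> w = u \<otimes>\<^bsub>En n\<^esub> (v \<otimes>\<^bsub>En n\<^esub> w)"
    unfolding u_eq v_eq w_eq el_mult[OF xa yb] el_mult[OF yb zc] el_mult[OF xy(2) zc] el_mult[OF xa yz(2)]
  proof (rule el_cong)
    show "x \<otimes>\<^bsub>Wt n\<^esub> y \<otimes>\<^bsub>Wt n\<^esub> z = x \<otimes>\<^bsub>Wt n\<^esub> (y \<otimes>\<^bsub>Wt n\<^esub> z)"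
      by (rule Wn.m_assoc[OF Wc[OF x] Wc[OF y] Wc[OF z]])
    fix i assume i: "i < n"
    show "tghost i (x \<otimes>\<^bsub>Wt n\<^esub> y) \<otimes> c i \<oplus>
        tghost i z \<otimes> (tghost i x \<otimes> b i \<oplus> tghost i y \<otimes> a i) =
      tghost i x \<otimes> (tghost i y \<otimes> c i \<oplus> tghost i z \<otimes> b i) \<oplus>
        tghost i (y \<otimes>\<^bsub>Wt n\<^esub> z) \<otimes> a i"
      unfolding tghost_mult[OF i x y] tghost_mult[OF i y z]
      using t[OF i] a[OF i] b[OF i] c[OF i] by algebra
  qed
  show "(u \<oplus>\<^bsub>En n\<^esub> v) \<otimes>\<^bsub>En n\<^esub> w = u \<otimes>\<^bsub>En n\<^esub> w \<oplus>\<^bsub>En n\<^esub> v \<otimes>\<^bsub>En n\<^esub> w"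
    unfolding u_eq v_eq w_eq el_add[OF xa yb] el_mult[OF xy(1) zc] el_mult[OF xa zc] el_mult[OF yb zc]
      el_add[OF xz yz(2)]
  proof (rule el_cong)
    show "(x \<oplus>\<^bsub>Wt n\<^esub> y) \<otimes>\<^bsub>Wt n\<^esub> z = x \<otimes>\<^bsub>Wt n\<^esub> z \<oplus>\<^bsub>Wt n\<^esub> y \<otimes>\<^bsub>Wt n\<^esub> z"
      by (rule Wn.l_distr[OF Wc[OF x] Wc[OF y] Wc[OF z]])
    fix i assume i: "i < n"
    show "tghost i (x \<oplus>\<^bsub>Wt n\<^esub> y) \<otimes> c i \<oplus> tghost i z \<otimes> (a i \<oplus> b i) =
      (tghost i x \<otimes> c i \<oplus> tghost i z \<otimes> a i) \<oplus>
        (tghost i y \<otimes> c i \<oplus> tghost i z \<otimes> b i)"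
      unfolding tghost_add[OF i x y]
      using t[OF i] a[OF i] b[OF i] c[OF i] by algebra
  qed
qed (simp_all add: el_zero el_one good_zero good_one)

end

section \<open>Structure maps on representatives, the grading and the differential\<close>

context perfect_witt_complex
begin

lemma E_d_el: "dE n (el n x a) = el n (Wzero n) (coeffs n x)"
  by (simp add: E_d_def el_def cls_def A_eq ver_coeffs_eq)

lemma E_res_el: "E_res n (el (Suc n) x a) = el n (restrict x {..<n}) a"
proof -
  have "{..<Suc n} \<inter> {..<n} = {..<n}" by auto
  then show ?thesis by (simp add: E_res_def el_def cls_def)
qed

lemma E_lam_el: "lamE n x = el n x zeros"
  by (simp add: E_lam_def el_def E1_one)

lemma E_F_el:
  assumes "good (Suc n) x a"
  shows "FE n (el (Suc n) x a) = el n (frob {..<n} x) (\<lambda>i. \<phi> (a (Suc i)))"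
proof -
  have "quot_map p k i \<phi> (cls (Suc n) a (Suc i)) = cl i (\<phi> (a (Suc i)))" if i: "i < n" for i
  proof -
    have a: "a (Suc i) \<in> carrier A" using seqD[OF goodD(2)[OF assms]] i by simp
    have "quot_map p k i \<phi> (cl (Suc i) (a (Suc i))) = cl i (\<phi> (a (Suc i)))"
    proof (rule quot_map_cl[OF a])
      fix b assume "b \<in> carrier A" "pcong A p (Suc i) b (a (Suc i))"
      then show "pcong A p i (\<phi> b) (\<phi> (a (Suc i)))"
        using pcong_mono[OF pcong_hom[OF _ a is_cring \<phi>_hom]] by simp
    qed simp
    then show ?thesis using i by (simp add: cls_def)
  qed
  then show ?thesis
    unfolding E_F_def el_def A_eq \<phi>_eq by (auto simp: cls_def[of n] intro!: restrict_ext)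
qed

definition ver_seq :: "(nat \<Rightarrow> nat \<Rightarrow> 'a) \<Rightarrow> nat \<Rightarrow> nat \<Rightarrow> 'a" where
  "ver_seq a i = (case i of 0 \<Rightarrow> \<zero> | Suc j \<Rightarrow> [p] \<cdot> \<psi> (a j))"

text \<open>The factor \<open>p\<close> is what makes the map from A/p^j to A/p^(j+1) well defined:
  it raises the modulus of a congruence by one power.\<close>

lemma E_V_el:
  assumes "good n x a"
  shows "VE n (el n x a) = el (Suc n) (ver {..<Suc n} x) (ver_seq a)"
proof -
  have "quot_map p k (Suc j) (\<lambda>a. [p] \<cdot> \<psi> a) (cls n a j) = cl (Suc j) ([p] \<cdot> \<psi> (a j))"
    if j: "j < n" for j
  proof -
    have a: "a j \<in> carrier A" using seqD[OF goodD(2)[OF assms]] j by simp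
    have "quot_map p k (Suc j) (\<lambda>a. [p] \<cdot> \<psi> a) (cl j (a j)) = cl (Suc j) ([p] \<cdot> \<psi> (a j))"
    proof (rule quot_map_cl[OF a])
      fix b assume "b \<in> carrier A" "pcong A p j b (a j)"
      then show "pcong A p (Suc j) ([p] \<cdot> \<psi> b) ([p] \<cdot> \<psi> (a j))"
        using pcong_scale[OF pcong_hom[OF _ a is_cring \<psi>_hom], of p j b 1] \<psi>_closed[OF a] by simp
    qed (simp add: \<psi>_closed)
    then show ?thesis using j by (simp add: cls_def)
  qed
  moreover have "\<zero>\<^bsub>Q 0\<^esub> = cl 0 \<zero>"
    by (simp add: ring_hom_zero[OF cl_hom ring_axioms cring.axioms(1)[OF Q_cring]])
  ultimately show ?thesis
    unfolding E_V_def el_def A_eq phi_inv_eq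
    by (auto simp: cls_def[of "Suc n"] ver_seq_def intro!: restrict_ext split: nat.split)
qed

lemma good_F: "good (Suc n) x a \<Longrightarrow> good n (frob {..<n} x) (\<lambda>i. \<phi> (a (Suc i)))"
  by (simp add: good_def seq_def trunc_frob_closed)

lemma good_V: "good n x a \<Longrightarrow> good (Suc n) (ver {..<Suc n} x) (ver_seq a)"
  by (auto simp: good_def seq_def trunc_ver_closed ver_seq_def \<psi>_closed split: nat.split)

lemma good_d: "good n x a \<Longrightarrow> good n (Wzero n) (coeffs n x)"
  by (simp add: good_def seq_def coeffs_closed)

lemma good_res: "good (Suc n) x a \<Longrightarrow> good n (restrict x {..<n}) a"
  unfolding good_def seq_def using trunc_restrict_closed by auto

lemma good_lam: "x \<in> vec {..<n} \<Longrightarrow> good n x zeros"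
  by (simp add: good_def seq_zeros)

text \<open>Vanishing parts are returned as equations of representatives, ready for rewriting.
  Conversely \<open>grI\<close> asks for zeros only below \<open>n\<close>, since later entries do
  not affect the class.\<close>

lemma grD:
  assumes "z \<in> gr n i"
  obtains x a where "good n x a" "z = el n x a" "i \<noteq> 0 \<Longrightarrow> x = Wzero n" "i \<noteq> 1 \<Longrightarrow> a = zeros"
proof -
  consider "i = 0" | "i = 1" | "i \<noteq> 0" "i \<noteq> 1" by blast
  then show ?thesis
  proof cases
    case 1
    then obtain x where "x \<in> vec {..<n}" "z = el n x zeros"
      using assms by (auto simp: E_gr_def A_eq E1_one el_def Let_def)
    then show ?thesis using that[of x zeros] 1 by (simp add: good_lam)
  next
    case 2
    then obtain m where "m \<in> carrier (E1 p k n)" "z = (Wzero n, m)"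
      using assms by (auto simp: E_gr_def A_eq Let_def)
    then obtain a where "seq n a" "z = el n (Wzero n) a" by (auto simp: el_def elim: cls_cases)
    then show ?thesis using that[of "Wzero n" a] 2 by (simp add: good_def)
  next
    case 3
    then have "z = el n (Wzero n) zeros"
      using assms by (auto simp: E_gr_def A_eq E1_one el_def Let_def)
    then show ?thesis using that[of "Wzero n" zeros] by (simp add: good_zero)
  qed
qed

lemma grI:
  assumes "good n x a" "i \<noteq> 0 \<Longrightarrow> x = Wzero n" "i \<noteq> 1 \<Longrightarrow> (\<And>j. j < n \<Longrightarrow> a j = \<zero>)"
  shows "el n x a \<in> gr n i"
proof -
  have "cls n a = cls n zeros" if "i \<noteq> 1" using assms(3)[OF that] by (rule cls_cong)
  then show ?thesis using assms(1,2) cls_closed[OF goodD(2)[OF assms(1)]]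
    by (auto simp: E_gr_def A_eq E1_one el_def Let_def good_def)
qed

lemma Wn_null:
  assumes "x \<in> vec {..<n}"
  shows "Wzero n \<otimes>\<^bsub>Wt n\<^esub> x = Wzero n" "x \<otimes>\<^bsub>Wt n\<^esub> Wzero n = Wzero n"
    and "Wzero n \<oplus>\<^bsub>Wt n\<^esub> x = x" "x \<oplus>\<^bsub>Wt n\<^esub> Wzero n = x"
proof -
  interpret Wn: cring "Wt n" by (rule trunc_cring)
  have "x \<in> carrier (Wt n)" using assms by simp
  then show "Wzero n \<otimes>\<^bsub>Wt n\<^esub> x = Wzero n" "x \<otimes>\<^bsub>Wt n\<^esub> Wzero n = Wzero n"
    "Wzero n \<oplus>\<^bsub>Wt n\<^esub> x = x" "x \<oplus>\<^bsub>Wt n\<^esub> Wzero n = x"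
    by (rule Wn.l_null Wn.r_null Wn.l_zero Wn.r_zero)+
qed

lemma el_mult_positive:
  assumes "good n (Wzero n) a" "good n (Wzero n) b"
  shows "el n (Wzero n) a \<otimes>\<^bsub>En n\<^esub> el n (Wzero n) b = \<zero>\<^bsub>En n\<^esub>"
  unfolding el_mult[OF assms] el_zero
  by (rule el_cong) (use Wn_null seqD[OF goodD(2)[OF assms(1)]] seqD[OF goodD(2)[OF assms(2)]] in auto)

lemma gr_subset: "gr n i \<subseteq> carrier (En n)"
  by (auto elim!: grD intro: el_closed)

lemma gr_additive_subgroup: "additive_subgroup (gr n i) (En n)"
proof -
  interpret E: cring "En n" by (rule En_cring)
  interpret Wn: cring "Wt n" by (rule trunc_cring)
  have "subgroup (gr n i) (add_monoid (En n))"
  proof (rule E.add.subgroupI)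
    show "gr n i \<subseteq> carrier (En n)" by (rule gr_subset)
    have "el n (Wzero n) zeros \<in> gr n i" by (rule grI[OF good_zero]) simp_all
    then show "gr n i \<noteq> {}" by blast
    fix u assume u: "u \<in> gr n i"
    obtain x a where xa: "good n x a" "u = el n x a" "i \<noteq> 0 \<Longrightarrow> x = Wzero n" "i \<noteq> 1 \<Longrightarrow> a = zeros"
      using grD[OF u] by blast
    have "\<ominus>\<^bsub>En n\<^esub> u = el n (Wneg n x) (\<lambda>i. \<ominus> a i)"
      unfolding xa(2) by (rule E.minus_equality[OF el_neg[OF xa(1)] el_closed[OF xa(1)] el_closed[OF good_neg[OF xa(1)]]])
    then show "\<ominus>\<^bsub>En n\<^esub> u \<in> gr n i"
      using grI[OF good_neg[OF xa(1)], of i] xa(3,4) Wn.minus_zero by (simp add: Wneg_def)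
    fix v assume v: "v \<in> gr n i"
    obtain y b where yb: "good n y b" "v = el n y b" "i \<noteq> 0 \<Longrightarrow> y = Wzero n" "i \<noteq> 1 \<Longrightarrow> b = zeros"
      using grD[OF v] by blast
    show "u \<oplus>\<^bsub>En n\<^esub> v \<in> gr n i"
      unfolding xa(2) yb(2) el_add[OF xa(1) yb(1)]
      by (rule grI[OF good_add[OF xa(1) yb(1)]]) (use xa(3,4) yb(3,4) Wn_null(3)[of "Wzero n" n] in auto)
  qed
  then show ?thesis by (rule additive_subgroup.intro)
qed

text \<open>Only the degrees 0 and 1 can be nonzero, so the sum over the support of
  \<open>c\<close>, which varies with \<open>c\<close>, equals \<open>c 0 \<oplus> c 1\<close>. The
  decomposition is then that of a pair.\<close>

lemma gr_direct_sum:
  assumes "z \<in> carrier (En n)"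
  shows "\<exists>!c. (\<forall>i. c i \<in> gr n i) \<and> finite {i. c i \<noteq> \<zero>\<^bsub>En n\<^esub>} \<and>
    z = (\<Oplus>\<^bsub>En n\<^esub>i\<in>{i. c i \<noteq> \<zero>\<^bsub>En n\<^esub>}. c i)"
proof -
  interpret E: cring "En n" by (rule En_cring)
  have support: "{i. c i \<noteq> \<zero>\<^bsub>En n\<^esub>} \<subseteq> {0, 1}" if c: "\<forall>i. c i \<in> gr n i" for c
  proof
    fix i assume "i \<in> {i. c i \<noteq> \<zero>\<^bsub>En n\<^esub>}"
    moreover obtain x a where "c i = el n x a" "i \<noteq> 0 \<Longrightarrow> x = Wzero n" "i \<noteq> 1 \<Longrightarrow> a = zeros"
      using c by (metis grD)
    ultimately show "i \<in> {0, 1}" by (auto simp: el_zero)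
  qed
  have sum: "(\<Oplus>\<^bsub>En n\<^esub>i\<in>{i. c i \<noteq> \<zero>\<^bsub>En n\<^esub>}. c i) = c 0 \<oplus>\<^bsub>En n\<^esub> c 1"
    if c: "\<forall>i. c i \<in> gr n i" for c
  proof -
    have cc: "c i \<in> carrier (En n)" for i using c gr_subset by blast
    have "(\<Oplus>\<^bsub>En n\<^esub>i\<in>{i. c i \<noteq> \<zero>\<^bsub>En n\<^esub>}. c i) = (\<Oplus>\<^bsub>En n\<^esub>i\<in>{0, 1}. c i)"
      by (rule E.add.finprod_mono_neutral_cong_left) (use support[OF c] cc in auto)
    also have "\<dots> = c 0 \<oplus>\<^bsub>En n\<^esub> c 1" using cc by simp
    finally show ?thesis .
  qed
  obtain x a where xa: "good n x a" and z: "z = el n x a" using el_cases[OF assms] .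
  have good: "good n x zeros" "good n (Wzero n) a" using xa by (simp_all add: good_def seq_zeros)
  define c where "c i = (if i = 0 then el n x zeros else if i = 1 then el n (Wzero n) a
    else el n (Wzero n) zeros)" for i :: nat
  have c_gr: "\<forall>i. c i \<in> gr n i"
    unfolding c_def by (auto intro!: grI good good_zero)
  show ?thesis
  proof (rule ex1I[of _ c])
    have "c 0 \<oplus>\<^bsub>En n\<^esub> c 1 = z"
      unfolding c_def z using el_add[OF good]
      by (simp add: Wn_null(4)[OF goodD(1)[OF xa]])
        (rule el_cong, use seqD[OF goodD(2)[OF xa]] in auto)
    then show "(\<forall>i. c i \<in> gr n i) \<and> finite {i. c i \<noteq> \<zero>\<^bsub>En n\<^esub>} \<and>
        z = (\<Oplus>\<^bsub>En n\<^esub>i\<in>{i. c i \<noteq> \<zero>\<^bsub>En n\<^esub>}. c i)"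
      using c_gr sum[OF c_gr] finite_subset[OF support[OF c_gr]] by simp
    fix e assume e: "(\<forall>i. e i \<in> gr n i) \<and> finite {i. e i \<noteq> \<zero>\<^bsub>En n\<^esub>} \<and>
        z = (\<Oplus>\<^bsub>En n\<^esub>i\<in>{i. e i \<noteq> \<zero>\<^bsub>En n\<^esub>}. e i)"
    then have gr: "\<forall>i. e i \<in> gr n i" and z_eq: "z = e 0 \<oplus>\<^bsub>En n\<^esub> e 1"
      using sum by auto
    obtain y where y: "good n y zeros" "e 0 = el n y zeros" using gr[rule_format, of 0]
      by (elim grD) auto
    obtain b where b: "good n (Wzero n) b" "e 1 = el n (Wzero n) b" using gr[rule_format, of 1]
      by (elim grD) auto
    have "z = el n (y \<oplus>\<^bsub>Wt n\<^esub> Wzero n) (\<lambda>i. \<zero> \<oplus> b i)"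
      using z_eq y(2) b(2) el_add[OF y(1) b(1)] by simp
    also have "\<dots> = el n y b"
      by (rule el_cong) (use Wn_null(4)[OF goodD(1)[OF y(1)]] seqD[OF goodD(2)[OF b(1)]] in auto)
    finally have "x = y" "cls n a = cls n b" unfolding z by (simp_all add: el_def)
    then have "e 0 = c 0" "e 1 = c 1" using y(2) b(2) by (simp_all add: c_def el_def)
    moreover have "e i = c i" if "i \<noteq> 0" "i \<noteq> 1" for i
      using support[OF gr] that by (auto simp: c_def el_zero)
    ultimately show "e = c" by (metis ext)
  qed
qed

lemma En_dg_ring: "graded_commutative_dg_ring (En n) (gr n) (dE n)"
proof -
  interpret E: cring "En n" by (rule En_cring)
  interpret Wn: cring "Wt n" by (rule trunc_cring)
  have zero_mult: "u \<otimes>\<^bsub>En n\<^esub> v = \<zero>\<^bsub>En n\<^esub>"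
    if "u \<in> gr n i" "v \<in> gr n j" "i \<noteq> 0" "j \<noteq> 0" for u v i j
    using grD[OF that(1)] grD[OF that(2)] that(3,4) el_mult_positive by metis
  have carr: "u \<in> carrier (En n)" if "u \<in> gr n i" for u i using that gr_subset by blast
  show ?thesis
  proof (rule graded_commutative_dg_ring.intro[OF E.ring_axioms], rule graded_commutative_dg_ring_axioms.intro)
    show "dE n \<in> hom (add_monoid (En n)) (add_monoid (En n))"
    proof (rule homI)
      fix u assume "u \<in> carrier (add_monoid (En n))"
      then have u: "u \<in> carrier (En n)" by simp
      obtain x a where xa: "good n x a" and u_eq: "u = el n x a" using el_cases[OF u] .
      show "dE n u \<in> carrier (add_monoid (En n))"
        using el_closed[OF good_d[OF xa]] by (simp add: u_eq E_d_el)
      fix v assume "v \<in> carrier (add_monoid (En n))"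
      then have v: "v \<in> carrier (En n)" by simp
      obtain y b where yb: "good n y b" and v_eq: "v = el n y b" using el_cases[OF v] .
      have "dE n (u \<oplus>\<^bsub>En n\<^esub> v) = dE n u \<oplus>\<^bsub>En n\<^esub> dE n v"
        unfolding u_eq v_eq el_add[OF xa yb] E_d_el el_add[OF good_d[OF xa] good_d[OF yb]]
        by (rule el_cong) (use Wn_null(3)[of "Wzero n" n] coeffs_add goodD(1)[OF xa] goodD(1)[OF yb] in auto)
      then show "dE n (u \<otimes>\<^bsub>add_monoid (En n)\<^esub> v) =
          dE n u \<otimes>\<^bsub>add_monoid (En n)\<^esub> dE n v" by simp
    qed
  next
    show "additive_subgroup (gr n i) (En n)" for i by (rule gr_additive_subgroup)
  next
    show "\<exists>!c. (\<forall>i. c i \<in> gr n i) \<and> finite {i. c i \<noteq> \<zero>\<^bsub>En n\<^esub>} \<and>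
        z = (\<Oplus>\<^bsub>En n\<^esub>i\<in>{i. c i \<noteq> \<zero>\<^bsub>En n\<^esub>}. c i)" if "z \<in> carrier (En n)" for z
      by (rule gr_direct_sum[OF that])
  next
    show "\<one>\<^bsub>En n\<^esub> \<in> gr n 0" unfolding el_one by (rule grI[OF good_one]) simp_all
  next
    fix u v i j assume u: "u \<in> gr n i" and v: "v \<in> gr n j"
    obtain x a where xa: "good n x a" and u_eq: "u = el n x a"
      and x0: "i \<noteq> 0 \<Longrightarrow> x = Wzero n" and a0: "i \<noteq> 1 \<Longrightarrow> a = zeros" using grD[OF u] by blast
    obtain y b where yb: "good n y b" and v_eq: "v = el n y b"
      and y0: "j \<noteq> 0 \<Longrightarrow> y = Wzero n" and b0: "j \<noteq> 1 \<Longrightarrow> b = zeros" using grD[OF v] by blast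
    note x = goodD(1)[OF xa] and y = goodD(1)[OF yb]
    note a = seqD[OF goodD(2)[OF xa]] and b = seqD[OF goodD(2)[OF yb]]
    note t = tghost_closed[OF _ x x] tghost_closed[OF _ y y]
    show "u \<otimes>\<^bsub>En n\<^esub> v \<in> gr n (i + j)"
      unfolding u_eq v_eq el_mult[OF xa yb]
    proof (rule grI[OF good_mult[OF xa yb]])
      show "x \<otimes>\<^bsub>Wt n\<^esub> y = Wzero n" if "i + j \<noteq> 0"
        using that x0 y0 Wn_null(1)[OF y] Wn_null(2)[OF x] by (cases "i = 0") auto
      fix l assume l: "i + j \<noteq> 1" "l < n"
      consider "i = 0" "j = 0" | "i = 0" "j \<noteq> 0" "j \<noteq> 1" | "j = 0" "i \<noteq> 0" "i \<noteq> 1" | "i \<noteq> 0" "j \<noteq> 0"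
        using l(1) by (cases "i = 0"; cases "j = 0") auto
      then show "tghost l x \<otimes> b l \<oplus> tghost l y \<otimes> a l = \<zero>"
        by cases (use x0 y0 a0 b0 a[OF l(2)] b[OF l(2)] t[OF l(2)] l(2) in simp_all)
    qed
    \<comment> \<open>If one degree is 0 the sign is positive and the total ring is commutative; if
      both are positive, both products vanish.\<close>
    show "u \<otimes>\<^bsub>En n\<^esub> v = [((- 1 :: int) ^ (i * j))] \<cdot>\<^bsub>En n\<^esub> (v \<otimes>\<^bsub>En n\<^esub> u)"
    proof (cases "i = 0 \<or> j = 0")
      case True
      then have "(- 1 :: int) ^ (i * j) = 1" by auto
      then show ?thesis
        using E.m_comm[OF carr[OF u] carr[OF v]] E.add.int_pow_1[OF E.m_closed[OF carr[OF v] carr[OF u]]]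
        by simp
    next
      case False
      then show ?thesis using zero_mult[OF u v] zero_mult[OF v u] E.add.int_pow_one by simp
    qed
    let ?s = "[((- 1 :: int) ^ i)] \<cdot>\<^bsub>En n\<^esub> (u \<otimes>\<^bsub>En n\<^esub> dE n v)"
    show "dE n (u \<otimes>\<^bsub>En n\<^esub> v) = (dE n u \<otimes>\<^bsub>En n\<^esub> v) \<oplus>\<^bsub>En n\<^esub> ?s"
    proof -
      let ?du = "el n (Wzero n) (\<lambda>l. tghost l y \<otimes> coeffs n x l)"
      let ?dv = "el n (Wzero n) (\<lambda>l. tghost l x \<otimes> coeffs n y l)"
      have gu: "good n (Wzero n) (\<lambda>l. tghost l y \<otimes> coeffs n x l)"
        and gv: "good n (Wzero n) (\<lambda>l. tghost l x \<otimes> coeffs n y l)"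
        using seq_act[OF y goodD(2)[OF good_d[OF xa]]] seq_act[OF x goodD(2)[OF good_d[OF yb]]]
        by (simp_all add: good_def)
      have du: "dE n u \<otimes>\<^bsub>En n\<^esub> v = ?du"
        unfolding u_eq v_eq E_d_el el_mult[OF good_d[OF xa] yb]
        by (rule el_cong) (use Wn_null(1)[OF y] b t coeffs_closed[OF x] in auto)
      have dv: "u \<otimes>\<^bsub>En n\<^esub> dE n v = ?dv"
        unfolding u_eq v_eq E_d_el el_mult[OF xa good_d[OF yb]]
        by (rule el_cong) (use Wn_null(2)[OF x] a t coeffs_closed[OF y] in auto)
      \<comment> \<open>In positive degree the component \<open>x\<close> is zero, so the term
        vanishes and its sign does not matter; in degree 0 the sign is positive.\<close>
      have s: "?s = ?dv"
      proof (cases "i = 0")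
        case True
        then show ?thesis unfolding dv using E.add.int_pow_1[OF el_closed[OF gv]] by simp
      next
        case False
        have "?dv = \<zero>\<^bsub>En n\<^esub>" unfolding el_zero
          by (rule el_cong) (use x0[OF False] coeffs_closed[OF y] in auto)
        then show ?thesis unfolding dv using E.add.int_pow_one by simp
      qed
      have "dE n (u \<otimes>\<^bsub>En n\<^esub> v) = el n (Wzero n) (coeffs n (x \<otimes>\<^bsub>Wt n\<^esub> y))"
        unfolding u_eq v_eq el_mult[OF xa yb] E_d_el ..
      also have "\<dots> = ?du \<oplus>\<^bsub>En n\<^esub> ?dv"
        unfolding el_add[OF gu gv]
      proof (rule el_eqI)
        show "Wzero n = Wzero n \<oplus>\<^bsub>Wt n\<^esub> Wzero n" using Wn_null(3)[of "Wzero n" n] by simp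
        show "seq n (coeffs n (x \<otimes>\<^bsub>Wt n\<^esub> y))" by (rule goodD(2)[OF good_d[OF good_mult[OF xa yb]]])
        show "seq n (\<lambda>l. tghost l y \<otimes> coeffs n x l \<oplus> tghost l x \<otimes> coeffs n y l)"
          by (rule seq_add[OF goodD(2)[OF gu] goodD(2)[OF gv]])
      qed (rule coeffs_mult[OF _ x y])
      finally show ?thesis unfolding du s .
    qed
  next
    fix u i assume u: "u \<in> gr n i"
    obtain x a where xa: "good n x a" and u_eq: "u = el n x a"
      and x0: "i \<noteq> 0 \<Longrightarrow> x = Wzero n" using grD[OF u] by blast
    show "dE n u \<in> gr n (Suc i)"
      unfolding u_eq E_d_el by (rule grI[OF good_d[OF xa]]) (use x0 coeffs_zero in auto)
  next
    fix u assume u: "u \<in> carrier (En n)"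
    obtain x a where xa: "good n x a" and u_eq: "u = el n x a" using el_cases[OF u] .
    show "dE n (dE n u) = \<zero>\<^bsub>En n\<^esub>"
      unfolding u_eq E_d_el el_zero by (rule el_cong) (use coeffs_zero in auto)
  qed
qed

end

section \<open>Compatibilities of restriction, Frobenius and Verschiebung\<close>

context perfect_witt_complex
begin

lemma el_add_pow:
  assumes "good n x a"
  shows "[(m::nat)] \<cdot>\<^bsub>En n\<^esub> el n x a = el n ([m] \<cdot>\<^bsub>Wt n\<^esub> x) (\<lambda>i. [m] \<cdot> a i) \<and>
    good n ([m] \<cdot>\<^bsub>Wt n\<^esub> x) (\<lambda>i. [m] \<cdot> a i)"
proof (induction m)
  case 0
  interpret E: cring "En n" by (rule En_cring)
  interpret Wn: cring "Wt n" by (rule trunc_cring)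
  show ?case using el_zero good_zero by simp
next
  case (Suc m)
  interpret E: cring "En n" by (rule En_cring)
  interpret Wn: cring "Wt n" by (rule trunc_cring)
  from Suc have eq: "[m] \<cdot>\<^bsub>En n\<^esub> el n x a = el n ([m] \<cdot>\<^bsub>Wt n\<^esub> x) (\<lambda>i. [m] \<cdot> a i)"
    and good: "good n ([m] \<cdot>\<^bsub>Wt n\<^esub> x) (\<lambda>i. [m] \<cdot> a i)" by blast+
  show ?case using el_add[OF good assms] good_add[OF good assms] eq by simp
qed

lemma trunc_frob_zero: "frob {..<n} (Wzero (Suc n)) = Wzero n"
  by (rule ring_hom_zero[OF trunc_frob_hom cring.axioms(1)[OF trunc_cring] cring.axioms(1)[OF trunc_cring]])

lemma trunc_restrict_zero: "restrict (Wzero (Suc n)) {..<n} = Wzero n"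
  by (rule ring_hom_zero[OF trunc_restrict_hom cring.axioms(1)[OF trunc_cring] cring.axioms(1)[OF trunc_cring]])

lemma trunc_ver_zero: "ver {..<Suc n} (Wzero n) = Wzero (Suc n)"
  by (auto simp: witt_ver_def witt_ring_zero teichmueller_def split: nat.split)

lemma E_res_hom: "E_res n \<in> ring_hom (En (Suc n)) (En n)"
proof (rule ring_hom_memI)
  fix u assume u: "u \<in> carrier (En (Suc n))"
  obtain x a where xa: "good (Suc n) x a" and u_eq: "u = el (Suc n) x a" using el_cases[OF u] .
  show "E_res n u \<in> carrier (En n)" unfolding u_eq E_res_el by (rule el_closed[OF good_res[OF xa]])
  fix v assume v: "v \<in> carrier (En (Suc n))"
  obtain y b where yb: "good (Suc n) y b" and v_eq: "v = el (Suc n) y b" using el_cases[OF v] .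
  have W: "x \<in> carrier (Wt (Suc n))" "y \<in> carrier (Wt (Suc n))"
    using goodD(1)[OF xa] goodD(1)[OF yb] by simp_all
  show "E_res n (u \<otimes>\<^bsub>En (Suc n)\<^esub> v) = E_res n u \<otimes>\<^bsub>En n\<^esub> E_res n v"
    unfolding u_eq v_eq el_mult[OF xa yb] E_res_el el_mult[OF good_res[OF xa] good_res[OF yb]]
    by (rule el_cong) (use ring_hom_mult[OF trunc_restrict_hom W] goodD(1)[OF xa] goodD(1)[OF yb]
        in \<open>simp_all add: tghost_restrict\<close>)
  show "E_res n (u \<oplus>\<^bsub>En (Suc n)\<^esub> v) = E_res n u \<oplus>\<^bsub>En n\<^esub> E_res n v"
    unfolding u_eq v_eq el_add[OF xa yb] E_res_el el_add[OF good_res[OF xa] good_res[OF yb]]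
    by (rule el_cong) (use ring_hom_add[OF trunc_restrict_hom W] in simp_all)
next
  show "E_res n \<one>\<^bsub>En (Suc n)\<^esub> = \<one>\<^bsub>En n\<^esub>"
    unfolding el_one E_res_el using ring_hom_one[OF trunc_restrict_hom] by (intro el_cong) simp_all
qed

lemma E_F_hom: "FE n \<in> ring_hom (En (Suc n)) (En n)"
proof (rule ring_hom_memI)
  fix u assume u: "u \<in> carrier (En (Suc n))"
  obtain x a where xa: "good (Suc n) x a" and u_eq: "u = el (Suc n) x a" using el_cases[OF u] .
  note x = goodD(1)[OF xa] and a = seqD[OF goodD(2)[OF xa]]
  show "FE n u \<in> carrier (En n)" unfolding u_eq E_F_el[OF xa] by (rule el_closed[OF good_F[OF xa]])
  fix v assume v: "v \<in> carrier (En (Suc n))"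
  obtain y b where yb: "good (Suc n) y b" and v_eq: "v = el (Suc n) y b" using el_cases[OF v] .
  note y = goodD(1)[OF yb] and b = seqD[OF goodD(2)[OF yb]]
  have W: "x \<in> carrier (Wt (Suc n))" "y \<in> carrier (Wt (Suc n))"
    using x y by simp_all
  note t = tghost_closed[OF _ x x] tghost_closed[OF _ y y]
  show "FE n (u \<otimes>\<^bsub>En (Suc n)\<^esub> v) = FE n u \<otimes>\<^bsub>En n\<^esub> FE n v"
    unfolding u_eq v_eq el_mult[OF xa yb] E_F_el[OF xa] E_F_el[OF yb] E_F_el[OF good_mult[OF xa yb]]
      el_mult[OF good_F[OF xa] good_F[OF yb]]
    by (rule el_cong) (use ring_hom_mult[OF trunc_frob_hom W] x y a b t
        in \<open>simp_all add: tghost_frob\<close>)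
  show "FE n (u \<oplus>\<^bsub>En (Suc n)\<^esub> v) = FE n u \<oplus>\<^bsub>En n\<^esub> FE n v"
    unfolding u_eq v_eq el_add[OF xa yb] E_F_el[OF xa] E_F_el[OF yb] E_F_el[OF good_add[OF xa yb]]
      el_add[OF good_F[OF xa] good_F[OF yb]]
    by (rule el_cong) (use ring_hom_add[OF trunc_frob_hom W] a b in simp_all)
next
  show "FE n \<one>\<^bsub>En (Suc n)\<^esub> = \<one>\<^bsub>En n\<^esub>"
    unfolding el_one E_F_el[OF good_one] using ring_hom_one[OF trunc_frob_hom] by (intro el_cong) simp_all
qed

lemma E_V_hom: "VE n \<in> hom (add_monoid (En n)) (add_monoid (En (Suc n)))"
proof (rule homI)
  fix u assume "u \<in> carrier (add_monoid (En n))"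
  then have u: "u \<in> carrier (En n)" by simp
  obtain x a where xa: "good n x a" and u_eq: "u = el n x a" using el_cases[OF u] .
  note x = goodD(1)[OF xa] and a = seqD[OF goodD(2)[OF xa]]
  show "VE n u \<in> carrier (add_monoid (En (Suc n)))"
    unfolding u_eq E_V_el[OF xa] using el_closed[OF good_V[OF xa]] by simp
  fix v assume "v \<in> carrier (add_monoid (En n))"
  then have v: "v \<in> carrier (En n)" by simp
  obtain y b where yb: "good n y b" and v_eq: "v = el n y b" using el_cases[OF v] .
  note y = goodD(1)[OF yb] and b = seqD[OF goodD(2)[OF yb]]
  have "VE n (u \<oplus>\<^bsub>En n\<^esub> v) = VE n u \<oplus>\<^bsub>En (Suc n)\<^esub> VE n v"
    unfolding u_eq v_eq el_add[OF xa yb] E_V_el[OF xa] E_V_el[OF yb] E_V_el[OF good_add[OF xa yb]]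
      el_add[OF good_V[OF xa] good_V[OF yb]]
  proof (rule el_cong)
    show "ver {..<Suc n} (x \<oplus>\<^bsub>Wt n\<^esub> y) =
        ver {..<Suc n} x \<oplus>\<^bsub>Wt (Suc n)\<^esub> ver {..<Suc n} y"
      by (rule trunc_ver_add[OF x y])
    show "ver_seq (\<lambda>i. a i \<oplus> b i) i = ver_seq a i \<oplus> ver_seq b i" if "i < Suc n" for i
      using that a b by (cases i) (simp_all add: ver_seq_def add.nat_pow_distrib \<psi>_closed)
  qed
  then show "VE n (u \<otimes>\<^bsub>add_monoid (En n)\<^esub> v) =
      VE n u \<otimes>\<^bsub>add_monoid (En (Suc n))\<^esub> VE n v" by simp
qed

text \<open>In degree one, \<psi> \<phi> = id handles the factors that come from \<open>u\<close>,
  and the twisted component of a Verschiebung supplies the \<open>p\<close> in the term where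
  \<open>v\<close> acts on the degree one part of \<open>u\<close>. At index 0 both sides are
  zero.\<close>

lemma E_V_module:
  assumes u: "u \<in> carrier (En (Suc n))" and v: "v \<in> carrier (En n)"
  shows "VE n (FE n u \<otimes>\<^bsub>En n\<^esub> v) = u \<otimes>\<^bsub>En (Suc n)\<^esub> VE n v"
proof -
  obtain x a where xa: "good (Suc n) x a" and u_eq: "u = el (Suc n) x a" using el_cases[OF u] .
  note x = goodD(1)[OF xa] and a = seqD[OF goodD(2)[OF xa]]
  obtain y b where yb: "good n y b" and v_eq: "v = el n y b" using el_cases[OF v] .
  note y = goodD(1)[OF yb] and b = seqD[OF goodD(2)[OF yb]]
  show ?thesis
    unfolding u_eq v_eq E_F_el[OF xa] E_V_el[OF yb] el_mult[OF good_F[OF xa] yb]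
      E_V_el[OF good_mult[OF good_F[OF xa] yb]] el_mult[OF xa good_V[OF yb]]
  proof (rule el_cong)
    show "ver {..<Suc n} (frob {..<n} x \<otimes>\<^bsub>Wt n\<^esub> y) =
        x \<otimes>\<^bsub>Wt (Suc n)\<^esub> ver {..<Suc n} y"
      by (rule trunc_ver_frob_mult[OF x y])
    fix i assume i: "i < Suc n"
    show "ver_seq (\<lambda>i. tghost i (frob {..<n} x) \<otimes> b i \<oplus> tghost i y \<otimes> \<phi> (a (Suc i))) i =
        tghost i x \<otimes> ver_seq b i \<oplus> tghost i (ver {..<Suc n} y) \<otimes> a i"
    proof (cases i)
      case 0
      then show ?thesis using a tghost_closed[OF _ x x] by (simp add: ver_seq_def tghost_ver_0)
    next
      case (Suc j)
      then have j: "j < n" "Suc j < Suc n" using i by simp_all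
      note closed = a[OF j(2)] b[OF j(1)] tghost_closed[OF j(2) x x] tghost_closed[OF j(1) y y]
      then show ?thesis
        using j unfolding Suc
        by (simp add: ver_seq_def tghost_frob[OF x] tghost_ver_Suc[OF y] \<psi>_\<phi> \<psi>_closed
            add.nat_pow_distrib add_pow_rdistr add_pow_ldistr)
    qed
  qed
qed

text \<open>The parts of degree 0 vanish on both sides. In degree one the power of [r] acts through
  the same power of its twisted component, which is the setting of
  \<open>coeffs_teichmueller\<close>.\<close>

lemma E_F_d_teichmueller:
  assumes r: "r \<in> carrier A"
  shows "FE n (dE (Suc n) (lamE (Suc n) (teich {..<Suc n} r))) =
    lamE n (teich {..<n} r [^]\<^bsub>Wt n\<^esub> (p - 1)) \<otimes>\<^bsub>En n\<^esub>
      dE n (lamE n (teich {..<n} r))"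
proof -
  interpret Wn: cring "Wt n" by (rule trunc_cring)
  let ?T = "teich {..<n} r" and ?T' = "teich {..<Suc n} r"
  have T: "?T \<in> vec {..<n}" "?T' \<in> vec {..<Suc n}" using r by simp_all
  have pow: "?T [^]\<^bsub>Wt n\<^esub> m \<in> vec {..<n}" for m :: nat
    using Wn.nat_pow_closed[of ?T m] T by simp
  have ghost_pow: "tghost i (?T [^]\<^bsub>Wt n\<^esub> m) = tghost i ?T [^] m" if "i < n" for i and m :: nat
    by (induction m) (use that T pow in \<open>simp_all add: tghost_mult\<close>)
  note gd = good_d[OF good_lam[OF T(1)]] and gd' = good_d[OF good_lam[OF T(2)]]
  have t: "tghost i ?T \<in> carrier A" if "i < n" for i by (rule tghost_closed[OF that T(1) T(1)])
  note c = coeffs_closed[OF T(1)] and c' = coeffs_closed[OF T(2)]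
  show ?thesis
    unfolding E_lam_el E_d_el E_F_el[OF gd'] el_mult[OF good_lam[OF pow] gd]
  proof (rule el_eqI)
    show "frob {..<n} (Wzero (Suc n)) = ?T [^]\<^bsub>Wt n\<^esub> (p - 1) \<otimes>\<^bsub>Wt n\<^esub> Wzero n"
      by (simp only: trunc_frob_zero Wn_null(2)[OF pow])
    show "seq n (\<lambda>i. \<phi> (coeffs (Suc n) ?T' (Suc i)))"
      by (rule goodD(2)[OF good_F[OF gd']])
    show "seq n (\<lambda>i. tghost i (?T [^]\<^bsub>Wt n\<^esub> (p - 1)) \<otimes> coeffs n ?T i
        \<oplus> tghost i (Wzero n) \<otimes> \<zero>)"
      by (rule goodD(2)[OF good_mult[OF good_lam[OF pow] gd]])
    show "pcong A p i (\<phi> (coeffs (Suc n) ?T' (Suc i)))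
        (tghost i (?T [^]\<^bsub>Wt n\<^esub> (p - 1)) \<otimes> coeffs n ?T i \<oplus> tghost i (Wzero n) \<otimes> \<zero>)"
      if i: "i < n" for i
      using coeffs_teichmueller[OF i r] t[OF i] c[OF i] i by (simp add: ghost_pow)
  qed
qed

theorem is_witt_complex:
  assumes algebra: "\<exists>h. h \<in> ring_hom (integers_localized_at p) A"
  shows "witt_complex p A (E_ring p k) gr dE E_res lamE FE VE"
proof (rule witt_complex.intro)
  show "prime p" "odd p" by (rule prime_p odd_p)+
  show "cring A" by (rule is_cring)
  show "\<exists>h. h \<in> ring_hom (integers_localized_at p) A" by (rule algebra)
  fix n :: nat
  show "graded_commutative_dg_ring (En n) (gr n) (dE n)" by (rule En_dg_ring)
  show "E_res n \<in> ring_hom (En (Suc n)) (En n)" by (rule E_res_hom)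
  show "FE n \<in> ring_hom (En (Suc n)) (En n)" by (rule E_F_hom)
  show "VE n \<in> hom (add_monoid (En n)) (add_monoid (En (Suc n)))" by (rule E_V_hom)
  show "lamE n \<in> ring_hom (Wt n) (En n)"
  proof (rule ring_hom_memI)
    fix x assume "x \<in> carrier (Wt n)"
    then have x: "x \<in> vec {..<n}" by simp
    show "lamE n x \<in> carrier (En n)" unfolding E_lam_el by (rule el_closed[OF good_lam[OF x]])
    fix y assume "y \<in> carrier (Wt n)"
    then have y: "y \<in> vec {..<n}" by simp
    show "lamE n (x \<otimes>\<^bsub>Wt n\<^esub> y) = lamE n x \<otimes>\<^bsub>En n\<^esub> lamE n y"
      unfolding E_lam_el el_mult[OF good_lam[OF x] good_lam[OF y]]
      by (rule el_cong) (use tghost_closed[OF _ x x] tghost_closed[OF _ y y] in simp_all)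
    show "lamE n (x \<oplus>\<^bsub>Wt n\<^esub> y) = lamE n x \<oplus>\<^bsub>En n\<^esub> lamE n y"
      unfolding E_lam_el el_add[OF good_lam[OF x] good_lam[OF y]] by (rule el_cong) simp_all
  next
    show "lamE n \<one>\<^bsub>Wt n\<^esub> = \<one>\<^bsub>En n\<^esub>" unfolding E_lam_el el_one ..
  qed
  show "FE n (dE (Suc n) (lamE (Suc n) (teich {..<Suc n} r))) =
      lamE n (teich {..<n} r [^]\<^bsub>Wt n\<^esub> (p - 1)) \<otimes>\<^bsub>En n\<^esub>
        dE n (lamE n (teich {..<n} r))" if "r \<in> carrier A" for r
    by (rule E_F_d_teichmueller[OF that])
  {
    fix w assume "w \<in> carrier (Wt n)"
    then have w: "w \<in> vec {..<n}" by simp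
    show "lamE n w \<in> gr n 0" unfolding E_lam_el by (rule grI[OF good_lam[OF w]]) simp_all
    show "VE n (lamE n w) = lamE (Suc n) (ver {..<Suc n} w)"
      unfolding E_lam_el E_V_el[OF good_lam[OF w]]
      by (rule el_cong) (simp_all add: ver_seq_def split: nat.split)
  next
    fix w assume "w \<in> carrier (Wt (Suc n))"
    then have w: "w \<in> vec {..<Suc n}" by simp
    show "E_res n (lamE (Suc n) w) = lamE n (restrict w {..<n})"
      unfolding E_lam_el E_res_el ..
    show "FE n (lamE (Suc n) w) = lamE n (frob {..<n} w)"
      unfolding E_lam_el E_F_el[OF good_lam[OF w]] by (rule el_cong) simp_all
  next
    fix u i assume u: "u \<in> gr (Suc n) i"
    obtain x a where xa: "good (Suc n) x a" and u_eq: "u = el (Suc n) x a"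
      and x0: "i \<noteq> 0 \<Longrightarrow> x = Wzero (Suc n)" and a0: "i \<noteq> 1 \<Longrightarrow> a = zeros" using grD[OF u] by blast
    show "E_res n u \<in> gr n i"
      unfolding u_eq E_res_el by (rule grI[OF good_res[OF xa]]) (use x0 a0 trunc_restrict_zero in auto)
    show "FE n u \<in> gr n i"
      unfolding u_eq E_F_el[OF xa] by (rule grI[OF good_F[OF xa]]) (use x0 a0 trunc_frob_zero in auto)
  next
    fix u i assume u: "u \<in> gr n i"
    obtain x a where xa: "good n x a" and u_eq: "u = el n x a"
      and x0: "i \<noteq> 0 \<Longrightarrow> x = Wzero n" and a0: "i \<noteq> 1 \<Longrightarrow> a = zeros" using grD[OF u] by blast
    show "VE n u \<in> gr (Suc n) i"
      unfolding u_eq E_V_el[OF xa] by (rule grI[OF good_V[OF xa]])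
        (use x0 a0 trunc_ver_zero in \<open>auto simp: ver_seq_def split: nat.split\<close>)
  next
    fix u assume u: "u \<in> carrier (En (Suc n))"
    obtain x a where xa: "good (Suc n) x a" and u_eq: "u = el (Suc n) x a" using el_cases[OF u] .
    show "E_res n (dE (Suc n) u) = dE n (E_res n u)"
      unfolding u_eq E_d_el E_res_el
      by (rule el_cong) (use coeffs_restrict[OF _ goodD(1)[OF xa]] trunc_restrict_zero in auto)
    show "VE n (E_res n u) = E_res (Suc n) (VE (Suc n) u)"
      unfolding u_eq E_res_el E_V_el[OF xa] E_V_el[OF good_res[OF xa]]
      by (rule el_cong) (simp_all add: trunc_ver_restrict)
    fix v assume v: "v \<in> carrier (En n)"
    show "VE n (FE n u \<otimes>\<^bsub>En n\<^esub> v) = u \<otimes>\<^bsub>En (Suc n)\<^esub> VE n v"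
      by (rule E_V_module[OF u v])
    have c: "FE n u \<in> carrier (En n)" "VE n v \<in> carrier (En (Suc n))"
      using ring_hom_closed[OF E_F_hom u] hom_in_carrier[OF E_V_hom, of v n] v by simp_all
    \<comment> \<open>The total ring is commutative, as products of degree one elements vanish, so
      the right-hand rule follows from the left-hand one.\<close>
    show "VE n (v \<otimes>\<^bsub>En n\<^esub> FE n u) = VE n v \<otimes>\<^bsub>En (Suc n)\<^esub> u"
      using E_V_module[OF u v] cring.cring_simprules(14)[OF En_cring] u v c by metis
  next
    fix u assume u: "u \<in> carrier (En (Suc (Suc n)))"
    obtain x a where xa: "good (Suc (Suc n)) x a" and u_eq: "u = el (Suc (Suc n)) x a" using el_cases[OF u] .
    show "FE n (E_res (Suc n) u) = E_res n (FE (Suc n) u)"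
      unfolding u_eq E_res_el E_F_el[OF xa] E_F_el[OF good_res[OF xa]]
      by (rule el_cong) (simp_all add: trunc_frob_restrict[OF goodD(1)[OF xa]])
  next
    fix u assume u: "u \<in> carrier (En n)"
    obtain x a where xa: "good n x a" and u_eq: "u = el n x a" using el_cases[OF u] .
    note x = goodD(1)[OF xa] and a = seqD[OF goodD(2)[OF xa]]
    \<comment> \<open>The coefficient of the Verschiebung at index i + 1 is \<psi> of the
      coefficient of \<open>x\<close> at i. Frobenius shifts it back and applies \<phi>.\<close>
    show "FE n (dE (Suc n) (VE n u)) = dE n u"
      unfolding u_eq E_V_el[OF xa] E_d_el E_F_el[OF good_d[OF good_V[OF xa]]]
      by (rule el_cong) (simp_all add: trunc_frob_zero coeffs_ver[OF _ x] \<phi>_\<psi> coeffs_closed[OF x])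
    show "FE n (VE n u) = [p] \<cdot>\<^bsub>En n\<^esub> u"
      unfolding u_eq E_V_el[OF xa] E_F_el[OF good_V[OF xa]] conjunct1[OF el_add_pow[OF xa]]
      by (rule el_cong) (use a in \<open>simp_all add: trunc_frob_ver[OF x] ver_seq_def \<phi>_add_pow \<phi>_\<psi> \<psi>_closed\<close>)
  }
qed

end

theorem theorem3p7:
  fixes p :: nat and k :: "('a, 'b) ring_scheme"
  assumes "prime p" and "p > 2"
    and "perfect_ring_of_char p k"
  shows "witt_complex p (witt_ring p k)
           (E_ring p k) (E_gr p k) (E_d p k) E_res (E_lam p k) (E_F p k) (E_V p k)"
proof -
  interpret k: cring k using assms(3) by (simp add: perfect_ring_of_char_def)
  interpret k: perfect_ring_witt_vectors k p
    by unfold_locales (use assms prime_odd_nat in auto)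
  interpret A: perfect_witt_complex "witt_ring p k" p "phi p k" k
    by (intro perfect_witt_complex.intro perfect_witt_complex_axioms.intro
        k.A_bijective_frobenius_lift refl)
  show ?thesis
    by (rule A.is_witt_complex) (rule k.A.integers_localized_hom[OF assms(1) k.A_unit])
qed

end
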